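(* Let $d\ge3$ and let $k$ be a field with $\mathrm{char}\,k=0$ or $\mathrm{char}\,k>d$. Let $l/k$ be a finite separable field extension and let $\varphi=tr_{l/k}(\Gamma)$ be a nondegenerate form of degree $d$ over $k$, where $\Gamma$ is an absolutely indecomposable form of degree $d$ over $l$. Let $\overline{k}$ be the algebraic closure of $k$ (containing $l$) and let $\sigma_1,\dots,\sigma_n$ be the distinct $k$-algebra isomorphisms from $l$ into $\overline{k}$. Let $X=(x_1,\dots,x_N)$, $N=\dim_k\varphi$, be independent indeterminates and $\overline{K}=\overline{k}(X)$. If $n<d$ and $\varphi(X)^s\notin G(\Gamma_{\overline{K}})$ for all integers $s$ with $1\le s\le n$, then $\varphi$ is not strongly multiplicative.
   Context: A form of degree $d$ on a finite-dimensional vector space $V$ over a field $F$ is a map $\varphi:V\to F$ which in coordinates is given by a homogeneous polynomial of degree $d$; it corresponds to a unique symmetric $d$-linear form $\theta$ with $\varphi(v)=\theta(v,\dots,v)$, and it is nondegenerate if $v=0$ is the only vector with $\theta(v,v_2,\dots,v_d)=0$ for all $v_i\in V$. All forms considered are nondegenerate. Two forms are isomorphic ($\cong$) if they correspond to each other under a bijective linear map of the underlying spaces. A nonzero form is decomposable if it is isomorphic to an orthogonal sum $\varphi_1\perp\varphi_2$ (i.e. $u_1+u_2\mapsto\varphi_1(u_1)+\varphi_2(u_2)$ on $V_1\oplus V_2$) of two forms on nonzero spaces, and indecomposable otherwise; it is absolutely indecomposable if it stays indecomposable after extension of scalars to the algebraic closure of its base field. For a form $\Gamma:V\to l$ over $l$,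 $tr_{l/k}(\Gamma)$ is the form of degree $d$ over $k$ on $V$ regarded as a $k$-vector space given by $v\mapsto tr_{l/k}(\Gamma(v))$, where $tr_{l/k}$ is the trace of $l/k$. $\Gamma_{\overline K}$ is the extension of scalars of $\Gamma$ along $l\subset\overline k\subset\overline K$. $\varphi(X)$ denotes the generic value of $\varphi$, i.e. the homogeneous polynomial representing $\varphi$ in some basis. For a form $\psi$ over a field $F$, $G(\psi)=\{a\in F^\times\mid a\psi\cong\psi\}$. $\varphi$ is strongly multiplicative if $\varphi(X)\varphi\cong\varphi$ over $k(X)$. *)

theory Defs
  imports
    "HOL-Analysis.Cartesian_Space"
    "HOL-Analysis.Product_Vector"
    "HOL-Computational_Algebra.Computational_Algebra"
    "HOL-Library.Poly_Mapping"
    "Subresultants.More_Homomorphisms"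
begin

section \<open>Homogeneous polynomials\<close>

text \<open>Polynomials over \<open>'a\<close> in variables indexed by \<open>'i\<close> are elements of
  \<open>('i \<Rightarrow>\<^sub>0 nat) \<Rightarrow>\<^sub>0 'a\<close>: a monomial is its finitely supported exponent function.\<close>

definition homogeneous_poly :: "nat \<Rightarrow> (('i \<Rightarrow>\<^sub>0 nat) \<Rightarrow>\<^sub>0 'a::zero) \<Rightarrow> bool" where
  "homogeneous_poly d p \<longleftrightarrow>
     (\<forall>m \<in> Poly_Mapping.keys p. (\<Sum>i \<in> Poly_Mapping.keys m. Poly_Mapping.lookup m i) = d)"

text \<open>Evaluation at \<open>x\<close> after applying \<open>h\<close> to the coefficients.\<close>

definition eval_poly_at ::
    "('a::zero \<Rightarrow> 'b::comm_semiring_1) \<Rightarrow> (('i \<Rightarrow>\<^sub>0 nat) \<Rightarrow>\<^sub>0 'a) \<Rightarrow> ('i \<Rightarrow> 'b) \<Rightarrow> 'b" where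
  "eval_poly_at h p x =
     (\<Sum>m \<in> Poly_Mapping.keys p. h (Poly_Mapping.lookup p m) *
        (\<Prod>i \<in> Poly_Mapping.keys m. x i ^ Poly_Mapping.lookup m i))"

section \<open>Forms of higher degree\<close>

text \<open>A vector space is given by a scalar multiplication \<open>s\<close> (turning the whole type into a
  vector space) together with a subspace \<open>V\<close>; only the values of a form on \<open>V\<close> matter.\<close>

definition basis_family ::
    "('f::field \<Rightarrow> 'v::ab_group_add \<Rightarrow> 'v) \<Rightarrow> 'i set \<Rightarrow> ('i \<Rightarrow> 'v) \<Rightarrow> 'v set \<Rightarrow> bool" where
  "basis_family s I b V \<longleftrightarrow>
     finite I \<and> inj_on b I \<and> \<not> module.dependent s (b ` I) \<and> module.span s (b ` I) = V"

definition represented_by ::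
    "('f::field \<Rightarrow> 'v::ab_group_add \<Rightarrow> 'v) \<Rightarrow> 'i set \<Rightarrow> ('i \<Rightarrow> 'v) \<Rightarrow> nat \<Rightarrow> ('v \<Rightarrow> 'f) \<Rightarrow>
     (('i \<Rightarrow>\<^sub>0 nat) \<Rightarrow>\<^sub>0 'f) \<Rightarrow> bool" where
  "represented_by s I b d \<phi> p \<longleftrightarrow>
     homogeneous_poly d p \<and> (\<forall>m \<in> Poly_Mapping.keys p. Poly_Mapping.keys m \<subseteq> I) \<and>
     (\<forall>x. \<phi> (\<Sum>i\<in>I. s (x i) (b i)) = eval_poly_at id p x)"

definition form_on ::
    "('f::field \<Rightarrow> 'v::ab_group_add \<Rightarrow> 'v) \<Rightarrow> 'v set \<Rightarrow> nat \<Rightarrow> ('v \<Rightarrow> 'f) \<Rightarrow> bool" where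
  "form_on s V d \<phi> \<longleftrightarrow>
     vector_space s \<and> (\<exists>B p. basis_family s B id V \<and> represented_by s B id d \<phi> p)"

text \<open>A function of \<open>d\<close> vector arguments is represented as a function of lists of length \<open>d\<close>.\<close>

definition symmetric_multilinear_on ::
    "('f::field \<Rightarrow> 'v::ab_group_add \<Rightarrow> 'v) \<Rightarrow> 'v set \<Rightarrow> nat \<Rightarrow> ('v list \<Rightarrow> 'f) \<Rightarrow> bool" where
  "symmetric_multilinear_on s V d \<theta> \<longleftrightarrow>
     (\<forall>xs ys. set xs \<subseteq> V \<longrightarrow> length xs = d \<longrightarrow> mset xs = mset ys \<longrightarrow> \<theta> xs = \<theta> ys) \<and>
     (\<forall>xs ys u v a. set xs \<union> set ys \<union> {u, v} \<subseteq> V \<longrightarrow> length xs + length ys + 1 = d \<longrightarrow>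
        \<theta> (xs @ (u + v) # ys) = \<theta> (xs @ u # ys) + \<theta> (xs @ v # ys) \<and>
        \<theta> (xs @ s a v # ys) = a * \<theta> (xs @ v # ys))"

text \<open>The symmetric multilinear form \<open>\<theta>\<close> of \<open>\<phi>\<close> is unique when the characteristic is \<open>0\<close> or
  greater than \<open>d\<close>.\<close>

definition nondegenerate_form_on ::
    "('f::field \<Rightarrow> 'v::ab_group_add \<Rightarrow> 'v) \<Rightarrow> 'v set \<Rightarrow> nat \<Rightarrow> ('v \<Rightarrow> 'f) \<Rightarrow> bool" where
  "nondegenerate_form_on s V d \<phi> \<longleftrightarrow> form_on s V d \<phi> \<and>
     (\<exists>\<theta>. symmetric_multilinear_on s V d \<theta> \<and> (\<forall>v\<in>V. \<phi> v = \<theta> (replicate d v)) \<and>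
        (\<forall>v\<in>V. (\<forall>vs. set vs \<subseteq> V \<longrightarrow> length vs = d - 1 \<longrightarrow> \<theta> (v # vs) = 0) \<longrightarrow> v = 0))"

text \<open>A linear bijection between subspaces extends to a linear map of the ambient spaces, so
  nothing is lost by taking \<open>f\<close> to be linear everywhere.\<close>

definition isomorphic_forms ::
    "('f::field \<Rightarrow> 'v::ab_group_add \<Rightarrow> 'v) \<Rightarrow> 'v set \<Rightarrow> ('v \<Rightarrow> 'f) \<Rightarrow>
     ('f \<Rightarrow> 'w::ab_group_add \<Rightarrow> 'w) \<Rightarrow> 'w set \<Rightarrow> ('w \<Rightarrow> 'f) \<Rightarrow> bool" where
  "isomorphic_forms s V \<phi> t W \<psi> \<longleftrightarrow>
     (\<exists>f. Vector_Spaces.linear s t f \<and> bij_betw f V W \<and> (\<forall>v\<in>V. \<psi> (f v) = \<phi> v))"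

definition orthogonal_sum :: "('v \<Rightarrow> 'f::plus) \<Rightarrow> ('w \<Rightarrow> 'f) \<Rightarrow> 'v \<times> 'w \<Rightarrow> 'f" where
  "orthogonal_sum \<phi> \<psi> = (\<lambda>(v, w). \<phi> v + \<psi> w)"

text \<open>The two summands live on arbitrary spaces. Their dimensions are at most that of \<open>V\<close>, so up
  to isomorphism these spaces are subspaces of the type carrying \<open>V\<close>. The sum \<open>V1 \<oplus> V2\<close> is the
  external one, carried by \<open>V1 \<times> V2\<close>.\<close>

definition decomposable ::
    "('f::field \<Rightarrow> 'v::ab_group_add \<Rightarrow> 'v) \<Rightarrow> 'v set \<Rightarrow> nat \<Rightarrow> ('v \<Rightarrow> 'f) \<Rightarrow> bool" where
  "decomposable s V d \<phi> \<longleftrightarrow>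
     (\<exists>V1 V2 \<phi>1 \<phi>2. V1 \<noteq> {0} \<and> V2 \<noteq> {0} \<and>
        nondegenerate_form_on s V1 d \<phi>1 \<and> nondegenerate_form_on s V2 d \<phi>2 \<and>
        isomorphic_forms s V \<phi> (module_prod.scale s s) (V1 \<times> V2) (orthogonal_sum \<phi>1 \<phi>2))"

definition indecomposable ::
    "('f::field \<Rightarrow> 'v::ab_group_add \<Rightarrow> 'v) \<Rightarrow> 'v set \<Rightarrow> nat \<Rightarrow> ('v \<Rightarrow> 'f) \<Rightarrow> bool" where
  "indecomposable s V d \<phi> \<longleftrightarrow> (\<exists>v\<in>V. \<phi> v \<noteq> 0) \<and> \<not> decomposable s V d \<phi>"

text \<open>The group \<open>G(\<psi>)\<close>.\<close>

definition similarity_factors ::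
    "('f::field \<Rightarrow> 'v::ab_group_add \<Rightarrow> 'v) \<Rightarrow> 'v set \<Rightarrow> ('v \<Rightarrow> 'f) \<Rightarrow> 'f set" where
  "similarity_factors s V \<psi> = {a. a \<noteq> 0 \<and> isomorphic_forms s V (\<lambda>v. a * \<psi> v) s V \<psi>}"

section \<open>Extension of scalars\<close>

text \<open>The polynomial is unique when the field has characteristic \<open>0\<close> or greater than \<open>d\<close>.\<close>

definition coordinate_poly ::
    "('f::field \<Rightarrow> 'v::ab_group_add \<Rightarrow> 'v) \<Rightarrow> ('i::finite \<Rightarrow> 'v) \<Rightarrow> nat \<Rightarrow> ('v \<Rightarrow> 'f) \<Rightarrow>
     (('i \<Rightarrow>\<^sub>0 nat) \<Rightarrow>\<^sub>0 'f)" where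
  "coordinate_poly s b d \<phi> = (THE p. represented_by s UNIV b d \<phi> p)"

text \<open>The extension along the embedding \<open>h\<close> of a form on a space with basis \<open>b\<close>; the extended
  space is identified with the coordinate space by means of the basis \<open>b \<otimes> 1\<close>.\<close>

definition scalar_extension ::
    "('f::field \<Rightarrow> 'g::field) \<Rightarrow> ('f \<Rightarrow> 'v::ab_group_add \<Rightarrow> 'v) \<Rightarrow> ('i::finite \<Rightarrow> 'v) \<Rightarrow> nat \<Rightarrow>
     ('v \<Rightarrow> 'f) \<Rightarrow> 'g ^ 'i \<Rightarrow> 'g" where
  "scalar_extension h s b d \<phi> = (\<lambda>x. eval_poly_at h (coordinate_poly s b d \<phi>) (vec_nth x))"

definition is_algebraic_closure :: "('f::field \<Rightarrow> 'c::alg_closed_field) \<Rightarrow> bool" where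
  "is_algebraic_closure h \<longleftrightarrow>
     field_hom h \<and> (\<forall>x. \<exists>p. p \<noteq> 0 \<and> poly (map_poly h p) x = 0)"

text \<open>Here \<open>h\<close> is meant to be the embedding of the base field into its algebraic closure.\<close>

definition absolutely_indecomposable ::
    "('f::field \<Rightarrow> 'c::alg_closed_field) \<Rightarrow> ('f \<Rightarrow> 'v::ab_group_add \<Rightarrow> 'v) \<Rightarrow>
     ('i::finite \<Rightarrow> 'v) \<Rightarrow> nat \<Rightarrow> ('v \<Rightarrow> 'f) \<Rightarrow> bool" where
  "absolutely_indecomposable h s b d \<phi> \<longleftrightarrow>
     indecomposable (*s) UNIV d (scalar_extension h s b d \<phi>)"

section \<open>Strongly multiplicative forms\<close>

text \<open>The rational function field over \<open>'a\<close> in the variables indexed by \<open>'i\<close>. The order on \<open>'i\<close>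
  only serves to make the polynomial ring an instance of \<^class>\<open>idom\<close>.\<close>

type_synonym ('a, 'i) ratfun = "(('i \<Rightarrow>\<^sub>0 nat) \<Rightarrow>\<^sub>0 'a) fract"

definition const_ratfun :: "'a::field \<Rightarrow> ('a, 'i::linorder) ratfun" where
  "const_ratfun c = Fract (Poly_Mapping.single 0 c) 1"

text \<open>The generic value \<open>\<phi>(X)\<close> as an element of \<open>K(X)\<close>, where \<open>h\<close> embeds the base field of
  \<open>\<phi>\<close> into \<open>K\<close>.\<close>

definition generic_value ::
    "('f::field \<Rightarrow> 'g::field) \<Rightarrow> ('f \<Rightarrow> 'v::ab_group_add \<Rightarrow> 'v) \<Rightarrow>
     ('i::{finite,linorder} \<Rightarrow> 'v) \<Rightarrow> nat \<Rightarrow> ('v \<Rightarrow> 'f) \<Rightarrow> ('g, 'i) ratfun" where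
  "generic_value h s b d \<phi> = Fract (Poly_Mapping.map h (coordinate_poly s b d \<phi>)) 1"

definition strongly_multiplicative ::
    "('f::field \<Rightarrow> 'v::ab_group_add \<Rightarrow> 'v) \<Rightarrow> ('i::{finite,linorder} \<Rightarrow> 'v) \<Rightarrow> nat \<Rightarrow>
     ('v \<Rightarrow> 'f) \<Rightarrow> bool" where
  "strongly_multiplicative s b d \<phi> \<longleftrightarrow>
     (let \<phi>X = scalar_extension (const_ratfun :: 'f \<Rightarrow> ('f, 'i) ratfun) s b d \<phi>
      in isomorphic_forms (*s) UNIV (\<lambda>v. generic_value id s b d \<phi> * \<phi>X v) (*s) UNIV \<phi>X)"

section \<open>Finite separable extensions and trace forms\<close>

text \<open>A field extension is an embedding \<open>h\<close> of the small field into the large one.\<close>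

definition restrict_scalars ::
    "('k \<Rightarrow> 'l) \<Rightarrow> ('l \<Rightarrow> 'v \<Rightarrow> 'v) \<Rightarrow> 'k \<Rightarrow> 'v \<Rightarrow> 'v" where
  "restrict_scalars h s = (\<lambda>a. s (h a))"

definition finite_separable_extension :: "('k::field \<Rightarrow> 'l::field) \<Rightarrow> bool" where
  "finite_separable_extension h \<longleftrightarrow> field_hom h \<and>
     (\<exists>B. finite B \<and> module.span (restrict_scalars h (*)) B = UNIV) \<and>
     (\<forall>x. \<exists>p :: 'k poly. irreducible p \<and> poly (map_poly h p) x = 0 \<and> coprime p (pderiv p))"

definition endomorphism_trace ::
    "('f::field \<Rightarrow> 'v::ab_group_add \<Rightarrow> 'v) \<Rightarrow> ('v \<Rightarrow> 'v) \<Rightarrow> 'f" where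
  "endomorphism_trace s f =
     (let B = (SOME B. \<not> module.dependent s B \<and> module.span s B = UNIV)
      in \<Sum>b\<in>B. module.representation s B (f b) b)"

definition field_trace :: "('k::field \<Rightarrow> 'l::field) \<Rightarrow> 'l \<Rightarrow> 'k" where
  "field_trace h a = endomorphism_trace (restrict_scalars h (*)) (\<lambda>x. a * x)"

definition trace_form :: "('k::field \<Rightarrow> 'l::field) \<Rightarrow> ('v \<Rightarrow> 'l) \<Rightarrow> 'v \<Rightarrow> 'k" where
  "trace_form h \<Gamma> = (\<lambda>v. field_trace h (\<Gamma> v))"

text \<open>For \<open>h : k \<rightarrow> l\<close> and \<open>e : l \<rightarrow> c\<close>, the embeddings of \<open>l\<close> into \<open>c\<close> over \<open>k\<close>.\<close>

definition embeddings_over ::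
    "('k::field \<Rightarrow> 'l::field) \<Rightarrow> ('l \<Rightarrow> 'c::field) \<Rightarrow> ('l \<Rightarrow> 'c) set" where
  "embeddings_over h e = {\<sigma>. field_hom \<sigma> \<and> \<sigma> \<circ> h = e \<circ> h}"

end

theory Submission
  imports Defs "HOL-Library.Function_Algebras"
begin

text \<open>Write \<open>h : k \<rightarrow> c\<close> for the embedding of \<open>k\<close> into its algebraic closure and \<open>K = c(X)\<close>. Over \<open>K\<close> the form
\<open>\<phi>\<close> falls apart: \<open>l \<otimes> c\<close> is a product of copies of \<open>c\<close>, one for each embedding \<open>\<sigma>\<close> of \<open>l\<close> over
\<open>k\<close>, and the trace of \<open>l/k\<close> is the sum of the \<open>\<sigma>\<close>, so \<open>\<phi>\<close> becomes the orthogonal sum of the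
conjugates \<open>\<Gamma>\<^sup>\<sigma>\<close> (\<open>dual_basis_and_trace\<close>, \<open>embedding_coordinate_matrices\<close>).

Every \<open>\<Gamma>\<^sup>\<sigma>\<close> is indecomposable over \<open>K\<close>. Decompositions of a nondegenerate form correspond to
idempotents in its centre, the algebra of self-adjoint endomorphisms. For the given embedding
there are only the trivial ones over \<open>c\<close> by absolute indecomposability. For another embedding
\<open>\<sigma>\<close> an idempotent is transported by an endomorphism of \<open>c\<close> that carries \<open>\<sigma>\<close> to the given
embedding (\<open>algebraic_closure_embedding_extends\<close>). An idempotent over \<open>K\<close> has rational functions
as entries; at each point where its denominator is nonzero it specialises to a trivial
idempotent over \<open>c\<close>, and polynomial identities over the infinite field \<open>c\<close> then make it trivial
itself (\<open>primitive_tensor_ratfun\<close>).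

If \<open>\<phi>\<close> is strongly multiplicative, base change yields a similarity \<open>f\<close> with factor \<open>g = \<phi>(X)\<close> of
the sum of the \<open>\<Gamma>\<^sup>\<sigma>\<close> over \<open>K\<close> (\<open>isometry_base_change\<close>). In degree at least \<open>3\<close> the centre is
commutative (\<open>self_adjoint_commute\<close>), so the decomposition into indecomposables is not only
unique up to isomorphism: the summands themselves are unique, and \<open>f\<close> permutes them
(\<open>similar_orthogonal_sums_permute_blocks\<close>). Each step along this permutation multiplies by \<open>g\<close>, so
following the component of \<open>\<Gamma>\<close> around its cycle, whose length \<open>i\<close> is at most the number \<open>n\<close> of
embeddings, gives \<open>g\<^sup>i \<Gamma> \<cong> \<Gamma>\<close> over \<open>K\<close>, contrary to the hypothesis.

Forms are handled through the tensor \<open>T\<close> of values of the polar form on basis vectors. A field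
homomorphism is applied to a form by composing it with \<open>T\<close>, and the conditions on centres and
nondegeneracy are equations in the entries of \<open>T\<close>. The restriction on the characteristic enters
twice: it makes the coordinate polynomial of a form unique, and it permits polarisation.\<close>

text \<open>Below, \<open>$\<close> selects a coordinate of a vector in \<open>'f^'n\<close> and \<open>mat 1\<close> is the identity matrix in
\<open>'f^'n^'n\<close>.\<close>

hide_const (open) Matrix.mat Module.smult
no_notation fps_nth (infixl "$" 75)
no_notation vec_index (infixl "$" 100)

section \<open>Evaluation of multivariate polynomials\<close>

lemma eval_poly_at_superset:
  assumes "h 0 = 0" "finite S" "Poly_Mapping.keys p \<subseteq> S"
  shows "eval_poly_at h p x = (\<Sum>m\<in>S. h (Poly_Mapping.lookup p m) *
     (\<Prod>i \<in> Poly_Mapping.keys m. x i ^ Poly_Mapping.lookup m i))"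
  unfolding eval_poly_at_def
  by (rule sum.mono_neutral_left) (use assms in \<open>auto simp: in_keys_iff\<close>)

lemma poly_mapping_sum_singles:
  fixes p :: "'a \<Rightarrow>\<^sub>0 'b::comm_monoid_add"
  shows "p = (\<Sum>m\<in>Poly_Mapping.keys p. Poly_Mapping.single m (Poly_Mapping.lookup p m))"
  by (rule poly_mapping_eqI) (auto simp: lookup_sum lookup_single when_def in_keys_iff)

lemma poly_mapping_additive_induct [case_names zero single add]:
  fixes p :: "'a \<Rightarrow>\<^sub>0 'b::comm_monoid_add"
  assumes "P 0" "\<And>m a. P (Poly_Mapping.single m a)" "\<And>p q. P p \<Longrightarrow> P q \<Longrightarrow> P (p + q)"
  shows "P p"
proof -
  have "P (\<Sum>m\<in>S. Poly_Mapping.single m (Poly_Mapping.lookup p m))" if "finite S" for S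
    using that by induction (auto intro: assms)
  thus ?thesis by (subst poly_mapping_sum_singles) auto
qed

lemma eval_poly_at_zero [simp]: "eval_poly_at h 0 x = 0"
  by (simp add: eval_poly_at_def)

lemma eval_poly_at_single:
  assumes "h 0 = 0"
  shows "eval_poly_at h (Poly_Mapping.single m a) x =
    h a * (\<Prod>i \<in> Poly_Mapping.keys m. x i ^ Poly_Mapping.lookup m i)"
  using eval_poly_at_superset[of h "{m}" "Poly_Mapping.single m a" x] assms by auto

lemma eval_poly_at_add:
  assumes "comm_ring_hom h"
  shows "eval_poly_at h (p + q) x = eval_poly_at h p x + eval_poly_at h q x"
proof -
  interpret h: comm_ring_hom h by fact
  let ?S = "Poly_Mapping.keys p \<union> Poly_Mapping.keys q"
  have "Poly_Mapping.keys (p + q) \<subseteq> ?S" by (rule Poly_Mapping.keys_add)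
  thus ?thesis
    by (simp add: eval_poly_at_superset[where S = ?S] lookup_add h.hom_add sum.distrib
        distrib_right)
qed

lemma monomial_value_add:
  fixes x :: "'i \<Rightarrow> 'a::comm_semiring_1"
  shows "(\<Prod>i \<in> Poly_Mapping.keys (m + m'). x i ^ Poly_Mapping.lookup (m + m') i) =
    (\<Prod>i \<in> Poly_Mapping.keys m. x i ^ Poly_Mapping.lookup m i) *
    (\<Prod>i \<in> Poly_Mapping.keys m'. x i ^ Poly_Mapping.lookup m' i)"
proof -
  let ?S = "Poly_Mapping.keys m \<union> Poly_Mapping.keys m'"
  have *: "(\<Prod>i \<in> Poly_Mapping.keys n. x i ^ Poly_Mapping.lookup n i) =
      (\<Prod>i \<in> ?S. x i ^ Poly_Mapping.lookup n i)" if "Poly_Mapping.keys n \<subseteq> ?S" for n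
    by (rule prod.mono_neutral_left) (use that in \<open>auto simp: in_keys_iff\<close>)
  show ?thesis
    unfolding *[OF Poly_Mapping.keys_add] *[of m, simplified] *[of m', simplified]
    by (simp add: lookup_add power_add prod.distrib)
qed

lemma eval_poly_at_mult:
  assumes "comm_ring_hom h"
  shows "eval_poly_at h (p * q) x = eval_poly_at h p x * eval_poly_at h q x"
proof -
  interpret h: comm_ring_hom h by fact
  show ?thesis
  proof (induction p rule: poly_mapping_additive_induct)
    case (single m a)
    show ?case
      by (induction q rule: poly_mapping_additive_induct)
        (simp_all add: eval_poly_at_single mult_single monomial_value_add h.hom_mult
          ring_distribs eval_poly_at_add[OF assms] mult_ac)
  qed (simp_all add: ring_distribs eval_poly_at_add[OF assms])
qed

lemma eval_poly_at_const [simp]: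
  assumes "h 0 = 0"
  shows "eval_poly_at h (Poly_Mapping.single 0 a) x = h a"
  using assms by (simp add: eval_poly_at_single)

lemma eval_poly_at_sum:
  assumes "comm_ring_hom h"
  shows "eval_poly_at h (sum f S) x = (\<Sum>i\<in>S. eval_poly_at h (f i) x)"
  by (induction S rule: infinite_finite_induct) (simp_all add: eval_poly_at_add[OF assms])

lemma comm_ring_hom_id: "comm_ring_hom id"
  by unfold_locales auto

lemma comm_ring_hom_eval_poly_at: "comm_ring_hom (\<lambda>p. eval_poly_at id p x)"
proof -
  have "eval_poly_at id 1 x = 1"
    using eval_poly_at_const[of id 1 x] by simp
  thus ?thesis
    by unfold_locales
      (simp_all add: eval_poly_at_add[OF comm_ring_hom_id] eval_poly_at_mult[OF comm_ring_hom_id])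
qed

lemma lookup_map_poly_mapping: "h 0 = 0 \<Longrightarrow> Poly_Mapping.lookup (Poly_Mapping.map h p) m = h (Poly_Mapping.lookup p m)"
  by (simp add: Poly_Mapping.map.rep_eq when_def)

lemma comm_ring_hom_map_poly_mapping:
  fixes h :: "'a::comm_ring_1 \<Rightarrow> 'b::comm_ring_1"
  assumes "comm_ring_hom h"
  shows "comm_ring_hom (Poly_Mapping.map h :: ('m::comm_monoid_add \<Rightarrow>\<^sub>0 'a) \<Rightarrow> ('m \<Rightarrow>\<^sub>0 'b))"
proof -
  interpret h: comm_ring_hom h by fact
  note [simp] = lookup_map_poly_mapping[where h = h, OF h.hom_zero]
  have add: "Poly_Mapping.map h (p + q) = Poly_Mapping.map h p + Poly_Mapping.map h q"
    for p q :: "'m \<Rightarrow>\<^sub>0 'a"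
    by (rule poly_mapping_eqI) (simp add: lookup_add h.hom_add)
  have zero: "Poly_Mapping.map h (0 :: 'm \<Rightarrow>\<^sub>0 'a) = 0"
    by (rule poly_mapping_eqI) simp
  have single: "Poly_Mapping.map h (Poly_Mapping.single m a) = Poly_Mapping.single m (h a)"
    for m :: 'm and a
    by (rule poly_mapping_eqI) (simp add: lookup_single when_def)
  have mult: "Poly_Mapping.map h (p * q) = Poly_Mapping.map h p * Poly_Mapping.map h q"
    for p q :: "'m \<Rightarrow>\<^sub>0 'a"
  proof (induction p rule: poly_mapping_additive_induct)
    case (single m a)
    show ?case
      by (induction q rule: poly_mapping_additive_induct)
        (simp_all add: \<open>\<And>m a. Poly_Mapping.map h (Poly_Mapping.single m a) = _\<close> zero add ring_distribs mult_single h.hom_mult)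
  qed (simp_all add: zero add ring_distribs)
  have one: "Poly_Mapping.map h (1 :: 'm \<Rightarrow>\<^sub>0 'a) = 1"
    using single[of 0 1] by simp
  show ?thesis
    by unfold_locales (simp_all add: add zero mult one)
qed

text \<open>Induction on the set of variables: with all variables but one fixed, the polynomial is univariate
of degree at most \<open>D\<close> with more than \<open>D\<close> roots, so the coefficient of each power of that variable
vanishes, and this coefficient is a polynomial in fewer variables. Monomials count as equal
when their exponents agree on \<open>I\<close>, so that the induction can pass to a smaller \<open>I\<close> after
collecting the monomials with a common exponent at the removed variable.\<close>

lemma vanishing_poly_coeffs_zero:
  fixes c :: "('i \<Rightarrow>\<^sub>0 nat) \<Rightarrow> 'a::idom"
  assumes A: "finite A" "D < card (A :: 'a set)"
    and "finite I" "finite M" "\<forall>m\<in>M. \<forall>i\<in>I. Poly_Mapping.lookup m i \<le> D"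
    and "\<forall>m\<in>M. \<forall>m'\<in>M. (\<forall>i\<in>I. Poly_Mapping.lookup m i = Poly_Mapping.lookup m' i) \<longrightarrow> m = m'"
    and "\<forall>x. (\<Sum>m\<in>M. c m * (\<Prod>i\<in>I. x i ^ Poly_Mapping.lookup m i)) = 0"
  shows "\<forall>m\<in>M. c m = 0"
  using assms(3-)
proof (induction I arbitrary: M)
  case empty
  hence "M = {m}" if "m \<in> M" for m using that by auto
  with empty.prems(4) show ?case by fastforce
next
  case (insert j I)
  let ?l = Poly_Mapping.lookup
  show ?case
  proof
    fix m0 assume m0: "m0 \<in> M"
    let ?M = "{m\<in>M. ?l m j = ?l m0 j}"
    have "(\<Sum>m\<in>?M. c m * (\<Prod>i\<in>I. x i ^ ?l m i)) = 0" for x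
    proof -
      define q where "q = (\<Sum>m\<in>M. monom (c m * (\<Prod>i\<in>I. x i ^ ?l m i)) (?l m j))"
      have "poly q t = 0" for t
      proof -
        have eq: "(\<Prod>i\<in>I. (x(j := t)) i ^ ?l m i) = (\<Prod>i\<in>I. x i ^ ?l m i)" for m
          by (rule prod.cong) (use insert.hyps in auto)
        show ?thesis
          using insert.prems(4)[rule_format, of "x(j := t)"] insert.hyps
          by (simp add: q_def poly_sum poly_monom eq mult_ac del: fun_upd_apply)
             (simp add: mult_ac)
      qed
      moreover have "degree q \<le> D" unfolding q_def
        by (rule degree_sum_le) (use insert.prems in \<open>auto intro!: order.trans[OF degree_monom_le]\<close>)
      ultimately have "q = 0"
        using A(2) by (intro poly_eqI_degree[of A q 0]) auto
      hence "coeff q (?l m0 j) = 0" by simp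
      thus ?thesis using insert.prems(1)
        by (simp add: q_def coeff_sum sum.inter_filter)
    qed
    hence "\<forall>m\<in>?M. c m = 0"
      by (intro insert.IH) (use insert.prems in auto)
    thus "c m0 = 0" using m0 by auto
  qed
qed

lemma vanishing_poly_zero:
  fixes p :: "('i::finite \<Rightarrow>\<^sub>0 nat) \<Rightarrow>\<^sub>0 'a::idom"
  assumes "finite A" "D < card (A :: 'a set)"
    and "\<forall>m\<in>Poly_Mapping.keys p. \<forall>i. Poly_Mapping.lookup m i \<le> D"
    and van: "\<And>x. eval_poly_at id p x = 0"
  shows "p = 0"
proof -
  have eq: "(\<Prod>i\<in>Poly_Mapping.keys m. x i ^ Poly_Mapping.lookup m i) =
     (\<Prod>i\<in>UNIV. x i ^ Poly_Mapping.lookup m i)" for x :: "'i \<Rightarrow> 'a" and m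
    by (rule prod.mono_neutral_left) (auto simp: in_keys_iff)
  have "\<forall>m\<in>Poly_Mapping.keys p. Poly_Mapping.lookup p m = 0"
    by (rule vanishing_poly_coeffs_zero[OF assms(1,2), where I = UNIV])
      (use assms(3) van in \<open>auto simp: eval_poly_at_def eq poly_mapping_eqI\<close>)
  thus ?thesis by (intro poly_mapping_eqI) (auto simp: in_keys_iff)
qed

text \<open>Otherwise one plus the product of all \<open>X - a\<close> would be a polynomial without root.\<close>

lemma infinite_alg_closed_field: "infinite (UNIV :: 'a::alg_closed_field set)"
proof
  assume fin: "finite (UNIV :: 'a set)"
  define p where "p = (\<Prod>a\<in>(UNIV::'a set). [:-a, 1:]) + 1"
  have "degree (\<Prod>a\<in>(UNIV::'a set). [:-a, 1:]) = card (UNIV :: 'a set)"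
    by (subst degree_prod_sum_eq) auto
  hence "degree p > 0"
    using fin by (simp add: p_def degree_add_eq_left finite_UNIV_card_ge_0)
  then obtain x where "poly p x = 0" using alg_closed_imp_poly_has_root by blast
  moreover have "poly p x = 1" using fin by (simp add: p_def poly_prod prod_zero)
  ultimately show False by simp
qed

lemma vanishing_poly_zero_alg_closed:
  fixes p :: "('i::finite \<Rightarrow>\<^sub>0 nat) \<Rightarrow>\<^sub>0 'a::alg_closed_field"
  assumes "\<And>x. eval_poly_at id p x = 0"
  shows "p = 0"
proof -
  define D where "D = (\<Sum>m\<in>Poly_Mapping.keys p. \<Sum>i\<in>UNIV. Poly_Mapping.lookup m i)"
  obtain A :: "'a set" where A: "finite A" "card A = Suc D"
    using infinite_alg_closed_field infinite_arbitrarily_large by blast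
  have "Poly_Mapping.lookup m i \<le> D" if "m \<in> Poly_Mapping.keys p" for m i
  proof -
    have "Poly_Mapping.lookup m i \<le> (\<Sum>i\<in>UNIV. Poly_Mapping.lookup m i)"
      by (rule member_le_sum) auto
    also have "\<dots> \<le> D" unfolding D_def by (rule member_le_sum) (use that in auto)
    finally show ?thesis .
  qed
  thus ?thesis by (intro vanishing_poly_zero[of A D]) (use A assms in auto)
qed

section \<open>Symmetric tensors, multilinear forms and polarisation\<close>

text \<open>The multilinear form with coefficients \<open>T\<close>. Recursion over the arguments, with the tensor
shrinking by one index at each step, turns multilinearity, symmetry and compatibility with
homomorphisms into inductions on the list.\<close>

primrec tensor_eval :: "'i set \<Rightarrow> ('i list \<Rightarrow> 'f::comm_semiring_1) \<Rightarrow> ('i \<Rightarrow> 'f) list \<Rightarrow> 'f" where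
  "tensor_eval I T [] = T []"
| "tensor_eval I T (x # xs) = (\<Sum>i\<in>I. x i * tensor_eval I (\<lambda>is. T (i # is)) xs)"

text \<open>The coordinate polynomial of the form that arises from the multilinear form with coefficients \<open>T\<close>
by making all arguments equal.\<close>

primrec tensor_poly ::
    "'i set \<Rightarrow> ('i list \<Rightarrow> 'f::comm_semiring_1) \<Rightarrow> nat \<Rightarrow> ('i \<Rightarrow>\<^sub>0 nat) \<Rightarrow>\<^sub>0 'f" where
  "tensor_poly I T 0 = Poly_Mapping.single 0 (T [])"
| "tensor_poly I T (Suc d) =
     (\<Sum>i\<in>I. Poly_Mapping.single (Poly_Mapping.single i 1) 1 * tensor_poly I (\<lambda>is. T (i # is)) d)"

lemma tensor_eval_hom:
  assumes "comm_ring_hom h"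
  shows "h (tensor_eval I T xs) = tensor_eval I (h \<circ> T) (map ((\<circ>) h) xs)"
proof -
  interpret h: comm_ring_hom h by fact
  show ?thesis
    by (induction xs arbitrary: T) (simp_all add: h.hom_sum h.hom_mult comp_def)
qed

lemma tensor_eval_add:
  "tensor_eval I T (xs @ (\<lambda>i. u i + v i) # ys) =
   tensor_eval I T (xs @ u # ys) + tensor_eval I T (xs @ v # ys)"
  by (induction xs arbitrary: T) (simp_all add: ring_distribs sum.distrib)

lemma tensor_eval_scale:
  "tensor_eval I T (xs @ (\<lambda>i. a * v i) # ys) = a * tensor_eval I T (xs @ v # ys)"
  by (induction xs arbitrary: T) (simp_all add: sum_distrib_left mult_ac)

lemma tensor_eval_axes:
  assumes "finite I" "set js \<subseteq> I"
  shows "tensor_eval I T (map (\<lambda>j i. of_bool (i = j)) js) = T js"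
  using assms(2) by (induction js arbitrary: T) (use assms(1) in \<open>auto simp: of_bool_def if_distrib[of "\<lambda>x. x * _"] cong: if_cong\<close>)

lemma tensor_eval_cong:
  assumes "\<And>is. length is = length xs \<Longrightarrow> T1 is = T2 is"
  shows "tensor_eval I T1 xs = tensor_eval I T2 xs"
  using assms
proof (induction xs arbitrary: T1 T2)
  case (Cons x xs)
  have "tensor_eval I (\<lambda>is. T1 (i # is)) xs = tensor_eval I (\<lambda>is. T2 (i # is)) xs" for i
    by (rule Cons.IH) (simp add: Cons.prems)
  thus ?case by simp
qed simp

lemma tensor_eval_sum:
  "tensor_eval I (\<lambda>is. \<Sum>r\<in>R. T r is) xs = (\<Sum>r\<in>R. tensor_eval I (T r) xs)"
proof (induction xs arbitrary: T)
  case (Cons x xs)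
  show ?case by (simp add: Cons.IH sum_distrib_left sum.swap[of _ I])
qed simp

lemma tensor_eval_cmult: "tensor_eval I (\<lambda>is. c * T is) xs = c * tensor_eval I T xs"
  by (induction xs arbitrary: T) (simp_all add: sum_distrib_left mult.left_commute)

text \<open>Pulling one argument to the front is a succession of exchanges of adjacent summations; with it,
induction on the list gives invariance under all permutations.\<close>

lemma tensor_eval_move:
  assumes "\<And>is js. length is = d \<Longrightarrow> mset is = mset js \<Longrightarrow> T is = T js"
    and "length us + length vs + 1 = d"
  shows "tensor_eval I T (us @ x # vs) = tensor_eval I T (x # us @ vs)"
  using assms
proof (induction us arbitrary: T d)
  case (Cons u us)
  have "tensor_eval I (\<lambda>is. T (i # is)) (us @ x # vs) =
      tensor_eval I (\<lambda>is. T (i # is)) (x # us @ vs)" for i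
    by (rule Cons.IH[of "d - 1"]) (use Cons.prems in auto)
  hence "tensor_eval I T ((u # us) @ x # vs) =
      (\<Sum>i\<in>I. \<Sum>j\<in>I. u i * (x j * tensor_eval I (\<lambda>is. T (i # j # is)) (us @ vs)))"
    by (simp add: sum_distrib_left)
  also have "\<dots> = (\<Sum>j\<in>I. \<Sum>i\<in>I. u i * (x j * tensor_eval I (\<lambda>is. T (i # j # is)) (us @ vs)))"
    by (rule sum.swap)
  also have "\<dots> = (\<Sum>j\<in>I. \<Sum>i\<in>I. x j * (u i * tensor_eval I (\<lambda>is. T (j # i # is)) (us @ vs)))"
  proof -
    have swap: "tensor_eval I (\<lambda>is. T (i # j # is)) (us @ vs) =
        tensor_eval I (\<lambda>is. T (j # i # is)) (us @ vs)" for i j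
      by (rule tensor_eval_cong, rule Cons.prems(1)) (use Cons.prems(2) in auto)
    show ?thesis
      by (intro sum.cong refl) (subst swap, simp only: mult.left_commute)
  qed
  finally show ?case by (simp add: sum_distrib_left)
qed simp

lemma tensor_eval_symmetric:
  assumes "\<And>is js. length is = d \<Longrightarrow> mset is = mset js \<Longrightarrow> T is = T js"
    and "length xs = d" "mset xs = mset ys"
  shows "tensor_eval I T xs = tensor_eval I T ys"
  using assms
proof (induction xs arbitrary: T d ys)
  case (Cons x xs)
  from Cons.prems(3) obtain us vs where ys: "ys = us @ x # vs"
    by (metis list.set_intros(1) set_mset_mset split_list)
  have len: "length us + length vs + 1 = d"
    using Cons.prems(2) mset_eq_length[OF Cons.prems(3)] ys by auto
  have "tensor_eval I (\<lambda>is. T (i # is)) xs = tensor_eval I (\<lambda>is. T (i # is)) (us @ vs)" for i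
    by (rule Cons.IH[of "d - 1"]) (use Cons.prems ys in auto)
  hence "tensor_eval I T (x # xs) = tensor_eval I T (x # us @ vs)" by simp
  also have "\<dots> = tensor_eval I T ys"
    unfolding ys by (rule tensor_eval_move[symmetric]) (use Cons.prems(1) len in auto)
  finally show ?case .
qed auto

definition monomial_degree :: "('i \<Rightarrow>\<^sub>0 nat) \<Rightarrow> nat" where
  "monomial_degree m = (\<Sum>i \<in> Poly_Mapping.keys m. Poly_Mapping.lookup m i)"

lemma monomial_degree_add: "monomial_degree (m + m') = monomial_degree m + monomial_degree m'"
  unfolding monomial_degree_def
  by (rule setsum_keys_plus_distrib[where f = "\<lambda>_ x. x"]) simp_all

lemma monomial_degree_single [simp]: "monomial_degree (Poly_Mapping.single i k) = k"
  by (simp add: monomial_degree_def)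

lemma tensor_poly_keys:
  assumes "m \<in> Poly_Mapping.keys (tensor_poly I T d)"
  shows "monomial_degree m = d \<and> Poly_Mapping.keys m \<subseteq> I"
  using assms
proof (induction d arbitrary: T m)
  case 0
  thus ?case by (auto simp: monomial_degree_def split: if_splits)
next
  case (Suc d)
  from Suc.prems obtain i where i: "i \<in> I"
    "m \<in> Poly_Mapping.keys (Poly_Mapping.single (Poly_Mapping.single i 1) 1 * tensor_poly I (\<lambda>is. T (i # is)) d)"
    using Poly_Mapping.keys_sum[of "\<lambda>i. Poly_Mapping.single (Poly_Mapping.single i 1) 1 * tensor_poly I (\<lambda>is. T (i # is)) d" I]
    by auto
  then obtain m' where m': "m' \<in> Poly_Mapping.keys (tensor_poly I (\<lambda>is. T (i # is)) d)"
    and m: "m = Poly_Mapping.single i 1 + m'"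
    using Poly_Mapping.keys_mult by (fastforce split: if_splits)
  have "Poly_Mapping.keys m \<subseteq> Poly_Mapping.keys (Poly_Mapping.single i (1::nat)) \<union> Poly_Mapping.keys m'"
    unfolding m by (rule Poly_Mapping.keys_add)
  thus ?case using Suc.IH[OF m'] i(1) by (auto simp: m monomial_degree_add)
qed

lemma eval_tensor_poly:
  assumes "comm_ring_hom h"
  shows "eval_poly_at h (tensor_poly I T d) x = tensor_eval I (h \<circ> T) (replicate d x)"
proof -
  interpret h: comm_ring_hom h by fact
  show ?thesis
    by (induction d arbitrary: T)
      (simp_all add: eval_poly_at_sum[OF assms] eval_poly_at_mult[OF assms] eval_poly_at_single comp_def)
qed

lemma inj_on_of_nat_atMost:
  assumes "\<And>m. 1 \<le> m \<Longrightarrow> m \<le> d \<Longrightarrow> of_nat m \<noteq> (0 :: 'a::ring_1)"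
  shows "inj_on (of_nat :: nat \<Rightarrow> 'a) {..d}"
proof (rule linorder_inj_onI)
  fix x y :: nat assume "x < y" "x \<in> {..d}" "y \<in> {..d}"
  hence "of_nat (y - x) \<noteq> (0 :: 'a)" by (intro assms) auto
  thus "of_nat x \<noteq> (of_nat y :: 'a)" using \<open>x < y\<close> by (auto simp: of_nat_diff)
qed auto

text \<open>If \<open>1, \<dots>, d\<close> are nonzero in the field, then \<open>0, \<dots>, d\<close> are \<open>d + 1\<close> distinct elements of it. That is
enough for a polynomial function of degree at most \<open>d\<close> to determine the polynomial.\<close>

lemma represented_by_unique:
  fixes s :: "'f::field \<Rightarrow> 'v::ab_group_add \<Rightarrow> 'v" and b :: "'i::finite \<Rightarrow> 'v"
  assumes char: "\<And>m. 1 \<le> m \<Longrightarrow> m \<le> d \<Longrightarrow> of_nat m \<noteq> (0 :: 'f)"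
    and p: "represented_by s UNIV b d \<phi> p" and q: "represented_by s UNIV b d \<phi> q"
  shows "p = q"
proof -
  have inj: "inj_on (of_nat :: nat \<Rightarrow> 'f) {..d}" by (rule inj_on_of_nat_atMost) (rule char)
  have card: "card ((of_nat :: nat \<Rightarrow> 'f) ` {..d}) = Suc d" using inj by (simp add: card_image)
  have "Poly_Mapping.lookup m i \<le> d"
    if "m \<in> Poly_Mapping.keys p \<union> Poly_Mapping.keys q" for m i
  proof -
    have "(\<Sum>i \<in> Poly_Mapping.keys m. Poly_Mapping.lookup m i) = d"
      using p q that by (auto simp: represented_by_def homogeneous_poly_def)
    thus ?thesis using member_le_sum[of i "Poly_Mapping.keys m" "Poly_Mapping.lookup m"]
      by (cases "i \<in> Poly_Mapping.keys m") (auto simp: in_keys_iff)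
  qed
  moreover have "Poly_Mapping.keys (p - q) \<subseteq> Poly_Mapping.keys p \<union> Poly_Mapping.keys q"
    by (rule Poly_Mapping.keys_diff)
  moreover have "eval_poly_at id (p - q) x = 0" for x
  proof -
    interpret comm_ring_hom "\<lambda>p. eval_poly_at id p x" by (rule comm_ring_hom_eval_poly_at)
    show ?thesis using p q by (simp add: represented_by_def hom_minus)
  qed
  ultimately have "p - q = 0"
    by (intro vanishing_poly_zero[of "of_nat ` {..d}" d]) (use card in auto)
  thus ?thesis by simp
qed

text \<open>The subspace \<open>V\<close> is kept as a parameter because the summands of a decomposition are subspaces
of the ambient type.\<close>

locale symmetric_multilinear_form = vector_space s
  for s :: "'f::field \<Rightarrow> 'v::ab_group_add \<Rightarrow> 'v" +
  fixes V :: "'v set" and d :: nat and \<theta> :: "'v list \<Rightarrow> 'f"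
  assumes subspace_V: "subspace V" and sml: "symmetric_multilinear_on s V d \<theta>"
begin

lemma perm:
  "set xs \<subseteq> V \<Longrightarrow> length xs = d \<Longrightarrow> mset xs = mset ys \<Longrightarrow> \<theta> xs = \<theta> ys"
  using sml by (auto simp: symmetric_multilinear_on_def)

lemma add_slot:
  "set xs \<subseteq> V \<Longrightarrow> set ys \<subseteq> V \<Longrightarrow> u \<in> V \<Longrightarrow> v \<in> V \<Longrightarrow> length xs + length ys + 1 = d \<Longrightarrow>
   \<theta> (xs @ (u + v) # ys) = \<theta> (xs @ u # ys) + \<theta> (xs @ v # ys)"
  using sml unfolding symmetric_multilinear_on_def by auto

lemma scale_slot:
  "set xs \<subseteq> V \<Longrightarrow> set ys \<subseteq> V \<Longrightarrow> v \<in> V \<Longrightarrow> length xs + length ys + 1 = d \<Longrightarrow>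
   \<theta> (xs @ s a v # ys) = a * \<theta> (xs @ v # ys)"
  using sml unfolding symmetric_multilinear_on_def by auto

lemma zero_slot:
  assumes "set xs \<subseteq> V" "set ys \<subseteq> V" "length xs + length ys + 1 = d"
  shows "\<theta> (xs @ 0 # ys) = 0"
  using scale_slot[OF assms(1,2) subspace_0[OF subspace_V] assms(3), of 0] by simp

lemma sum_slot:
  assumes "set xs \<subseteq> V" "set ys \<subseteq> V" "length xs + length ys + 1 = d" "\<And>i. i \<in> S \<Longrightarrow> f i \<in> V"
  shows "\<theta> (xs @ (\<Sum>i\<in>S. f i) # ys) = (\<Sum>i\<in>S. \<theta> (xs @ f i # ys))"
  using assms(4)
  by (induction S rule: infinite_finite_induct)
    (simp_all add: zero_slot[OF assms(1-3)] add_slot[OF assms(1,2) _ _ assms(3)]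
      subspace_sum[OF subspace_V])

text \<open>The prefix \<open>ys\<close> collects the basis vectors chosen so far, as the arguments are expanded one
after the other.\<close>

lemma tensor_eval_expand:
  assumes "\<And>i. i \<in> I \<Longrightarrow> b i \<in> V" "set ys \<subseteq> V" "length ys + length xs = d"
  shows "\<theta> (ys @ map (\<lambda>x. \<Sum>i\<in>I. s (x i) (b i)) xs) =
    tensor_eval I (\<lambda>is. \<theta> (ys @ map b is)) xs"
  using assms(2-)
proof (induction xs arbitrary: ys)
  case (Cons x xs)
  have inV: "(\<Sum>i\<in>I. s (x i) (b i)) \<in> V" for x
    by (intro subspace_sum subspace_scale subspace_V assms(1))
  let ?X = "map (\<lambda>x. \<Sum>i\<in>I. s (x i) (b i)) xs"
  have X: "set ?X \<subseteq> V" using inV by auto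
  have "\<theta> (ys @ map (\<lambda>x. \<Sum>i\<in>I. s (x i) (b i)) (x # xs)) =
     (\<Sum>i\<in>I. \<theta> (ys @ s (x i) (b i) # ?X))"
    using sum_slot[OF Cons.prems(1) X, of I "\<lambda>i. s (x i) (b i)"] Cons.prems(2)
    by (simp add: subspace_scale subspace_V assms(1))
  also have "\<dots> = (\<Sum>i\<in>I. x i * \<theta> ((ys @ [b i]) @ ?X))"
    by (rule sum.cong) (use X Cons.prems in \<open>auto simp: scale_slot assms(1)\<close>)
  also have "\<dots> = (\<Sum>i\<in>I. x i * tensor_eval I (\<lambda>is. \<theta> ((ys @ [b i]) @ map b is)) xs)"
    by (rule sum.cong[OF refl], subst Cons.IH) (use Cons.prems in \<open>auto simp: assms(1)\<close>)
  finally show ?case by simp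
qed auto

lemma represented_by_tensor_poly:
  assumes b: "basis_family s I b V" and \<phi>: "\<And>v. v \<in> V \<Longrightarrow> \<phi> v = \<theta> (replicate d v)"
  shows "represented_by s I b d \<phi> (tensor_poly I (\<lambda>is. \<theta> (map b is)) d)"
proof -
  have bV: "b i \<in> V" if "i \<in> I" for i
    using b that span_base[of "b i" "b ` I"] by (auto simp: basis_family_def)
  have "\<phi> (\<Sum>i\<in>I. s (x i) (b i)) =
      eval_poly_at id (tensor_poly I (\<lambda>is. \<theta> (map b is)) d) x" for x
  proof -
    have "(\<Sum>i\<in>I. s (x i) (b i)) \<in> V"
      by (intro subspace_sum subspace_scale subspace_V bV)
    thus ?thesis
      using tensor_eval_expand[of I b "[]" "replicate d x"] bV
      by (simp add: \<phi> eval_tensor_poly[OF comm_ring_hom_id] comp_def)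
  qed
  thus ?thesis
    by (auto simp: represented_by_def homogeneous_poly_def monomial_degree_def[symmetric]
        dest: tensor_poly_keys)
qed

lemma form_on_diagonal:
  assumes "\<And>v. v \<in> V \<Longrightarrow> \<phi> v = \<theta> (replicate d v)" "finite B" "V \<subseteq> span B"
  shows "form_on s V d \<phi>"
proof -
  obtain C where C: "C \<subseteq> V" "independent C" "V = span C"
    using maximal_independent_subset[of V] span_subspace[OF _ _ subspace_V] by metis
  have "finite C"
    using independent_span_bound[OF assms(2) C(2)] C(1) assms(3) by auto
  hence "basis_family s C id V" using C by (auto simp: basis_family_def)
  thus ?thesis using represented_by_tensor_poly[OF _ assms(1), of C id] vector_space_axioms
    by (auto simp: form_on_def)
qed

end

lemma coordinate_poly_eq_tensor_poly:
  fixes s :: "'f::field \<Rightarrow> 'v::ab_group_add \<Rightarrow> 'v" and b :: "'i::finite \<Rightarrow> 'v"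
  assumes char: "\<And>m. 1 \<le> m \<Longrightarrow> m \<le> d \<Longrightarrow> of_nat m \<noteq> (0 :: 'f)"
    and "vector_space s" "symmetric_multilinear_on s UNIV d \<theta>" "\<And>v. \<phi> v = \<theta> (replicate d v)"
    and "basis_family s UNIV b UNIV"
  shows "coordinate_poly s b d \<phi> = tensor_poly UNIV (\<lambda>is. \<theta> (map b is)) d"
proof -
  interpret vector_space s by fact
  interpret symmetric_multilinear_form s UNIV d \<theta> by unfold_locales (use assms in auto)
  show ?thesis unfolding coordinate_poly_def
    using represented_by_tensor_poly[OF assms(5)] assms(4)
    by (intro the_equality) (auto intro: represented_by_unique[OF char])
qed

lemma scalar_extension_eq_tensor_eval:
  fixes s :: "'f::field \<Rightarrow> 'v::ab_group_add \<Rightarrow> 'v" and b :: "'i::finite \<Rightarrow> 'v"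
  assumes "\<And>m. 1 \<le> m \<Longrightarrow> m \<le> d \<Longrightarrow> of_nat m \<noteq> (0 :: 'f)"
    and "vector_space s" "symmetric_multilinear_on s UNIV d \<theta>" "\<And>v. \<phi> v = \<theta> (replicate d v)"
    and "basis_family s UNIV b UNIV" and h: "comm_ring_hom h"
  shows "scalar_extension h s b d \<phi> x =
    tensor_eval UNIV (\<lambda>is. h (\<theta> (map b is))) (map vec_nth (replicate d x))"
proof -
  have "coordinate_poly s b d \<phi> = tensor_poly UNIV (\<lambda>is. \<theta> (map b is)) d"
    by (rule coordinate_poly_eq_tensor_poly) (use assms in auto)
  thus ?thesis by (simp add: scalar_extension_def eval_tensor_poly[OF h] comp_def)
qed

lemma symmetric_multilinear_tensor_eval:
  fixes T :: "'i::finite list \<Rightarrow> 'f::field"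
  assumes "\<And>is js. length is = d \<Longrightarrow> mset is = mset js \<Longrightarrow> T is = T js"
  shows "symmetric_multilinear_form (*s) UNIV d (\<lambda>xs. tensor_eval UNIV T (map vec_nth xs))"
proof -
  have [simp]: "vec_nth (u + v) = (\<lambda>i. u $ i + v $ i)" "vec_nth (a *s v) = (\<lambda>i. a * v $ i)"
    for u v :: "'f^'i" and a by auto
  have "tensor_eval UNIV T (map vec_nth xs) = tensor_eval UNIV T (map vec_nth ys)"
    if "length xs = d" "mset xs = mset ys" for xs ys
    by (rule tensor_eval_symmetric[OF assms]) (use that in \<open>auto simp: mset_map\<close>)
  thus ?thesis
    by unfold_locales
      (auto simp: symmetric_multilinear_on_def tensor_eval_add tensor_eval_scale
        vec.scale_right_distrib vec.scale_left_distrib)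
qed

context symmetric_multilinear_form
begin

text \<open>The step of polarisation: along the line \<open>v + t w\<close> the form is a polynomial in \<open>t\<close>, and its linear
coefficient is \<open>m\<close> times the value with a single \<open>v\<close> replaced by \<open>w\<close>. The constant coefficient is
recorded because the induction on \<open>m\<close> needs it.\<close>

lemma diagonal_along_line:
  assumes V: "V = UNIV" and "m + length ws = d"
  shows "\<exists>q. degree q \<le> m \<and> (\<forall>t. \<theta> (replicate m (v + s t w) @ ws) = poly q t) \<and>
    coeff q 0 = \<theta> (replicate m v @ ws) \<and>
    coeff q 1 = of_nat m * \<theta> (replicate (m - 1) v @ w # ws)"
  using assms(2)
proof (induction m arbitrary: ws)
  case 0
  show ?case by (rule exI[of _ "[:\<theta> ws:]"]) simp
next
  case (Suc m)
  let ?y = "\<lambda>t. v + s t w"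
  obtain q where q: "degree q \<le> m" "\<And>t. \<theta> (replicate m (?y t) @ v # ws) = poly q t"
    "coeff q 0 = \<theta> (replicate m v @ v # ws)"
    "coeff q 1 = of_nat m * \<theta> (replicate (m - 1) v @ w # v # ws)"
    using Suc.IH[of "v # ws"] Suc.prems by auto
  obtain r where r: "degree r \<le> m" "\<And>t. \<theta> (replicate m (?y t) @ w # ws) = poly r t"
    "coeff r 0 = \<theta> (replicate m v @ w # ws)"
    using Suc.IH[of "w # ws"] Suc.prems by auto
  have *: "\<theta> xs = \<theta> ys" if "mset xs = mset ys" "length xs = d" for xs ys
    by (rule perm) (use that V in auto)
  show ?case
  proof (intro exI[of _ "q + pCons 0 r"] conjI allI)
    show "degree (q + pCons 0 r) \<le> Suc m"
      using q(1) r(1) by (intro degree_add_le) (auto intro: order.trans[OF degree_pCons_le])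
    show "\<theta> (replicate (Suc m) (?y t) @ ws) = poly (q + pCons 0 r) t" for t
    proof -
      have "\<theta> (replicate (Suc m) (?y t) @ ws) = \<theta> (replicate m (?y t) @ ?y t # ws)"
        by (rule *) (use Suc.prems in auto)
      thus ?thesis using Suc.prems V by (simp add: add_slot scale_slot q(2) r(2))
    qed
    show "coeff (q + pCons 0 r) 0 = \<theta> (replicate (Suc m) v @ ws)"
      using q(3) *[of "replicate m v @ v # ws" "replicate (Suc m) v @ ws"] Suc.prems by simp
    have "of_nat m * \<theta> (replicate (m - 1) v @ w # v # ws) = of_nat m * \<theta> (replicate m v @ w # ws)"
    proof (cases m)
      case (Suc k)
      have "\<theta> (replicate (m - 1) v @ w # v # ws) = \<theta> (replicate m v @ w # ws)"
        by (rule *) (use Suc Suc.prems in auto)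
      thus ?thesis by simp
    qed auto
    thus "coeff (q + pCons 0 r) 1 = of_nat (Suc m) * \<theta> (replicate (Suc m - 1) v @ w # ws)"
      using q(4) r(3) by (simp add: ring_distribs)
  qed
qed

text \<open>Polarisation by counting roots. Arguments are freed one at a time: if the form vanishes whenever
\<open>m\<close> of its arguments coincide, then the polynomial along each line has at least \<open>d + 1\<close> roots but degree
at most \<open>m\<close>, so its linear coefficient vanishes, and \<open>m\<close> is invertible.\<close>

lemma zero_if_diagonal_zero:
  assumes V: "V = UNIV" and char: "\<And>m. 1 \<le> m \<Longrightarrow> m \<le> d \<Longrightarrow> of_nat m \<noteq> (0 :: 'f)"
    and diag: "\<And>v. \<theta> (replicate d v) = 0" and "length vs = d"
  shows "\<theta> vs = 0"
proof -
  have inj: "inj_on (of_nat :: nat \<Rightarrow> 'f) {..d}" by (rule inj_on_of_nat_atMost) (rule char)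
  have "\<theta> (replicate (d - length ws) v @ ws) = 0" if "length ws \<le> d" for ws v
    using that
  proof (induction ws arbitrary: v)
    case (Cons w ws)
    define m where "m = d - length ws"
    have m: "m + length ws = d" "1 \<le> m" "m \<le> d" using Cons.prems by (auto simp: m_def)
    obtain q where q: "degree q \<le> m" "\<And>t. \<theta> (replicate m (v + s t w) @ ws) = poly q t"
      "coeff q 1 = of_nat m * \<theta> (replicate (m - 1) v @ w # ws)"
      using diagonal_along_line[OF V m(1)] by blast
    have "poly q t = 0" for t
      using Cons.IH Cons.prems q(2) by (simp add: m_def)
    moreover have "card ((of_nat :: nat \<Rightarrow> 'f) ` {..d}) > degree q"
      using inj q(1) m by (simp add: card_image)
    ultimately have "q = 0" by (intro poly_eqI_degree[of "of_nat ` {..d}" q 0]) auto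
    thus ?case using q(3) char[OF m(2,3)] by (simp add: m_def)
  qed (use diag in auto)
  from this[of vs] show ?thesis using assms(4) by simp
qed

end

section \<open>The centre of a form and the uniqueness of orthogonal decompositions\<close>

text \<open>The self-adjoint endomorphisms make up the centre of \<open>\<theta>\<close>. For symmetric \<open>\<theta>\<close> the condition on
the first two slots implies that on any two slots.\<close>

definition self_adjoint :: "nat \<Rightarrow> ('v list \<Rightarrow> 'f) \<Rightarrow> ('v \<Rightarrow> 'v) \<Rightarrow> bool" where
  "self_adjoint d \<theta> A \<longleftrightarrow> (\<forall>x y zs. length zs + 2 = d \<longrightarrow> \<theta> (A x # y # zs) = \<theta> (x # A y # zs))"

locale nondegenerate_multilinear_form = symmetric_multilinear_form s UNIV d \<theta>
  for s :: "'f::field \<Rightarrow> 'v::ab_group_add \<Rightarrow> 'v" and d and \<theta> +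
  assumes three: "d \<ge> 3"
    and nondegenerate: "\<And>v. (\<And>vs. length vs + 1 = d \<Longrightarrow> \<theta> (v # vs) = 0) \<Longrightarrow> v = 0"
begin

lemma permute: "length xs = d \<Longrightarrow> mset xs = mset ys \<Longrightarrow> \<theta> xs = \<theta> ys"
  by (rule perm) auto

lemma add_first: "length vs + 1 = d \<Longrightarrow> \<theta> ((u + v) # vs) = \<theta> (u # vs) + \<theta> (v # vs)"
  using add_slot[of "[]" vs u v] by simp

lemma diff_first: "length vs + 1 = d \<Longrightarrow> \<theta> ((u - v) # vs) = \<theta> (u # vs) - \<theta> (v # vs)"
  using add_first[of vs "u - v" v] by simp

lemma zero_first: "length vs + 1 = d \<Longrightarrow> \<theta> (0 # vs) = 0"
  using zero_slot[of "[]" vs] by simp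

text \<open>A third slot allows the two operators to be moved past each other:
\<open>\<theta>(ABx, y, z) = \<theta>(Bx, Ay, z) = \<theta>(x, Ay, Bz) = \<theta>(Ax, y, Bz) = \<theta>(BAx, y, z)\<close>, and nondegeneracy
concludes. This is where degree at least \<open>3\<close> matters; quadratic forms in general have
noncommuting self-adjoint operators.\<close>

lemma self_adjoint_commute:
  assumes A: "self_adjoint d \<theta> A" and B: "self_adjoint d \<theta> B"
  shows "A (B x) = B (A x)"
proof -
  have "\<theta> ((A (B x) - B (A x)) # vs) = 0" if len: "length vs + 1 = d" for vs
  proof -
    obtain y z zs where vs: "vs = y # z # zs"
      using len three by (cases vs; cases "tl vs") auto
    have len': "length (z # zs) + 2 = d" "length (y # zs) + 2 = d" using len vs by auto
    have "\<theta> (A (B x) # y # z # zs) = \<theta> (B x # A y # z # zs)"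
      using A len' unfolding self_adjoint_def by simp
    also have "\<dots> = \<theta> (B x # z # A y # zs)" by (rule permute) (use len' in auto)
    also have "\<dots> = \<theta> (x # B z # A y # zs)" using B len' unfolding self_adjoint_def by simp
    also have "\<dots> = \<theta> (x # A y # B z # zs)" by (rule permute) (use len' in auto)
    also have "\<dots> = \<theta> (A x # y # B z # zs)" using A len' unfolding self_adjoint_def by simp
    also have "\<dots> = \<theta> (A x # B z # y # zs)" by (rule permute) (use len' in auto)
    also have "\<dots> = \<theta> (B (A x) # z # y # zs)" using B len' unfolding self_adjoint_def by simp
    also have "\<dots> = \<theta> (B (A x) # y # z # zs)" by (rule permute) (use len' in auto)
    finally show ?thesis using len by (simp add: vs diff_first)
  qed
  hence "A (B x) - B (A x) = 0" by (rule nondegenerate)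
  thus ?thesis by simp
qed

text \<open>One copy of the idempotent \<open>E\<close> in the first slot is as good as two, so a copy can be moved to
each of the other slots in turn.\<close>

lemma self_adjoint_absorb:
  assumes E: "self_adjoint d \<theta> E" and idem: "\<And>x. E (E x) = E x" and "length us + 1 = d"
  shows "\<theta> (E v # us) = \<theta> (E v # map E us)"
proof -
  have "\<theta> (E v # ys @ us) = \<theta> (E v # ys @ map E us)" if "length ys + length us + 1 = d" for ys
    using that
  proof (induction us arbitrary: ys)
    case (Cons u us)
    have "\<theta> (E v # ys @ u # us) = \<theta> (E (E v) # u # ys @ us)"
      unfolding idem by (rule permute) (use Cons.prems in auto)
    also have "\<dots> = \<theta> (E v # E u # ys @ us)"
      using E Cons.prems unfolding self_adjoint_def by simp
    also have "\<dots> = \<theta> (E v # (ys @ [E u]) @ us)" by (rule permute) (use Cons.prems in auto)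
    also have "\<dots> = \<theta> (E v # (ys @ [E u]) @ map E us)"
      by (rule Cons.IH) (use Cons.prems in auto)
    finally show ?case by simp
  qed auto
  from this[of "[]"] assms(3) show ?thesis by simp
qed

text \<open>A vector of \<open>range E\<close> pairs with arbitrary arguments as it does with their images under \<open>E\<close>, so
a radical vector of the restriction is a radical vector of the whole form.\<close>

lemma range_form_nondegenerate:
  assumes E: "self_adjoint d \<theta> E" "\<And>x. E (E x) = E x" "Vector_Spaces.linear s s E"
    and fin: "finite B" "span B = UNIV" and \<phi>: "\<And>v. \<phi> v = \<theta> (replicate d v)"
  shows "nondegenerate_form_on s (range E) d \<phi>"
proof -
  have sub: "subspace (range E)"
    using E(3) by (auto simp: Vector_Spaces.linear_iff intro!: subspaceI)
      (metis rangeI scale_zero_left, metis rangeI, metis rangeI)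
  have sml': "symmetric_multilinear_on s (range E) d \<theta>"
    using sml unfolding symmetric_multilinear_on_def by auto
  interpret E: symmetric_multilinear_form s "range E" d \<theta>
    by unfold_locales (use sub sml' in auto)
  have "form_on s (range E) d \<phi>"
    by (rule E.form_on_diagonal[of \<phi> B]) (use fin \<phi> in auto)
  moreover have "v = 0" if v: "v \<in> range E"
    and zero: "\<forall>vs. set vs \<subseteq> range E \<longrightarrow> length vs = d - 1 \<longrightarrow> \<theta> (v # vs) = 0" for v
  proof (rule nondegenerate)
    fix vs :: "'v list" assume len: "length vs + 1 = d"
    have "\<theta> (v # vs) = \<theta> (v # map E vs)"
      using self_adjoint_absorb[OF E(1,2) len] v by auto
    moreover have "set (map E vs) \<subseteq> range E" by auto
    ultimately show "\<theta> (v # vs) = 0" using zero[rule_format, of "map E vs"] len by simp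
  qed
  ultimately show ?thesis using sml' \<phi> unfolding nondegenerate_form_on_def by blast
qed

text \<open>The summands are the ranges of \<open>E\<close> and of \<open>1 - E\<close>. Mixed terms vanish, since moving \<open>E\<close> into a slot
that contains a value of \<open>1 - E\<close> yields zero.\<close>

lemma decomposable_if_idempotent:
  assumes E: "self_adjoint d \<theta> E" "\<And>x. E (E x) = E x" "Vector_Spaces.linear s s E"
    and nontrivial: "\<exists>v. E v \<noteq> 0" "\<exists>v. E v \<noteq> v"
    and fin: "finite B" "span B = UNIV" and \<phi>: "\<And>v. \<phi> v = \<theta> (replicate d v)"
  shows "decomposable s UNIV d \<phi>"
proof -
  define E' where "E' = (\<lambda>v. v - E v)"
  interpret vector_space_prod s s by unfold_locales
  have lin: "E (x + y) = E x + E y" "E (s a x) = s a (E x)" for x y a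
    using E(3) by (auto simp: Vector_Spaces.linear_iff)
  have E0: "E 0 = 0" using lin(1)[of 0 0] by simp
  have Ediff: "E (x - y) = E x - E y" for x y using lin(1)[of "x - y" y] by simp
  have EE': "E (E' x) = 0" for x by (simp add: E'_def Ediff E(2))
  have E': "self_adjoint d \<theta> E'" unfolding self_adjoint_def
  proof (intro allI impI)
    fix x y and zs :: "'v list" assume len: "length zs + 2 = d"
    have "\<theta> (x # E' y # zs) = \<theta> (E' y # x # zs)" by (rule permute) (use len in auto)
    also have "\<dots> = \<theta> (y # x # zs) - \<theta> (E y # x # zs)"
      using len by (simp add: E'_def diff_first)
    also have "\<theta> (y # x # zs) = \<theta> (x # y # zs)" by (rule permute) (use len in auto)
    also have "\<theta> (E y # x # zs) = \<theta> (x # E y # zs)" by (rule permute) (use len in auto)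
    also have "\<theta> (x # E y # zs) = \<theta> (E x # y # zs)"
      using E(1) len unfolding self_adjoint_def by simp
    finally show "\<theta> (E' x # y # zs) = \<theta> (x # E' y # zs)"
      using len by (simp add: E'_def diff_first)
  qed
  have E'2: "E' (E' x) = E' x" for x by (simp add: E'_def Ediff E(2))
  have E'3: "Vector_Spaces.linear s s E'"
    using lin vector_space_axioms by (auto simp: Vector_Spaces.linear_iff E'_def algebra_simps)
  let ?f = "\<lambda>v. (E v, E' v)"
  have "Vector_Spaces.linear s scale ?f"
    using lin p.vector_space_axioms vector_space_axioms
    by (auto simp: Vector_Spaces.linear_iff scale_def E'_def algebra_simps)
  moreover have "bij_betw ?f UNIV (range E \<times> range E')"
  proof (rule bij_betwI[where g = "\<lambda>(u, v). u + v"])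
    show "(\<lambda>(u, v). u + v) \<in> range E \<times> range E' \<rightarrow> UNIV" by auto
    show "?f \<in> UNIV \<rightarrow> range E \<times> range E'" by auto
    show "(\<lambda>(u, v). u + v) (?f x) = x" for x by (simp add: E'_def)
    show "?f ((\<lambda>(u, v). u + v) y) = y" if "y \<in> range E \<times> range E'" for y
      using that by (auto simp: lin EE' E(2)) (simp add: E'_def lin E(2) Ediff)
  qed
  moreover have "orthogonal_sum \<phi> \<phi> (?f v) = \<phi> v" for v
  proof -
    obtain k where d: "d = Suc k" using three by (cases d) auto
    have "\<theta> (v # replicate k v) = \<theta> ((E v + E' v) # replicate k v)" by (simp add: E'_def)
    also have "\<dots> = \<theta> (E v # replicate k v) + \<theta> (E' v # replicate k v)"
      by (rule add_first) (simp add: d)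
    also have "\<theta> (E v # replicate k v) = \<theta> (E v # replicate k (E v))"
      using self_adjoint_absorb[OF E(1,2), of "replicate k v" v] by (simp add: d)
    also have "\<theta> (E' v # replicate k v) = \<theta> (E' v # replicate k (E' v))"
      using self_adjoint_absorb[OF E' E'2, of "replicate k v" v] by (simp add: d)
    finally show ?thesis by (simp add: orthogonal_sum_def \<phi> d)
  qed
  ultimately have "isomorphic_forms s UNIV \<phi> scale (range E \<times> range E') (orthogonal_sum \<phi> \<phi>)"
    unfolding isomorphic_forms_def by blast
  moreover have "range E \<noteq> {0}" using nontrivial(1) by auto
  moreover have "range E' \<noteq> {0}"
  proof -
    obtain v where "E v \<noteq> v" using nontrivial(2) by blast
    hence "E' v \<noteq> 0" by (simp add: E'_def)
    thus ?thesis by blast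
  qed
  moreover note range_form_nondegenerate[OF E fin \<phi>] range_form_nondegenerate[OF E' E'2 E'3 fin \<phi>]
  ultimately show ?thesis
    unfolding decomposable_def
    by (intro exI[of _ "range E"] exI[of _ "range E'"] exI[of _ \<phi>] conjI) simp_all
qed

end

text \<open>The maps \<open>P \<sigma>\<close> and \<open>Q \<sigma>\<close> are the projections and inclusions of an orthogonal sum with components
\<open>\<theta> \<sigma>\<close>, and \<open>f\<close> is a similarity of this sum. The projectors \<open>e \<sigma> = Q \<sigma> P \<sigma>\<close> and their conjugates
\<open>e' \<tau> = f e \<tau> f\<^sup>-\<^sup>1\<close> lie in the centre, hence commute. So the compression \<open>b \<sigma> \<tau>\<close> of \<open>e' \<tau>\<close> to the
component \<open>\<sigma>\<close> is a self-adjoint idempotent there, that is, \<open>0\<close> or \<open>1\<close>. The compressions for all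
\<open>\<tau>\<close> add up to \<open>1\<close>, so one of them is \<open>1\<close>; call its index \<open>\<rho> \<sigma>\<close>. Then \<open>f\<close> carries the component
\<open>\<rho> \<sigma>\<close> onto the component \<open>\<sigma>\<close>.\<close>

lemma similar_orthogonal_sums_permute_blocks:
  fixes \<theta> :: "'\<sigma> \<Rightarrow> ('f::field^'m) list \<Rightarrow> 'f" and P :: "'\<sigma> \<Rightarrow> 'f^'n^'m" and Q :: "'\<sigma> \<Rightarrow> 'f^'m^'n"
  assumes S: "finite S"
    and form: "\<And>\<sigma>. \<sigma> \<in> S \<Longrightarrow> nondegenerate_multilinear_form (*s) d (\<theta> \<sigma>)"
    and primitive: "\<And>\<sigma> E. \<sigma> \<in> S \<Longrightarrow> E ** E = E \<Longrightarrow> self_adjoint d (\<theta> \<sigma>) ((*v) E) \<Longrightarrow> E = 0 \<or> E = mat 1"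
    and PQ: "\<And>\<sigma> \<tau>. \<sigma> \<in> S \<Longrightarrow> \<tau> \<in> S \<Longrightarrow> P \<tau> ** Q \<sigma> = (if \<tau> = \<sigma> then mat 1 else 0)"
    and QP: "(\<Sum>\<sigma>\<in>S. Q \<sigma> ** P \<sigma>) = mat 1"
    and f: "f ** f' = mat 1" "f' ** f = mat 1" and g: "g \<noteq> 0"
    and sim: "\<And>vs. length vs = d \<Longrightarrow>
      (\<Sum>\<sigma>\<in>S. \<theta> \<sigma> (map (\<lambda>v. P \<sigma> *v (f *v v)) vs)) = g * (\<Sum>\<sigma>\<in>S. \<theta> \<sigma> (map ((*v) (P \<sigma>)) vs))"
  obtains \<rho> where "\<rho> ` S \<subseteq> S" "inj_on \<rho> S"
    "\<And>\<sigma>. \<sigma> \<in> S \<Longrightarrow> \<exists>F F'. F ** F' = mat 1 \<and> F' ** F = mat 1 \<and>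
       (\<forall>w. \<theta> \<sigma> (replicate d (F *v w)) = g * \<theta> (\<rho> \<sigma>) (replicate d w))"
proof -
  define \<Theta> where "\<Theta> vs = (\<Sum>\<sigma>\<in>S. \<theta> \<sigma> (map ((*v) (P \<sigma>)) vs))" for vs
  define e where "e \<sigma> = Q \<sigma> ** P \<sigma>" for \<sigma>
  define e' where "e' \<sigma> = f ** e \<sigma> ** f'" for \<sigma>
  note mv = matrix_vector_mul_assoc[symmetric]
  have fv: "f *v (f' *v x) = x" "f' *v (f *v x) = x" for x by (simp_all add: matrix_vector_mul_assoc f)
  have PQv: "P \<tau> *v (Q \<sigma> *v w) = (if \<tau> = \<sigma> then w else 0)" if "\<sigma> \<in> S" "\<tau> \<in> S" for \<sigma> \<tau> w
    using PQ[OF that] by (simp add: matrix_vector_mul_assoc)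
  have sum_mv: "(\<Sum>\<sigma>\<in>S. M \<sigma>) *v x = (\<Sum>\<sigma>\<in>S. M \<sigma> *v x)" for M :: "'\<sigma> \<Rightarrow> 'f^'c^'r" and x
    by (induction S rule: infinite_finite_induct) (simp_all add: matrix_vector_mult_add_rdistrib)
  have mv_sum: "M *v (\<Sum>\<sigma>\<in>S. x \<sigma>) = (\<Sum>\<sigma>\<in>S. M *v x \<sigma>)" for M :: "'f^'c^'r" and x :: "'\<sigma> \<Rightarrow> 'f^'c"
    by (induction S rule: infinite_finite_induct) (simp_all add: matrix_vector_right_distrib)
  have esum: "(\<Sum>\<sigma>\<in>S. e \<sigma> *v v) = v" for v
    using QP by (simp add: e_def flip: sum_mv)
  have d3: "d \<ge> 3" if "S \<noteq> {}"
    using form that nondegenerate_multilinear_form.three by blast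
  have theta_zero: "\<theta> \<sigma> (0 # vs) = 0" if "\<sigma> \<in> S" "length vs + 1 = d" for \<sigma> vs
    using form[OF that(1)] that(2) by (rule nondegenerate_multilinear_form.zero_first)
  have theta_perm: "\<theta> \<sigma> xs = \<theta> \<sigma> ys" if "\<sigma> \<in> S" "length xs = d" "mset xs = mset ys" for \<sigma> xs ys
    using form[OF that(1)] that(2,3) by (rule nondegenerate_multilinear_form.permute)
  have Theta_perm: "\<Theta> xs = \<Theta> ys" if "length xs = d" "mset xs = mset ys" for xs ys
    unfolding \<Theta>_def by (intro sum.cong refl theta_perm) (use that in auto)
  have Theta_block: "\<Theta> (v # map ((*v) (Q \<sigma>)) ws) = \<theta> \<sigma> (P \<sigma> *v v # ws)"
    if "\<sigma> \<in> S" "length ws + 1 = d" "ws \<noteq> []" for \<sigma> v ws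
  proof -
    have "\<theta> \<tau> (map ((*v) (P \<tau>)) (v # map ((*v) (Q \<sigma>)) ws)) =
        (if \<tau> = \<sigma> then \<theta> \<sigma> (P \<sigma> *v v # ws) else 0)" if \<tau>: "\<tau> \<in> S" for \<tau>
    proof (cases "\<tau> = \<sigma>")
      case True
      have "map ((*v) (P \<sigma>)) (map ((*v) (Q \<sigma>)) ws) = ws"
        by (rule nth_equalityI) (use \<open>\<sigma> \<in> S\<close> in \<open>auto simp: PQv\<close>)
      thus ?thesis using True by simp
    next
      case False
      obtain w ws' where ws: "ws = w # ws'" using \<open>ws \<noteq> []\<close> by (cases ws) auto
      let ?l = "map ((*v) (P \<tau>)) (map ((*v) (Q \<sigma>)) ws')"
      have "\<theta> \<tau> (P \<tau> *v v # 0 # ?l) = \<theta> \<tau> (0 # P \<tau> *v v # ?l)"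
        by (rule theta_perm) (use that \<open>length ws + 1 = d\<close> ws in auto)
      also have "\<dots> = 0" by (rule theta_zero) (use that \<open>length ws + 1 = d\<close> ws in auto)
      finally show ?thesis using False PQv[OF \<open>\<sigma> \<in> S\<close> \<tau>] ws by simp
    qed
    hence "\<Theta> (v # map ((*v) (Q \<sigma>)) ws) = (\<Sum>\<tau>\<in>S. if \<tau> = \<sigma> then \<theta> \<sigma> (P \<sigma> *v v # ws) else 0)"
      unfolding \<Theta>_def by (intro sum.cong) auto
    thus ?thesis using S that(1) by simp
  qed
  have Theta_diag: "\<Theta> (replicate d (Q \<sigma> *v w)) = \<theta> \<sigma> (replicate d w)" if "\<sigma> \<in> S" for \<sigma> w
  proof -
    have "d \<ge> 3" using d3 that by blast
    then obtain k where k: "d = Suc (Suc k)" by (cases d; cases "d - 1") auto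
    show ?thesis using Theta_block[OF that, of "replicate (Suc k) w" "Q \<sigma> *v w"] that
      by (simp add: k PQv)
  qed
  have Theta_nondeg: "nondegenerate_multilinear_form (*s) d \<Theta>" if "S \<noteq> {}"
  proof (unfold_locales)
    show "vec.subspace (UNIV :: ('f^'n) set)" by simp
    have sl: "symmetric_multilinear_on (*s) UNIV d (\<theta> \<sigma>)" if "\<sigma> \<in> S" for \<sigma>
      using form[OF that] by (simp add: nondegenerate_multilinear_form_def symmetric_multilinear_form_def
          symmetric_multilinear_form_axioms_def)
    show "symmetric_multilinear_on (*s) UNIV d \<Theta>"
      unfolding symmetric_multilinear_on_def
    proof (intro conjI allI impI)
      show "\<Theta> xs = \<Theta> ys" if "length xs = d" "mset xs = mset ys" for xs ys
        using that by (rule Theta_perm)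
      fix xs ys :: "('f^'n) list" and u v :: "'f^'n" and a assume len: "length xs + length ys + 1 = d"
      have "\<theta> \<sigma> (map ((*v) (P \<sigma>)) xs @ (P \<sigma> *v u + P \<sigma> *v v) # map ((*v) (P \<sigma>)) ys) =
          \<theta> \<sigma> (map ((*v) (P \<sigma>)) xs @ (P \<sigma> *v u) # map ((*v) (P \<sigma>)) ys) +
          \<theta> \<sigma> (map ((*v) (P \<sigma>)) xs @ (P \<sigma> *v v) # map ((*v) (P \<sigma>)) ys)"
        "\<theta> \<sigma> (map ((*v) (P \<sigma>)) xs @ (a *s (P \<sigma> *v v)) # map ((*v) (P \<sigma>)) ys) =
          a * \<theta> \<sigma> (map ((*v) (P \<sigma>)) xs @ (P \<sigma> *v v) # map ((*v) (P \<sigma>)) ys)" if "\<sigma> \<in> S" for \<sigma>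
        using sl[OF that] len unfolding symmetric_multilinear_on_def by simp_all
      thus "\<Theta> (xs @ (u + v) # ys) = \<Theta> (xs @ u # ys) + \<Theta> (xs @ v # ys)"
        "\<Theta> (xs @ a *s v # ys) = a * \<Theta> (xs @ v # ys)"
        by (simp_all add: \<Theta>_def matrix_vector_right_distrib vector_scalar_commute sum.distrib sum_distrib_left)
    qed
    show "3 \<le> d" using d3 that .
    fix v assume zero: "\<And>vs. length vs + 1 = d \<Longrightarrow> \<Theta> (v # vs) = 0"
    have "P \<sigma> *v v = 0" if "\<sigma> \<in> S" for \<sigma>
    proof (rule nondegenerate_multilinear_form.nondegenerate[OF form[OF that]])
      fix ws :: "('f^'m) list" assume "length ws + 1 = d"
      thus "\<theta> \<sigma> (P \<sigma> *v v # ws) = 0"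
        using zero[of "map ((*v) (Q \<sigma>)) ws"] Theta_block[OF that, of ws v] d3 \<open>S \<noteq> {}\<close> by fastforce
    qed
    thus "v = 0" using esum[of v] by (simp add: e_def mv)
  qed
  have sim': "\<Theta> (map ((*v) f) vs) = g * \<Theta> vs" if "length vs = d" for vs
    using sim[OF that] by (simp add: \<Theta>_def comp_def)
  have Pe: "P \<sigma> *v (e \<tau> *v x) = (if \<sigma> = \<tau> then P \<sigma> *v x else 0)" if "\<sigma> \<in> S" "\<tau> \<in> S" for \<sigma> \<tau> x
    using that by (simp add: e_def mv PQv)
  have e_sa: "self_adjoint d \<Theta> ((*v) (e \<tau>))" if \<tau>: "\<tau> \<in> S" for \<tau>
    unfolding self_adjoint_def
  proof (intro allI impI)
    fix x y and zs :: "('f^'n) list" assume len: "length zs + 2 = d"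
    have "\<theta> \<sigma> (P \<sigma> *v (e \<tau> *v x) # P \<sigma> *v y # map ((*v) (P \<sigma>)) zs) =
        \<theta> \<sigma> (P \<sigma> *v x # P \<sigma> *v (e \<tau> *v y) # map ((*v) (P \<sigma>)) zs)" if \<sigma>: "\<sigma> \<in> S" for \<sigma>
    proof (cases "\<sigma> = \<tau>")
      case False
      have "\<theta> \<sigma> (P \<sigma> *v x # 0 # map ((*v) (P \<sigma>)) zs) = \<theta> \<sigma> (0 # P \<sigma> *v x # map ((*v) (P \<sigma>)) zs)"
        by (rule theta_perm) (use \<sigma> len in auto)
      thus ?thesis using False len by (simp add: Pe[OF \<sigma> \<tau>] theta_zero[OF \<sigma>])
    next
      case True
      thus ?thesis by (simp add: Pe[OF \<tau> \<tau>])
    qed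
    thus "\<Theta> (e \<tau> *v x # y # zs) = \<Theta> (x # e \<tau> *v y # zs)"
      by (simp add: \<Theta>_def)
  qed
  have e'_sa: "self_adjoint d \<Theta> ((*v) (e' \<tau>))" if \<tau>: "\<tau> \<in> S" for \<tau>
    unfolding self_adjoint_def
  proof (intro allI impI)
    fix x y and zs :: "('f^'n) list" assume len: "length zs + 2 = d"
    let ?zs = "map ((*v) f') zs"
    have zs: "map ((*v) f) ?zs = zs" by (rule nth_equalityI) (auto simp: fv)
    have "\<Theta> (e' \<tau> *v x # y # zs) = \<Theta> (map ((*v) f) (e \<tau> *v (f' *v x) # f' *v y # ?zs))"
      by (simp add: e'_def mv fv zs del: map_map)
    also have "\<dots> = g * \<Theta> (e \<tau> *v (f' *v x) # f' *v y # ?zs)"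
      by (rule sim') (use len in auto)
    also have "\<dots> = g * \<Theta> (f' *v x # e \<tau> *v (f' *v y) # ?zs)"
      using e_sa[OF \<tau>] len unfolding self_adjoint_def by simp
    also have "\<dots> = \<Theta> (map ((*v) f) (f' *v x # e \<tau> *v (f' *v y) # ?zs))"
      by (rule sim'[symmetric]) (use len in auto)
    also have "\<dots> = \<Theta> (x # e' \<tau> *v y # zs)"
      by (simp add: e'_def mv fv zs del: map_map)
    finally show "\<Theta> (e' \<tau> *v x # y # zs) = \<Theta> (x # e' \<tau> *v y # zs)" .
  qed
  have comm: "e \<sigma> *v (e' \<tau> *v x) = e' \<tau> *v (e \<sigma> *v x)" if "\<sigma> \<in> S" "\<tau> \<in> S" for \<sigma> \<tau> x
  proof -
    have "S \<noteq> {}" using that by auto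
    from nondegenerate_multilinear_form.self_adjoint_commute[OF Theta_nondeg[OF this]
        e_sa[OF that(1)] e'_sa[OF that(2)]] show ?thesis .
  qed
  have ee: "e \<sigma> *v (e \<sigma> *v x) = e \<sigma> *v x" if "\<sigma> \<in> S" for \<sigma> x
    using that by (simp add: e_def mv PQv)
  have e'e': "e' \<sigma> *v (e' \<sigma> *v x) = e' \<sigma> *v x" if "\<sigma> \<in> S" for \<sigma> x
    using that by (simp add: e'_def mv fv ee)
  define b where "b \<sigma> \<tau> = P \<sigma> ** e' \<tau> ** Q \<sigma>" for \<sigma> \<tau>
  have QP_e: "Q \<sigma> *v (P \<sigma> *v x) = e \<sigma> *v x" for \<sigma> x by (simp add: e_def mv)
  have eQ: "e \<sigma> *v (Q \<sigma> *v w) = Q \<sigma> *v w" if "\<sigma> \<in> S" for \<sigma> w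
    using that by (simp add: e_def mv PQv)
  have b01: "b \<sigma> \<tau> = 0 \<or> b \<sigma> \<tau> = mat 1" if \<sigma>: "\<sigma> \<in> S" and \<tau>: "\<tau> \<in> S" for \<sigma> \<tau>
  proof (rule primitive[OF \<sigma>])
    show "b \<sigma> \<tau> ** b \<sigma> \<tau> = b \<sigma> \<tau>"
      unfolding matrix_eq
      by (simp add: b_def mv QP_e comm[OF \<sigma> \<tau>] e'e'[OF \<tau>] eQ[OF \<sigma>])
    show "self_adjoint d (\<theta> \<sigma>) ((*v) (b \<sigma> \<tau>))"
      unfolding self_adjoint_def
    proof (intro allI impI)
      fix x y and zs :: "('f^'m) list" assume len: "length zs + 2 = d"
      let ?zs = "map ((*v) (Q \<sigma>)) zs"
      have "\<theta> \<sigma> (b \<sigma> \<tau> *v x # y # zs) = \<Theta> (e' \<tau> *v (Q \<sigma> *v x) # Q \<sigma> *v y # ?zs)"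
        using Theta_block[OF \<sigma>, of "y # zs" "e' \<tau> *v (Q \<sigma> *v x)"] len
        by (simp add: b_def mv)
      also have "\<dots> = \<Theta> (Q \<sigma> *v x # e' \<tau> *v (Q \<sigma> *v y) # ?zs)"
        using e'_sa[OF \<tau>] len unfolding self_adjoint_def by simp
      also have "\<dots> = \<Theta> (e' \<tau> *v (Q \<sigma> *v y) # Q \<sigma> *v x # ?zs)"
        by (rule Theta_perm) (use len in auto)
      also have "\<dots> = \<theta> \<sigma> (b \<sigma> \<tau> *v y # x # zs)"
        using Theta_block[OF \<sigma>, of "x # zs" "e' \<tau> *v (Q \<sigma> *v y)"] len
        by (simp add: b_def mv)
      also have "\<dots> = \<theta> \<sigma> (x # b \<sigma> \<tau> *v y # zs)"
        by (rule theta_perm[OF \<sigma>]) (use len in auto)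
      finally show "\<theta> \<sigma> (b \<sigma> \<tau> *v x # y # zs) = \<theta> \<sigma> (x # b \<sigma> \<tau> *v y # zs)" .
    qed
  qed
  have "\<exists>\<tau>\<in>S. b \<sigma> \<tau> = mat 1" if \<sigma>: "\<sigma> \<in> S" for \<sigma>
  proof (rule ccontr)
    assume "\<not> ?thesis"
    hence zero: "b \<sigma> \<tau> = 0" if "\<tau> \<in> S" for \<tau> using b01[OF \<sigma> that] that by auto
    have "w = 0" for w :: "'f^'m"
    proof -
      have "w = P \<sigma> *v (f *v (\<Sum>\<tau>\<in>S. e \<tau> *v (f' *v (Q \<sigma> *v w))))"
        by (simp add: esum fv PQv \<sigma>)
      also have "\<dots> = (\<Sum>\<tau>\<in>S. b \<sigma> \<tau> *v w)"
        by (simp add: mv_sum b_def e'_def mv)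
      finally show ?thesis by (simp add: zero)
    qed
    from this[of "axis undefined 1"] show False by (simp add: axis_eq_0_iff)
  qed
  then obtain \<rho> where \<rho>: "\<And>\<sigma>. \<sigma> \<in> S \<Longrightarrow> \<rho> \<sigma> \<in> S" "\<And>\<sigma>. \<sigma> \<in> S \<Longrightarrow> b \<sigma> (\<rho> \<sigma>) = mat 1"
    by metis
  define F where "F \<sigma> = P \<sigma> ** f ** Q (\<rho> \<sigma>)" for \<sigma>
  define F' where "F' \<sigma> = P (\<rho> \<sigma>) ** f' ** Q \<sigma>" for \<sigma>
  have FF': "F \<sigma> ** F' \<sigma> = mat 1" if "\<sigma> \<in> S" for \<sigma>
    using \<rho>(2)[OF that] by (simp add: F_def F'_def b_def e'_def e_def matrix_mul_assoc)
  have F'F: "F' \<sigma> ** F \<sigma> = mat 1" if "\<sigma> \<in> S" for \<sigma>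
    using FF'[OF that] by (rule matrix_left_right_inverse1)
  have FF'v: "F \<sigma> *v (F' \<sigma> *v w) = w" "F' \<sigma> *v (F \<sigma> *v w) = w" if "\<sigma> \<in> S" for \<sigma> w
    using FF'[OF that] F'F[OF that] by (simp_all add: matrix_vector_mul_assoc)
  have e'Q: "e' (\<rho> \<sigma>) *v (Q \<sigma> *v w) = Q \<sigma> *v w" if \<sigma>: "\<sigma> \<in> S" for \<sigma> w
  proof -
    have "e' (\<rho> \<sigma>) *v (Q \<sigma> *v w) = e' (\<rho> \<sigma>) *v (e \<sigma> *v (Q \<sigma> *v w))" by (simp add: eQ \<sigma>)
    also have "\<dots> = e \<sigma> *v (e' (\<rho> \<sigma>) *v (Q \<sigma> *v w))" by (simp add: comm \<sigma> \<rho>)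
    also have "\<dots> = Q \<sigma> *v (b \<sigma> (\<rho> \<sigma>) *v w)" by (simp add: b_def e_def mv)
    finally show ?thesis by (simp add: \<rho> \<sigma>)
  qed
  have fQ: "f *v (Q (\<rho> \<sigma>) *v w) = Q \<sigma> *v (F \<sigma> *v w)" if \<sigma>: "\<sigma> \<in> S" for \<sigma> w
  proof -
    have "f *v (Q (\<rho> \<sigma>) *v w) = f *v (Q (\<rho> \<sigma>) *v (F' \<sigma> *v (F \<sigma> *v w)))"
      by (simp add: FF'v \<sigma>)
    also have "\<dots> = e' (\<rho> \<sigma>) *v (Q \<sigma> *v (F \<sigma> *v w))"
      by (simp add: F'_def e'_def e_def mv)
    finally show ?thesis by (simp add: e'Q \<sigma>)
  qed
  show thesis
  proof (rule that)
    show "\<rho> ` S \<subseteq> S" using \<rho>(1) by auto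
    show "inj_on \<rho> S"
    proof (rule inj_onI, rule ccontr)
      fix \<sigma> \<tau> assume \<sigma>\<tau>: "\<sigma> \<in> S" "\<tau> \<in> S" "\<rho> \<sigma> = \<rho> \<tau>" "\<sigma> \<noteq> \<tau>"
      have "w = 0" for w :: "'f^'m"
      proof -
        have "Q \<sigma> *v w = f *v (Q (\<rho> \<sigma>) *v (F' \<sigma> *v w))"
          using fQ[OF \<sigma>\<tau>(1), of "F' \<sigma> *v w"] FF'v(1)[OF \<sigma>\<tau>(1), of w] by simp
        also have "\<dots> = Q \<tau> *v (F \<tau> *v (F' \<sigma> *v w))"
          using fQ[OF \<sigma>\<tau>(2), of "F' \<sigma> *v w"] \<sigma>\<tau>(3) by simp
        finally have "P \<sigma> *v (Q \<sigma> *v w) = P \<sigma> *v (Q \<tau> *v (F \<tau> *v (F' \<sigma> *v w)))" by simp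
        thus ?thesis using \<sigma>\<tau> by (simp add: PQv)
      qed
      from this[of "axis undefined 1"] show False by (simp add: axis_eq_0_iff)
    qed
    fix \<sigma> assume \<sigma>: "\<sigma> \<in> S"
    have "\<theta> \<sigma> (replicate d (F \<sigma> *v w)) = g * \<theta> (\<rho> \<sigma>) (replicate d w)" for w
    proof -
      have "\<theta> \<sigma> (replicate d (F \<sigma> *v w)) = \<Theta> (replicate d (f *v (Q (\<rho> \<sigma>) *v w)))"
        by (simp add: fQ Theta_diag \<sigma>)
      also have "\<dots> = g * \<Theta> (replicate d (Q (\<rho> \<sigma>) *v w))"
        using sim'[of "replicate d (Q (\<rho> \<sigma>) *v w)"] by simp
      finally show ?thesis by (simp add: Theta_diag \<rho> \<sigma>)
    qed
    thus "\<exists>F F'. F ** F' = mat 1 \<and> F' ** F = mat 1 \<and>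
       (\<forall>w. \<theta> \<sigma> (replicate d (F *v w)) = g * \<theta> (\<rho> \<sigma>) (replicate d w))"
      using FF' F'F \<sigma> by blast
  qed
qed

section \<open>Extension of embeddings and independence of characters\<close>

lemma field_hom_of_nat_eq_0:
  fixes h :: "'a::field \<Rightarrow> 'b::field"
  assumes "field_hom h"
  shows "of_nat m = (0::'b) \<longleftrightarrow> of_nat m = (0::'a)"
proof -
  interpret field_hom h by fact
  have "h (of_nat m) = of_nat m" by (induction m) (simp_all add: hom_add)
  thus ?thesis using hom_0_iff[of "of_nat m"] by simp
qed

text \<open>The graph of a ring homomorphism from a subring of \<open>c\<close> to \<open>c\<close> that sends \<open>\<sigma> a\<close> to \<open>\<rho> a\<close>: a subring
of \<open>c \<times> c\<close> that relates \<open>0\<close> to \<open>0\<close> only, which amounts to being single-valued. Working with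
graphs makes the union of a chain an upper bound without any gluing of functions.\<close>

definition partial_embedding :: "('l \<Rightarrow> 'c) \<Rightarrow> ('l \<Rightarrow> 'c) \<Rightarrow> ('c::field \<times> 'c) set \<Rightarrow> bool" where
  "partial_embedding \<sigma> \<rho> R \<longleftrightarrow>
     (\<forall>a. (\<sigma> a, \<rho> a) \<in> R) \<and>
     (\<forall>x y x' y'. (x, y) \<in> R \<longrightarrow> (x', y') \<in> R \<longrightarrow> (x + x', y + y') \<in> R \<and> (x * x', y * y') \<in> R) \<and>
     (\<forall>y. (0, y) \<in> R \<longrightarrow> y = 0)"

text \<open>The polynomial \<open>r\<close> arises from \<open>q\<close> by applying the partial homomorphism \<open>R\<close> to the coefficients.\<close>

definition coeffs_related :: "('c::field \<times> 'c) set \<Rightarrow> 'c poly \<Rightarrow> 'c poly \<Rightarrow> bool" where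
  "coeffs_related R q r \<longleftrightarrow> (\<forall>i. (coeff q i, coeff r i) \<in> R)"

context
  fixes \<sigma> \<rho> :: "'l::field \<Rightarrow> 'c::field" and R
  assumes hom: "field_hom \<sigma>" "field_hom \<rho>" and R: "partial_embedding \<sigma> \<rho> R"
begin

interpretation \<sigma>: field_hom \<sigma> by (rule hom)
interpretation \<rho>: field_hom \<rho> by (rule hom)

lemma related_base: "(\<sigma> a, \<rho> a) \<in> R"
  using R unfolding partial_embedding_def by blast

lemma related_add: "(x, y) \<in> R \<Longrightarrow> (x', y') \<in> R \<Longrightarrow> (x + x', y + y') \<in> R"
  using R unfolding partial_embedding_def by blast

lemma related_mult: "(x, y) \<in> R \<Longrightarrow> (x', y') \<in> R \<Longrightarrow> (x * x', y * y') \<in> R"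
  using R unfolding partial_embedding_def by blast

lemma related_zero: "(0, 0) \<in> R" using related_base[of 0] by simp

lemma related_one: "(1, 1) \<in> R" using related_base[of 1] by simp

lemma related_uminus: "(x, y) \<in> R \<Longrightarrow> (- x, - y) \<in> R"
  using related_mult[OF related_base[of "-1"]] by (simp add: \<sigma>.hom_uminus \<rho>.hom_uminus)

lemma related_unique:
  assumes "(x, y) \<in> R" "(x, y') \<in> R"
  shows "y = y'"
proof -
  have "(x + - x, y + - y') \<in> R" using assms by (intro related_add related_uminus)
  hence "(0, y - y') \<in> R" by simp
  hence "y - y' = 0" using R unfolding partial_embedding_def by blast
  thus ?thesis by simp
qed

lemma related_sum:
  "(\<And>i. i \<in> S \<Longrightarrow> (f i, g i) \<in> R) \<Longrightarrow> (\<Sum>i\<in>S. f i, \<Sum>i\<in>S. g i) \<in> R"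
  by (induction S rule: infinite_finite_induct) (auto simp: related_zero intro: related_add)

lemma related_power: "(x, y) \<in> R \<Longrightarrow> (x ^ n, y ^ n) \<in> R"
  by (induction n) (auto simp: related_one intro: related_mult)

lemma related_poly:
  assumes "coeffs_related R q r" "(x, y) \<in> R"
  shows "(poly q x, poly r y) \<in> R"
proof -
  define N where "N = max (degree q) (degree r)"
  have eq: "poly p z = (\<Sum>i\<le>N. coeff p i * z ^ i)" if "degree p \<le> N" for p :: "'c poly" and z
    unfolding poly_altdef by (rule sum.mono_neutral_left) (use that in \<open>auto simp: coeff_eq_0\<close>)
  show ?thesis
    using assms by (auto simp: eq N_def coeffs_related_def intro!: related_sum related_mult related_power)
qed

lemma coeffs_related_add:
  "coeffs_related R q r \<Longrightarrow> coeffs_related R q' r' \<Longrightarrow> coeffs_related R (q + q') (r + r')"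
  by (auto simp: coeffs_related_def intro: related_add)

lemma coeffs_related_uminus: "coeffs_related R q r \<Longrightarrow> coeffs_related R (- q) (- r)"
  by (auto simp: coeffs_related_def intro: related_uminus)

lemma coeffs_related_mult:
  "coeffs_related R q r \<Longrightarrow> coeffs_related R q' r' \<Longrightarrow> coeffs_related R (q * q') (r * r')"
  by (auto simp: coeffs_related_def coeff_mult intro!: related_sum related_mult)

lemma coeffs_related_monom: "(x, y) \<in> R \<Longrightarrow> coeffs_related R (monom x n) (monom y n)"
  by (auto simp: coeffs_related_def coeff_monom related_zero)

lemma coeffs_related_base: "coeffs_related R (map_poly \<sigma> p) (map_poly \<rho> p)"
  by (auto simp: coeffs_related_def related_base)

text \<open>The domain of \<open>R\<close> is a field: an algebraic equation for \<open>x\<close> with nonzero constant term expresses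
the inverse of \<open>x\<close> as a polynomial in \<open>x\<close>.\<close>

lemma related_inverse:
  assumes alg: "p \<noteq> 0" "poly (map_poly \<sigma> p) x = 0" and xy: "(x, y) \<in> R" and "x \<noteq> 0"
  shows "\<exists>z. (inverse x, z) \<in> R"
  using alg
proof (induction p)
  case (pCons a p)
  show ?case
  proof (cases "a = 0")
    case True
    with pCons.prems \<open>x \<noteq> 0\<close> show ?thesis by (intro pCons.IH) (auto simp: \<sigma>.map_poly_pCons_hom)
  next
    case False
    have "\<sigma> a + x * poly (map_poly \<sigma> p) x = 0"
      using pCons.prems by (simp add: \<sigma>.map_poly_pCons_hom)
    hence "inverse x = - inverse (\<sigma> a) * poly (map_poly \<sigma> p) x"
      using False \<open>x \<noteq> 0\<close> by (simp add: field_simps eq_neg_iff_add_eq_0)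
    hence "inverse x = \<sigma> (- inverse a) * poly (map_poly \<sigma> p) x"
      by (simp only: \<sigma>.hom_uminus \<sigma>.hom_inverse)
    thus ?thesis
      using related_mult[OF related_base related_poly[OF coeffs_related_base xy]] by metis
  qed
qed simp

text \<open>The usual extension to a simple algebraic extension: \<open>\<beta>\<close> is a root of the image \<open>m'\<close> of the minimal
polynomial \<open>m\<close> of \<open>\<alpha>\<close> over the domain of \<open>R\<close>, and \<open>q(\<alpha>)\<close> is sent to the value at \<open>\<beta>\<close> of the image of
\<open>q\<close>. This is well defined by division with remainder by the monic polynomial \<open>m\<close>.\<close>

lemma partial_embedding_extend:
  assumes alg: "\<And>x. \<exists>p. p \<noteq> 0 \<and> poly (map_poly \<sigma> p) x = 0"
    and root: "\<And>p :: 'c poly. degree p > 0 \<Longrightarrow> \<exists>x. poly p x = 0"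
  shows "\<exists>R' \<beta>. partial_embedding \<sigma> \<rho> R' \<and> R \<subseteq> R' \<and> (\<alpha>, \<beta>) \<in> R'"
proof -
  let ?P = "\<lambda>m. m \<noteq> 0 \<and> poly m \<alpha> = 0 \<and> (\<exists>m'. coeffs_related R m m')"
  obtain p where "p \<noteq> 0" "poly (map_poly \<sigma> p) \<alpha> = 0" using alg by blast
  hence "?P (map_poly \<sigma> p)" using coeffs_related_base by auto
  then obtain m0 where m0: "?P m0" "\<And>q. ?P q \<Longrightarrow> degree m0 \<le> degree q"
    using ex_has_least_nat[of ?P _ degree] by blast
  then obtain m0' where m0': "coeffs_related R m0 m0'" by blast
  obtain z where z: "(inverse (lead_coeff m0), z) \<in> R"
    using related_inverse[of _ "lead_coeff m0" "coeff m0' (degree m0)"] alg m0 m0'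
    unfolding coeffs_related_def by (metis leading_coeff_0_iff)
  \<comment> \<open>Dividing by the leading coefficient, simultaneously on both sides of \<open>R\<close>.\<close>
  define m where "m = monom (inverse (lead_coeff m0)) 0 * m0"
  define m' where "m' = monom z 0 * m0'"
  define n where "n = degree m"
  have mm': "coeffs_related R m m'"
    unfolding m_def m'_def by (intro coeffs_related_mult coeffs_related_monom z m0')
  have m_smult: "m = Polynomial.smult (inverse (lead_coeff m0)) m0" by (simp add: m_def monom_0)
  have n: "n = degree m0" using m0 by (simp add: n_def m_smult)
  have min: "n \<le> degree q" if "q \<noteq> 0" "poly q \<alpha> = 0" "coeffs_related R q r" for q r
    using m0(2) that n by blast
  have lead: "coeff m n = 1" using m0 by (simp add: m_smult n)
  have lead': "coeff m' n = 1"
    using mm' lead related_one related_unique unfolding coeffs_related_def by metis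
  have "coeff m' i = 0" if "i > n" for i
    using mm' related_unique[OF _ related_zero] coeff_eq_0[of m i] that
    unfolding coeffs_related_def n_def by metis
  hence deg': "degree m' = n" using lead'
    by (metis le_degree linorder_neqE_nat leading_coeff_0_iff not_le zero_neq_one degree_0 coeff_0)
  have "m \<noteq> 0" "poly m \<alpha> = 0" using m0 by (auto simp: m_smult)
  hence "n > 0" unfolding n_def by (metis degree_eq_zeroE gr0I mult_poly_0_left poly_pCons add.right_neutral poly_0 mult_zero_right pCons_0_0)
  then obtain \<beta> where \<beta>: "poly m' \<beta> = 0" using root deg' by blast
  have key: "poly r \<beta> = 0" if "coeffs_related R q r" "poly q \<alpha> = 0" for q r
    using that
  proof (induction "degree q" arbitrary: q r rule: less_induct)
    case less
    show ?case
    proof (cases "degree q < n")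
      case True
      hence "q = 0" using min less.prems by fastforce
      hence "coeff r i = 0" for i
        using less.prems(1) related_unique[OF _ related_zero] unfolding coeffs_related_def by auto
      thus ?thesis by (simp add: poly_altdef)
    next
      case False
      define t where "t = monom (lead_coeff q) (degree q - n)"
      define t' where "t' = monom (coeff r (degree q)) (degree q - n)"
      have rel: "coeffs_related R (q + - (t * m)) (r + - (t' * m'))"
        unfolding t_def t'_def using less.prems(1) mm'
        by (intro coeffs_related_add coeffs_related_uminus coeffs_related_mult coeffs_related_monom)
          (auto simp: coeffs_related_def)
      have root: "poly (q + - (t * m)) \<alpha> = 0"
        using less.prems(2) \<open>poly m \<alpha> = 0\<close> by simp
      have "poly (r + - (t' * m')) \<beta> = 0"
      proof (cases "q + - (t * m) = 0")
        case True
        hence "coeff (r + - (t' * m')) i = 0" for i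
          using rel related_unique[OF _ related_zero] unfolding coeffs_related_def True by (metis coeff_0)
        hence "r + - (t' * m') = 0" by (intro poly_eqI) simp
        thus ?thesis by (metis poly_0)
      next
        case nz: False
        have "degree (t * m) \<le> degree q"
          using False degree_mult_le[of t m] degree_monom_le[of "lead_coeff q" "degree q - n"]
          unfolding t_def n_def by linarith
        moreover have "coeff (t * m) (degree q) = lead_coeff q"
          using False lead by (simp add: t_def coeff_monom_mult)
        ultimately have le: "degree (q + - (t * m)) \<le> degree q" and
          "coeff (q + - (t * m)) (degree q) = 0"
          by (simp_all add: degree_diff_le)
        hence "degree (q + - (t * m)) \<noteq> degree q" using nz by (metis leading_coeff_0_iff)
        hence "degree (q + - (t * m)) < degree q" using le by simp
        from less.hyps[OF this rel root] show ?thesis .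
      qed
      thus ?thesis using \<beta> by simp
    qed
  qed
  define R' where "R' = {(poly q \<alpha>, poly r \<beta>) |q r. coeffs_related R q r}"
  have in_R': "(poly q \<alpha>, poly r \<beta>) \<in> R'" if "coeffs_related R q r" for q r
    using that by (auto simp: R'_def)
  have sub: "R \<subseteq> R'"
  proof safe
    fix x y assume "(x, y) \<in> R"
    from in_R'[OF coeffs_related_monom[OF this, of 0]] show "(x, y) \<in> R'"
      by (simp add: poly_monom)
  qed
  moreover have "(\<alpha>, \<beta>) \<in> R'"
    using in_R'[OF coeffs_related_monom[OF related_one, of 1]] by (simp add: poly_monom)
  moreover have "partial_embedding \<sigma> \<rho> R'"
    unfolding partial_embedding_def
  proof (intro conjI allI impI)
    show "(\<sigma> a, \<rho> a) \<in> R'" for a using sub related_base by blast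
    fix x y x' y' assume "(x, y) \<in> R'" "(x', y') \<in> R'"
    then obtain q r q' r' where *: "coeffs_related R q r" "coeffs_related R q' r'"
      and eq: "x = poly q \<alpha>" "y = poly r \<beta>" "x' = poly q' \<alpha>" "y' = poly r' \<beta>"
      unfolding R'_def by blast
    show "(x + x', y + y') \<in> R'"
      using in_R'[OF coeffs_related_add[OF *]] by (simp add: eq)
    show "(x * x', y * y') \<in> R'"
      using in_R'[OF coeffs_related_mult[OF *]] by (simp add: eq)
  next
    fix y assume "(0, y) \<in> R'"
    then obtain q r where "coeffs_related R q r" "poly q \<alpha> = 0" "y = poly r \<beta>"
      unfolding R'_def by auto
    thus "y = 0" using key by blast
  qed
  ultimately show ?thesis by blast
qed

end

text \<open>Any two embeddings of \<open>l\<close> into an algebraic closure differ by an endomorphism of the closure.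
Zorn's lemma gives a maximal partial homomorphism, and the extension step shows that its
domain is everything.\<close>

lemma algebraic_closure_embedding_extends:
  fixes \<sigma> \<rho> :: "'l::field \<Rightarrow> 'c::alg_closed_field"
  assumes hom: "field_hom \<sigma>" "field_hom \<rho>"
    and alg: "\<And>x. \<exists>p. p \<noteq> 0 \<and> poly (map_poly \<sigma> p) x = 0"
  shows "\<exists>\<tau>. field_hom \<tau> \<and> \<tau> \<circ> \<sigma> = \<rho>"
proof -
  interpret \<sigma>: field_hom \<sigma> by (rule hom)
  interpret \<rho>: field_hom \<rho> by (rule hom)
  define A where "A = {R. partial_embedding \<sigma> \<rho> R}"
  let ?R0 = "range (\<lambda>a. (\<sigma> a, \<rho> a))"
  have R0: "?R0 \<in> A"
    unfolding A_def partial_embedding_def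
    by (auto simp flip: \<sigma>.hom_add \<rho>.hom_add \<sigma>.hom_mult \<rho>.hom_mult)
  have "\<exists>M\<in>A. \<forall>X\<in>A. M \<subseteq> X \<longrightarrow> X = M"
  proof (rule subset_Zorn_nonempty)
    show "A \<noteq> {}" using R0 by blast
    fix C assume C: "C \<noteq> {}" "subset.chain A C"
    have cA: "partial_embedding \<sigma> \<rho> R" if "R \<in> C" for R
      using C(2) that by (auto simp: subset.chain_def A_def)
    have common: "\<exists>R\<in>C. p \<in> R \<and> q \<in> R" if pq: "p \<in> \<Union>C" "q \<in> \<Union>C" for p q
    proof -
      obtain R1 R2 where "R1 \<in> C" "p \<in> R1" "R2 \<in> C" "q \<in> R2" using pq by blast
      moreover from this have "R1 \<subseteq> R2 \<or> R2 \<subseteq> R1"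
        using C(2) by (auto simp: subset.chain_def)
      ultimately show ?thesis by blast
    qed
    have "partial_embedding \<sigma> \<rho> (\<Union>C)"
      unfolding partial_embedding_def
    proof (intro conjI allI impI)
      show "(\<sigma> a, \<rho> a) \<in> \<Union>C" for a
        using C(1) cA related_base[OF hom] by blast
      fix x y x' y' assume *: "(x, y) \<in> \<Union>C" "(x', y') \<in> \<Union>C"
      obtain R where R: "R \<in> C" "(x, y) \<in> R" "(x', y') \<in> R"
        using common[OF *] by blast
      show "(x + x', y + y') \<in> \<Union>C" "(x * x', y * y') \<in> \<Union>C"
        using R related_add[OF hom cA[OF R(1)] R(2,3)] related_mult[OF hom cA[OF R(1)] R(2,3)]
        by blast+
    next
      show "y = 0" if "(0, y) \<in> \<Union>C" for y
        using that cA unfolding partial_embedding_def by blast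
    qed
    thus "\<Union>C \<in> A" by (simp add: A_def)
  qed
  then obtain M where M: "partial_embedding \<sigma> \<rho> M"
    and max: "\<And>X. partial_embedding \<sigma> \<rho> X \<Longrightarrow> M \<subseteq> X \<Longrightarrow> X = M"
    unfolding A_def by auto
  have "\<exists>\<beta>. (\<alpha>, \<beta>) \<in> M" for \<alpha>
    using partial_embedding_extend[OF hom M alg alg_closed_imp_poly_has_root, of \<alpha>] max by blast
  then obtain \<tau> where \<tau>: "\<And>x. (x, \<tau> x) \<in> M" by metis
  have eq: "\<tau> x = y" if "(x, y) \<in> M" for x y
    using related_unique[OF hom M \<tau> that] .
  have "field_hom \<tau>"
    by unfold_locales
      (auto intro!: eq related_zero[OF hom M] related_one[OF hom M] related_add[OF hom M] related_mult[OF hom M] \<tau>)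
  moreover have "\<tau> \<circ> \<sigma> = \<rho>" using related_base[OF hom M] eq by fastforce
  ultimately show ?thesis by blast
qed

text \<open>Multiplying a relation by \<open>\<sigma> y\<close> and subtracting it from the relation at \<open>y x\<close> removes the
embedding \<open>\<sigma>\<close>; the remaining coefficients are scaled by \<open>\<tau> y - \<sigma> y\<close>.\<close>

lemma dedekind_independence:
  fixes c :: "('l::field \<Rightarrow> 'c::field) \<Rightarrow> 'c"
  assumes "finite S" "\<And>\<sigma>. \<sigma> \<in> S \<Longrightarrow> field_hom \<sigma>" "\<And>x. (\<Sum>\<sigma>\<in>S. c \<sigma> * \<sigma> x) = 0"
  shows "\<forall>\<sigma>\<in>S. c \<sigma> = 0"
  using assms
proof (induction S arbitrary: c)
  case (insert \<sigma> S)
  interpret \<sigma>: field_hom \<sigma> using insert.prems by auto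
  have "c \<tau> = 0" if \<tau>: "\<tau> \<in> S" for \<tau>
  proof -
    obtain y where y: "\<tau> y \<noteq> \<sigma> y" using insert.hyps(2) \<tau> by (metis ext)
    have "(\<Sum>\<rho>\<in>S. (c \<rho> * (\<rho> y - \<sigma> y)) * \<rho> x) = 0" for x
    proof -
      have "(c \<rho> * (\<rho> y - \<sigma> y)) * \<rho> x = c \<rho> * \<rho> (y * x) - \<sigma> y * (c \<rho> * \<rho> x)"
        if "\<rho> \<in> S" for \<rho>
      proof -
        interpret \<rho>: field_hom \<rho> using insert.prems that by auto
        show ?thesis by (simp add: \<rho>.hom_mult algebra_simps)
      qed
      hence "(\<Sum>\<rho>\<in>S. (c \<rho> * (\<rho> y - \<sigma> y)) * \<rho> x) =
          (\<Sum>\<rho>\<in>S. c \<rho> * \<rho> (y * x)) - \<sigma> y * (\<Sum>\<rho>\<in>S. c \<rho> * \<rho> x)"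
        by (simp add: sum_distrib_left sum_subtractf)
      also have "(\<Sum>\<rho>\<in>S. c \<rho> * \<rho> (y * x)) = - (c \<sigma> * (\<sigma> y * \<sigma> x))"
        using insert.prems(2)[of "y * x"] insert.hyps by (simp add: \<sigma>.hom_mult add_eq_0_iff)
      also have "(\<Sum>\<rho>\<in>S. c \<rho> * \<rho> x) = - (c \<sigma> * \<sigma> x)"
        using insert.prems(2)[of x] insert.hyps by (simp add: add_eq_0_iff)
      finally show ?thesis by (simp add: mult_ac)
    qed
    hence "\<forall>\<rho>\<in>S. c \<rho> * (\<rho> y - \<sigma> y) = 0"
      by (intro insert.IH) (use insert.prems in auto)
    thus ?thesis using \<tau> y by auto
  qed
  moreover from this have "c \<sigma> = 0"
    using insert.prems(2)[of 1] insert.hyps by simp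
  ultimately show ?case by auto
qed simp

section \<open>Embeddings of a separable extension and the trace\<close>

definition linear_over :: "('k::field \<Rightarrow> 'l::field) \<Rightarrow> ('k \<Rightarrow> 'c::field) \<Rightarrow> ('l \<Rightarrow> 'c) \<Rightarrow> bool" where
  "linear_over incl h u \<longleftrightarrow>
     (\<forall>x y. u (x + y) = u x + u y) \<and> (\<forall>a x. u (incl a * x) = h a * u x)"

lemma linear_over_sum:
  assumes "linear_over incl h u"
  shows "u (\<Sum>i\<in>I. f i) = (\<Sum>i\<in>I. u (f i))"
proof -
  have add: "u (x + y) = u x + u y" for x y using assms by (simp add: linear_over_def)
  have "u 0 = 0" using add[of 0 0] by (metis add_0 add_cancel_right_left)
  thus ?thesis by (induction I rule: infinite_finite_induct) (auto simp: add)
qed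

text \<open>The action of a polynomial on functionals, where the variable acts by \<open>u \<mapsto> (\<lambda>x. u (a * x))\<close>.\<close>

definition poly_act :: "'c::field poly \<Rightarrow> 'l::field \<Rightarrow> ('l \<Rightarrow> 'c) \<Rightarrow> 'l \<Rightarrow> 'c" where
  "poly_act q a u x = (\<Sum>i\<le>degree q. coeff q i * u (a ^ i * x))"

lemma poly_act_bound: "degree q \<le> N \<Longrightarrow> poly_act q a u x = (\<Sum>i\<le>N. coeff q i * u (a ^ i * x))"
  unfolding poly_act_def by (rule sum.mono_neutral_left) (auto simp: coeff_eq_0)

lemma poly_act_smult: "poly_act (smult c q) a u x = c * poly_act q a u x"
  by (simp add: poly_act_bound[of _ "degree q"] sum_distrib_left mult.assoc)

lemma poly_act_linear_factor:
  "poly_act ([:-r, 1:] * q) a u x = poly_act q a (\<lambda>x. u (a * x) - r * u x) x"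
proof -
  have deg: "degree ([:-r, 1:] * q) \<le> Suc (degree q)"
    using degree_mult_le[of "[:-r, 1:]" q] by simp
  have "poly_act ([:-r, 1:] * q) a u x =
      (\<Sum>i\<le>Suc (degree q). coeff (pCons 0 q) i * u (a ^ i * x)) - r * (\<Sum>i\<le>Suc (degree q). coeff q i * u (a ^ i * x))"
    unfolding poly_act_bound[OF deg] sum_distrib_left sum_subtractf[symmetric]
    by (rule sum.cong) (simp_all add: left_diff_distrib mult.assoc)
  also have "(\<Sum>i\<le>Suc (degree q). coeff (pCons 0 q) i * u (a ^ i * x)) =
      (\<Sum>i\<le>degree q. coeff q i * u (a ^ i * (a * x)))"
    by (simp add: sum.atMost_Suc_shift mult_ac del: sum.atMost_Suc)
  also have "(\<Sum>i\<le>Suc (degree q). coeff q i * u (a ^ i * x)) =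
      (\<Sum>i\<le>degree q. coeff q i * u (a ^ i * x))" by (simp add: coeff_eq_0)
  finally show ?thesis
    by (simp add: poly_act_def sum_subtractf[symmetric] sum_distrib_left algebra_simps)
qed

text \<open>A polynomial over \<open>k\<close> acts on \<open>u\<close> by substituting its value at \<open>a\<close>, so an equation of \<open>a\<close> kills
every linear functional.\<close>

lemma poly_act_annihilates:
  assumes "field_hom incl" "field_hom h" "linear_over incl h u" "poly (map_poly incl p) a = 0"
  shows "poly_act (map_poly h p) a u x = 0"
proof -
  interpret i: field_hom incl by fact
  interpret h: field_hom h by fact
  have u: "u (incl b * y) = h b * u y" for b y using assms(3) by (simp add: linear_over_def)
  have "poly_act (map_poly h p) a u x = (\<Sum>i\<le>degree p. u (incl (coeff p i) * (a ^ i * x)))"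
    by (simp add: poly_act_def u)
  also have "\<dots> = u (poly (map_poly incl p) a * x)"
    by (simp add: linear_over_sum[OF assms(3), symmetric] poly_altdef sum_distrib_right mult.assoc)
  also have "\<dots> = 0" using u[of 0 0] by (simp add: assms(4))
  finally show ?thesis .
qed

text \<open>An operator killed by a product of distinct linear factors is diagonalisable. The eigenvectors
found lie in every space \<open>U\<close> that contains \<open>u\<close> and is stable under the operator, which permits
diagonalising commuting operators one after the other.\<close>

lemma eigenvector_decomposition:
  fixes a :: "'l::field" and U :: "('l \<Rightarrow> 'c::field) set"
  assumes add: "\<And>u v. u \<in> U \<Longrightarrow> v \<in> U \<Longrightarrow> (\<lambda>x. u x + v x) \<in> U"
    and scale: "\<And>u c. u \<in> U \<Longrightarrow> (\<lambda>x. c * u x) \<in> U"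
    and shift: "\<And>u. u \<in> U \<Longrightarrow> (\<lambda>x. u (a * x)) \<in> U"
    and "u \<in> U" "distinct rs" "\<And>x. poly_act (\<Prod>r\<leftarrow>rs. [:-r, 1:]) a u x = 0"
  shows "\<exists>w. (\<forall>r\<in>set rs. w r \<in> U \<and> (\<forall>x. w r (a * x) = r * w r x)) \<and>
    (\<forall>x. u x = (\<Sum>r\<in>set rs. w r x))"
  using assms(4-)
proof (induction rs arbitrary: u)
  case Nil
  thus ?case by (simp add: poly_act_def)
next
  case (Cons r rs)
  have zero: "(\<lambda>x. 0) \<in> U" using scale[OF Cons.prems(1), of 0] by simp
  have sub: "(\<lambda>x. u x - v x) \<in> U" if "u \<in> U" "v \<in> U" for u v
    using add[OF that(1) scale[OF that(2), of "-1"]] by simp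
  have sum: "(\<lambda>x. \<Sum>i\<in>I. f i x) \<in> U" if "\<And>i. i \<in> I \<Longrightarrow> f i \<in> U" for I :: "'c set" and f
    using that by (induction I rule: infinite_finite_induct) (auto simp: zero intro: add)
  define v where "v x = u (a * x) - r * u x" for x
  have "v \<in> U" unfolding v_def[abs_def] by (intro sub shift scale Cons.prems(1))
  moreover have "poly_act (\<Prod>r\<leftarrow>rs. [:-r, 1:]) a v x = 0" for x
    using Cons.prems(3)[of x] unfolding v_def[abs_def] by (simp only: list.map prod_list.Cons poly_act_linear_factor)
  ultimately obtain w where w: "\<And>t. t \<in> set rs \<Longrightarrow> w t \<in> U"
    "\<And>t x. t \<in> set rs \<Longrightarrow> w t (a * x) = t * w t x" "\<And>x. v x = (\<Sum>t\<in>set rs. w t x)"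
    using Cons.IH[of v] Cons.prems(2) by auto
  \<comment> \<open>The operator minus \<open>r\<close> acts on \<open>w t\<close> as multiplication by \<open>t - r\<close>, so the \<open>w' t\<close> add up to a preimage of
    \<open>v\<close>, and subtracting this preimage from \<open>u\<close> leaves a vector killed by the operator minus \<open>r\<close>.\<close>
  define w' where "w' t = (\<lambda>x. inverse (t - r) * w t x)" for t
  define w0 where "w0 x = u x - (\<Sum>t\<in>set rs. w' t x)" for x
  have w'U: "w' t \<in> U" if "t \<in> set rs" for t
    unfolding w'_def using w(1)[OF that] by (rule scale)
  have w'_eigen: "w' t (a * x) = t * w' t x" if "t \<in> set rs" for t x
    using w(2)[OF that] by (simp add: w'_def)
  have w_w': "w t x = t * w' t x - r * w' t x" if "t \<in> set rs" for t x
  proof -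
    have "t \<noteq> r" using that Cons.prems(2) by auto
    hence "(t - r) * w' t x = w t x" by (simp add: w'_def)
    thus ?thesis by (simp add: left_diff_distrib)
  qed
  have "w0 \<in> U" unfolding w0_def[abs_def] by (intro sub sum Cons.prems(1) w'U)
  have "w0 (a * x) = r * w0 x" for x
  proof -
    have "u (a * x) = r * u x + (\<Sum>t\<in>set rs. t * w' t x - r * w' t x)"
      using w(3)[of x] by (simp add: v_def w_w' algebra_simps)
    thus ?thesis
      by (simp add: w0_def w'_eigen sum_subtractf sum_distrib_left algebra_simps)
  qed
  note w0 = \<open>w0 \<in> U\<close> this
  define W where "W t = (if t = r then w0 else w' t)" for t
  have W: "W r = w0" "\<And>t. t \<in> set rs \<Longrightarrow> W t = w' t"
    using Cons.prems(2) by (auto simp: W_def)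
  have "u x = (\<Sum>t\<in>set (r # rs). W t x)" for x
  proof -
    have "(\<Sum>t\<in>set rs. W t x) = (\<Sum>t\<in>set rs. w' t x)" by (rule sum.cong) (simp_all add: W)
    thus ?thesis using Cons.prems(2) by (simp add: W(1) w0_def)
  qed
  moreover have "\<forall>t\<in>set (r # rs). W t \<in> U \<and> (\<forall>x. W t (a * x) = t * W t x)"
    using w0 w'U w'_eigen by (simp add: W)
  ultimately show ?case by blast
qed

text \<open>A double root would be a common root of \<open>p\<close> and its derivative; a polynomial of least degree over
the base field that has this root divides both of them, although they are coprime.\<close>

lemma separable_poly_splits:
  fixes p :: "'k::field poly" and h :: "'k \<Rightarrow> 'c::alg_closed_field"
  assumes h: "field_hom h" and p: "p \<noteq> 0" "coprime p (pderiv p)"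
  obtains c rs where "c \<noteq> 0" "distinct rs" "map_poly h p = smult c (\<Prod>r\<leftarrow>rs. [:-r, 1:])"
proof -
  interpret h: field_hom h by fact
  interpret mp: map_poly_comm_ring_hom h ..
  obtain A where A: "map_poly h p = smult (lead_coeff (map_poly h p)) (\<Prod>x\<in>#A. [:-x, 1:])"
    using alg_closed_imp_factorization[of "map_poly h p"] p by auto
  obtain rs where rs: "mset rs = A" using ex_mset by blast
  have fact: "map_poly h p = smult (h (lead_coeff p)) (\<Prod>r\<leftarrow>rs. [:-r, 1:])"
    using A by (simp add: rs[symmetric] prod_mset_prod_list[symmetric] mset_map)
  have "distinct rs"
  proof (rule ccontr)
    assume "\<not> distinct rs"
    then obtain xs ys zs r where "rs = xs @ [r] @ ys @ [r] @ zs"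
      using not_distinct_decomp by blast
    hence "\<exists>q. map_poly h p = [:-r, 1:] * ([:-r, 1:] * q)"
      unfolding fact
      by (intro exI[of _ "smult (h (lead_coeff p)) (\<Prod>r\<leftarrow>xs @ ys @ zs. [:-r, 1:])"])
        (simp only: map_append prod_list.append list.map prod_list.Cons prod_list.Nil
          mult_smult_right mult_1_right mult_1_left mult_ac)
    then obtain q where q: "map_poly h p = [:-r, 1:] * ([:-r, 1:] * q)" by blast
    have "poly (map_poly h p) r = 0" "poly (map_poly h (pderiv p)) r = 0"
      unfolding h.map_poly_pderiv q pderiv_mult poly_add poly_mult by simp_all
    moreover have "\<exists>m. (m \<noteq> 0 \<and> poly (map_poly h m) r = 0) \<and>
       (\<forall>q. q \<noteq> 0 \<and> poly (map_poly h q) r = 0 \<longrightarrow> degree m \<le> degree q)"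
      by (rule ex_has_least_nat[of _ p]) (use p calculation in auto)
    then obtain m where m: "m \<noteq> 0" "poly (map_poly h m) r = 0"
      "\<And>q. q \<noteq> 0 \<Longrightarrow> poly (map_poly h q) r = 0 \<Longrightarrow> degree m \<le> degree q" by blast
    have "m dvd q" if "poly (map_poly h q) r = 0" for q
    proof -
      have "q mod m = q - q div m * m" by (simp add: minus_div_mult_eq_mod)
      hence "poly (map_poly h (q mod m)) r = 0"
        using that m(2) by (simp add: mp.hom_minus mp.hom_mult)
      hence "q mod m = 0" using m(3)[of "q mod m"] degree_mod_less[OF m(1), of q] by fastforce
      thus ?thesis by auto
    qed
    ultimately have "is_unit m" using p(2) by (metis coprime_common_divisor)
    then obtain c where "m = [:c:]" using m(1) by (auto elim: degree_eq_zeroE)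
    thus False using m(1,2) by (simp add: h.map_poly_pCons_hom)
  qed
  thus thesis using that[of "h (lead_coeff p)" rs] fact p by auto
qed

locale separable_extension =
  fixes incl :: "'k::field \<Rightarrow> 'l::field" and h :: "'k \<Rightarrow> 'c::alg_closed_field"
  assumes fse: "finite_separable_extension incl" and h: "field_hom h"
begin

sublocale incl: field_hom incl using fse by (simp add: finite_separable_extension_def)
sublocale h: field_hom h by (rule h)

sublocale L: vector_space "restrict_scalars incl (*)"
  by unfold_locales (simp_all add: restrict_scalars_def algebra_simps incl.hom_add incl.hom_mult)

definition embeddings :: "('l \<Rightarrow> 'c) set" where
  "embeddings = {\<sigma>. field_hom \<sigma> \<and> \<sigma> \<circ> incl = h}"

lemma embeddingD:
  assumes "\<sigma> \<in> embeddings"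
  shows "field_hom \<sigma>" "\<sigma> (incl a) = h a"
  using assms by (auto simp: embeddings_def)

lemma separable_poly:
  "\<exists>p. p \<noteq> 0 \<and> poly (map_poly incl p) x = 0 \<and> coprime p (pderiv p)"
  using fse unfolding finite_separable_extension_def by (metis not_irreducible_zero)

lemma finite_spanning:
  obtains B where "finite B" "L.span B = UNIV"
  using fse unfolding finite_separable_extension_def by blast

text \<open>An embedding is determined by its values on a finite spanning set, and each value is a root of
a fixed polynomial.\<close>

lemma finite_embeddings: "finite embeddings"
proof -
  obtain B where B: "finite B" "L.span B = UNIV" by (rule finite_spanning)
  obtain p where p: "\<And>x. p x \<noteq> 0 \<and> poly (map_poly incl (p x)) x = 0 \<and> coprime (p x) (pderiv (p x))"
    using choice[of "\<lambda>x p. p \<noteq> 0 \<and> poly (map_poly incl p) x = 0 \<and> coprime p (pderiv p)"]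
      separable_poly by blast
  let ?R = "\<lambda>x. {y. poly (map_poly h (p x)) y = 0}"
  have "(\<lambda>\<sigma>. restrict \<sigma> B) ` embeddings \<subseteq> PiE B ?R"
  proof safe
    fix \<sigma> x assume \<sigma>: "\<sigma> \<in> embeddings" "x \<in> B"
    interpret \<sigma>: field_hom \<sigma> using \<sigma>(1) by (rule embeddingD)
    have "map_poly h (p x) = map_poly \<sigma> (map_poly incl (p x))"
      by (rule poly_eqI) (simp add: embeddingD(2)[OF \<sigma>(1)])
    thus "poly (map_poly h (p x)) (restrict \<sigma> B x) = 0"
      using p[of x] \<sigma>(2) by simp
  qed auto
  moreover have "finite (PiE B ?R)"
    using B(1) p by (intro finite_PiE poly_roots_finite) auto
  moreover have "inj_on (\<lambda>\<sigma>. restrict \<sigma> B) embeddings"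
  proof (rule inj_onI)
    fix \<sigma> \<tau> assume st: "\<sigma> \<in> embeddings" "\<tau> \<in> embeddings" "restrict \<sigma> B = restrict \<tau> B"
    interpret \<sigma>: field_hom \<sigma> using st(1) by (rule embeddingD)
    interpret \<tau>: field_hom \<tau> using st(2) by (rule embeddingD)
    have "\<sigma> x = \<tau> x" if "x \<in> L.span B" for x
      using that
    proof (induction rule: L.span_induct_alt)
      case (step c x y)
      have "\<sigma> x = \<tau> x" using st(3) step(1) by (metis restrict_apply')
      thus ?case using step
        by (simp add: restrict_scalars_def \<sigma>.hom_add \<tau>.hom_add \<sigma>.hom_mult \<tau>.hom_mult
            embeddingD(2)[OF st(1)] embeddingD(2)[OF st(2)])
    qed simp
    thus "\<sigma> = \<tau>" using B(2) by auto
  qed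
  ultimately show ?thesis using finite_subset finite_imageD by metis
qed

definition in_embedding_span :: "('l \<Rightarrow> 'c) \<Rightarrow> bool" where
  "in_embedding_span u \<longleftrightarrow> (\<exists>c. \<forall>x. u x = (\<Sum>\<sigma>\<in>embeddings. c \<sigma> * \<sigma> x))"

lemma in_embedding_span_sum:
  assumes "\<And>i. i \<in> I \<Longrightarrow> in_embedding_span (f i)"
  shows "in_embedding_span (\<lambda>x. \<Sum>i\<in>I. f i x)"
proof -
  obtain c where "\<And>i x. i \<in> I \<Longrightarrow> f i x = (\<Sum>\<sigma>\<in>embeddings. c i \<sigma> * \<sigma> x)"
    using assms unfolding in_embedding_span_def by metis
  hence "(\<Sum>i\<in>I. f i x) = (\<Sum>\<sigma>\<in>embeddings. (\<Sum>i\<in>I. c i \<sigma>) * \<sigma> x)" for x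
    by (simp add: sum_distrib_right sum.swap[of _ I])
  thus ?thesis unfolding in_embedding_span_def by (intro exI allI)
qed

text \<open>A common eigenvector \<open>u\<close> of all multiplications satisfies \<open>u (a * x) = r a * u x\<close>. With \<open>x = 1\<close>
this shows that \<open>u\<close> divided by \<open>u 1\<close> is multiplicative, that is, an embedding.\<close>

lemma common_eigenvector_in_embedding_span:
  assumes u: "linear_over incl h u" and B: "L.span B = UNIV"
    and eigen: "\<And>b. b \<in> B \<Longrightarrow> \<exists>r. \<forall>x. u (b * x) = r * u x"
  shows "in_embedding_span u"
proof (cases "\<forall>x. u x = 0")
  case True
  thus ?thesis unfolding in_embedding_span_def by (intro exI[of _ "\<lambda>_. 0"]) simp
next
  case False
  have add: "u (x + y) = u x + u y" and scale: "u (incl a * x) = h a * u x" for x y a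
    using u by (auto simp: linear_over_def)
  have "\<exists>r. \<forall>x. u (a * x) = r * u x" if "a \<in> L.span B" for a
    using that
  proof (induction rule: L.span_induct_alt)
    case base
    show ?case using scale[of 0] by (intro exI[of _ 0]) simp
  next
    case (step c b y)
    obtain r1 r2 where r: "\<And>x. u (b * x) = r1 * u x" "\<And>x. u (y * x) = r2 * u x"
      using eigen[OF step(1)] step.IH by blast
    show ?case
      by (rule exI[of _ "h c * r1 + r2"])
        (simp add: restrict_scalars_def distrib_right add mult.assoc scale r)
  qed
  then obtain r where r: "\<And>a x. u (a * x) = r a * u x" using B by (metis UNIV_I)
  obtain x0 where "u x0 \<noteq> 0" using False by blast
  hence u1: "u 1 \<noteq> 0" using r[of x0 1] by auto
  define \<sigma> where "\<sigma> x = u x / u 1" for x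
  have mult: "\<sigma> (x * y) = \<sigma> x * \<sigma> y" for x y
    using r[of x y] r[of x 1] u1 by (simp add: \<sigma>_def)
  have "u 0 = 0" using scale[of 0 0] by simp
  hence "field_hom \<sigma>"
    using mult u1 by unfold_locales (simp_all add: \<sigma>_def add add_divide_distrib)
  moreover have "\<sigma> (incl a) = h a" for a using scale[of a 1] u1 by (simp add: \<sigma>_def)
  ultimately have "\<sigma> \<in> embeddings" by (auto simp: embeddings_def)
  have "u x = (\<Sum>\<tau>\<in>embeddings. (if \<tau> = \<sigma> then u 1 else 0) * \<tau> x)" for x
  proof -
    have "(\<Sum>\<tau>\<in>embeddings. (if \<tau> = \<sigma> then u 1 else 0) * \<tau> x) =
        (\<Sum>\<tau>\<in>embeddings. if \<tau> = \<sigma> then u 1 * \<sigma> x else 0)"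
      by (rule sum.cong) auto
    thus ?thesis using \<open>\<sigma> \<in> embeddings\<close> finite_embeddings u1 by (simp add: \<sigma>_def)
  qed
  thus ?thesis unfolding in_embedding_span_def by (intro exI allI)
qed

text \<open>This is the form in which separability is used; it says that \<open>l \<otimes> c\<close> is a product of copies of
\<open>c\<close> indexed by the embeddings. The multiplications by a finite spanning set act on functionals
as commuting operators, each diagonalisable because separable polynomials split into distinct
factors. So every functional is a sum of common eigenvectors, and these are multiples of
embeddings. The induction runs over the set \<open>A\<close> of multiplications that are not yet diagonal
on \<open>u\<close>.\<close>

lemma linear_functional_in_embedding_span:
  assumes "linear_over incl h u"
  shows "in_embedding_span u"
proof -
  obtain B where B: "finite B" "L.span B = UNIV" by (rule finite_spanning)
  have "in_embedding_span u" if "A \<subseteq> B" "linear_over incl h u"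
    "\<And>b. b \<in> B - A \<Longrightarrow> \<exists>r. \<forall>x. u (b * x) = r * u x" for A u
    using finite_subset[OF that(1) B(1)] that
  proof (induction A arbitrary: u)
    case empty
    thus ?case using common_eigenvector_in_embedding_span B(2) by simp
  next
    case (insert a A)
    define eigen where "eigen = (\<lambda>(v :: 'l \<Rightarrow> 'c) b r. \<forall>x. v (b * x) = r * v x)"
    obtain r0 where r0: "\<And>b. b \<in> B - insert a A \<Longrightarrow> eigen u b (r0 b)"
      using insert.prems(3) unfolding eigen_def by metis
    define U where "U = {v. linear_over incl h v \<and> (\<forall>b\<in>B - insert a A. eigen v b (r0 b))}"
    obtain p where p: "p \<noteq> 0" "poly (map_poly incl p) a = 0" "coprime p (pderiv p)"
      using separable_poly by blast
    obtain c rs where rs: "c \<noteq> 0" "distinct rs" "map_poly h p = smult c (\<Prod>r\<leftarrow>rs. [:-r, 1:])"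
      using separable_poly_splits[OF h p(1,3)] .
    have kill: "poly_act (\<Prod>r\<leftarrow>rs. [:-r, 1:]) a u x = 0" for x
      using poly_act_annihilates[OF incl.field_hom_axioms h insert.prems(2) p(2), of x] rs
      by (simp add: poly_act_smult)
    have "\<exists>w. (\<forall>r\<in>set rs. w r \<in> U \<and> (\<forall>x. w r (a * x) = r * w r x)) \<and>
        (\<forall>x. u x = (\<Sum>r\<in>set rs. w r x))"
    proof (rule eigenvector_decomposition[where U = U])
      show "(\<lambda>x. u x + v x) \<in> U" if "u \<in> U" "v \<in> U" for u v
        using that by (auto simp: U_def linear_over_def eigen_def algebra_simps)
      show "(\<lambda>x. c * u x) \<in> U" if "u \<in> U" for u c
        using that by (auto simp: U_def linear_over_def eigen_def algebra_simps)
      show "(\<lambda>x. u (a * x)) \<in> U" if "u \<in> U" for u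
        using that by (auto simp: U_def linear_over_def eigen_def distrib_left mult.left_commute[of a])
      show "u \<in> U" using insert.prems(2) r0 by (auto simp: U_def)
    qed (use rs kill in auto)
    then obtain w where w: "\<And>r. r \<in> set rs \<Longrightarrow> w r \<in> U" "\<And>r x. r \<in> set rs \<Longrightarrow> w r (a * x) = r * w r x"
      "\<And>x. u x = (\<Sum>r\<in>set rs. w r x)" by metis
    have "in_embedding_span (w r)" if "r \<in> set rs" for r
    proof (rule insert.IH)
      show "linear_over incl h (w r)" using w(1)[OF that] by (simp add: U_def)
      show "\<exists>t. \<forall>x. w r (b * x) = t * w r x" if "b \<in> B - A" for b
        using w(1,2)[OF \<open>r \<in> set rs\<close>] that by (cases "b = a") (auto simp: U_def eigen_def)
    qed (use insert.prems in auto)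
    hence "in_embedding_span (\<lambda>x. \<Sum>r\<in>set rs. w r x)" by (rule in_embedding_span_sum)
    moreover have "u = (\<lambda>x. \<Sum>r\<in>set rs. w r x)" using w(3) by auto
    ultimately show ?case by simp
  qed
  from this[of B u] show ?thesis using assms by simp
qed

text \<open>The coordinate functionals \<open>\<beta> b\<close> of a basis are combinations of embeddings, with coefficients
\<open>C b \<sigma>\<close>. Inserting this into the expansion of \<open>\<tau> x\<close> in the basis and comparing coefficients by
independence shows that the matrices \<open>C\<close> and \<open>\<tau> b\<close> are inverse to each other. The trace formula
follows from the diagonal entries of this relation.\<close>

lemma dual_basis_and_trace:
  obtains B :: "'l set" and \<beta> :: "'l \<Rightarrow> 'l \<Rightarrow> 'k" and C :: "'l \<Rightarrow> ('l \<Rightarrow> 'c) \<Rightarrow> 'c"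
  where "finite B"
    "\<And>x. (\<Sum>b\<in>B. incl (\<beta> b x) * b) = x"
    "\<And>b x. b \<in> B \<Longrightarrow> h (\<beta> b x) = (\<Sum>\<sigma>\<in>embeddings. C b \<sigma> * \<sigma> x)"
    "\<And>\<sigma> \<tau>. \<sigma> \<in> embeddings \<Longrightarrow> \<tau> \<in> embeddings \<Longrightarrow>
       (\<Sum>b\<in>B. C b \<sigma> * \<tau> b) = (if \<sigma> = \<tau> then 1 else 0)"
    "\<And>a. h (field_trace incl a) = (\<Sum>\<sigma>\<in>embeddings. \<sigma> a)"
proof -
  let ?s = "restrict_scalars incl (*)"
  define B where "B = (SOME B. \<not> L.dependent B \<and> L.span B = UNIV)"
  obtain B0 where B0: "finite B0" "L.span B0 = UNIV" by (rule finite_spanning)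
  have "\<exists>B. \<not> L.dependent B \<and> L.span B = UNIV"
    using L.maximal_independent_subset[of UNIV] by (metis top.extremum_uniqueI)
  hence B: "L.independent B" "L.span B = UNIV" unfolding B_def by (metis (mono_tags, lifting) someI_ex)+
  have fin: "finite B" using L.independent_span_bound[OF B0(1) B(1)] B0(2) by auto
  define \<beta> where "\<beta> b x = L.representation B x b" for b x
  have expand: "(\<Sum>b\<in>B. incl (\<beta> b x) * b) = x" for x
    using L.sum_representation_eq[OF B(1) _ fin order.refl, of x] B(2)
    by (simp add: \<beta>_def restrict_scalars_def)
  have "linear_over incl h (\<lambda>x. h (\<beta> b x))" for b
    using L.representation_add[OF B(1)] L.representation_scale[OF B(1)] B(2)
    by (simp add: linear_over_def \<beta>_def restrict_scalars_def h.hom_add h.hom_mult)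
  hence "\<exists>c. \<forall>x. h (\<beta> b x) = (\<Sum>\<sigma>\<in>embeddings. c \<sigma> * \<sigma> x)" for b
    using linear_functional_in_embedding_span unfolding in_embedding_span_def by blast
  then obtain C where C: "\<And>b x. h (\<beta> b x) = (\<Sum>\<sigma>\<in>embeddings. C b \<sigma> * \<sigma> x)" by metis
  have dual: "(\<Sum>b\<in>B. C b \<sigma> * \<tau> b) = (if \<sigma> = \<tau> then 1 else 0)"
    if \<sigma>: "\<sigma> \<in> embeddings" and \<tau>: "\<tau> \<in> embeddings" for \<sigma> \<tau>
  proof -
    interpret \<tau>: field_hom \<tau> using \<tau> by (rule embeddingD)
    have "(\<Sum>\<rho>\<in>embeddings. ((\<Sum>b\<in>B. C b \<rho> * \<tau> b) - (if \<rho> = \<tau> then 1 else 0)) * \<rho> x) = 0" for x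
    proof -
      have "\<tau> x = (\<Sum>b\<in>B. h (\<beta> b x) * \<tau> b)"
        by (subst expand[symmetric]) (simp add: \<tau>.hom_sum \<tau>.hom_mult embeddingD(2)[OF \<tau>])
      also have "\<dots> = (\<Sum>b\<in>B. \<Sum>\<rho>\<in>embeddings. C b \<rho> * \<rho> x * \<tau> b)"
        by (simp add: C sum_distrib_right)
      also have "\<dots> = (\<Sum>\<rho>\<in>embeddings. \<Sum>b\<in>B. C b \<rho> * \<rho> x * \<tau> b)"
        by (rule sum.swap)
      also have "\<dots> = (\<Sum>\<rho>\<in>embeddings. (\<Sum>b\<in>B. C b \<rho> * \<tau> b) * \<rho> x)"
        by (simp add: sum_distrib_left mult_ac)
      finally have "(\<Sum>\<rho>\<in>embeddings. (\<Sum>b\<in>B. C b \<rho> * \<tau> b) * \<rho> x) = \<tau> x" ..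
      moreover have "(\<Sum>\<rho>\<in>embeddings. (if \<rho> = \<tau> then 1 else 0) * \<rho> x) =
          (\<Sum>\<rho>\<in>embeddings. if \<rho> = \<tau> then \<tau> x else 0)"
        by (rule sum.cong) auto
      ultimately show ?thesis
        using \<tau> finite_embeddings by (simp add: left_diff_distrib sum_subtractf)
    qed
    from dedekind_independence[OF finite_embeddings _ this] \<sigma> show ?thesis
      using embeddingD(1) by auto
  qed
  have "h (field_trace incl a) = (\<Sum>\<sigma>\<in>embeddings. \<sigma> a)" for a
  proof -
    have hom: "\<sigma> (a * b) = \<sigma> a * \<sigma> b" if "\<sigma> \<in> embeddings" for \<sigma> b
    proof -
      interpret \<sigma>: field_hom \<sigma> using that by (rule embeddingD)
      show ?thesis by (rule \<sigma>.hom_mult)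
    qed
    have "field_trace incl a = (\<Sum>b\<in>B. \<beta> b (a * b))"
      by (simp add: field_trace_def endomorphism_trace_def B_def \<beta>_def Let_def)
    hence "h (field_trace incl a) = (\<Sum>b\<in>B. \<Sum>\<sigma>\<in>embeddings. C b \<sigma> * (\<sigma> a * \<sigma> b))"
      by (simp add: h.hom_sum C hom cong: sum.cong)
    also have "\<dots> = (\<Sum>\<sigma>\<in>embeddings. \<sigma> a * (\<Sum>b\<in>B. C b \<sigma> * \<sigma> b))"
      by (subst sum.swap) (simp add: sum_distrib_left mult_ac)
    also have "\<dots> = (\<Sum>\<sigma>\<in>embeddings. \<sigma> a)"
      by (rule sum.cong) (simp_all add: dual)
    finally show ?thesis .
  qed
  with that[OF fin expand C dual] show thesis by blast
qed

end

section \<open>Indecomposability and nondegeneracy under extension of scalars\<close>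

text \<open>Functoriality of the fraction field for injective homomorphisms.\<close>

lemma field_hom_to_fract_extension:
  fixes H :: "'a::idom \<Rightarrow> 'b::idom"
  assumes "comm_ring_hom H" and inj: "\<And>x. H x = 0 \<Longrightarrow> x = 0"
  shows "\<exists>\<iota>. field_hom \<iota> \<and> (\<forall>p q. q \<noteq> 0 \<longrightarrow> \<iota> (Fract p q) = Fract (H p) (H q))"
proof -
  interpret H: comm_ring_hom H by fact
  have nz: "H q \<noteq> 0" if "q \<noteq> 0" for q using inj that by blast
  define rep where "rep x = (SOME r. snd r \<noteq> 0 \<and> x = Fract (fst r) (snd r))" for x :: "'a fract"
  have rep: "snd (rep x) \<noteq> 0 \<and> x = Fract (fst (rep x)) (snd (rep x))" for x
    unfolding rep_def by (rule someI_ex) (metis Fract_cases fst_conv snd_conv)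
  define \<iota> where "\<iota> x = Fract (H (fst (rep x))) (H (snd (rep x)))" for x
  have \<iota>: "\<iota> (Fract p q) = Fract (H p) (H q)" if q: "q \<noteq> 0" for p q
  proof -
    define p' q' where "p' = fst (rep (Fract p q))" and "q' = snd (rep (Fract p q))"
    have q': "q' \<noteq> 0" and "Fract p q = Fract p' q'"
      using rep[of "Fract p q"] by (auto simp: p'_def q'_def)
    hence "p * q' = p' * q" using q by (simp add: eq_fract)
    hence "H p * H q' = H p' * H q" by (metis H.hom_mult)
    hence "Fract (H p') (H q') = Fract (H p) (H q)" using nz[OF q] nz[OF q'] by (simp add: eq_fract)
    thus ?thesis by (simp add: \<iota>_def p'_def q'_def)
  qed
  have "field_hom \<iota>"
  proof unfold_locales
    show "\<iota> 0 = 0" "\<iota> 1 = 1"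
      using \<iota>[of 1 0] \<iota>[of 1 1] by (simp_all add: Zero_fract_def One_fract_def)
    fix x y :: "'a fract"
    obtain a b where x: "x = Fract a b" "b \<noteq> 0" by (cases x)
    obtain c d where y: "y = Fract c d" "d \<noteq> 0" by (cases y)
    show "\<iota> (x + y) = \<iota> x + \<iota> y" "\<iota> (x * y) = \<iota> x * \<iota> y"
      using x y nz by (simp_all add: \<iota> H.hom_add H.hom_mult)
  qed
  thus ?thesis using \<iota> by blast
qed

lemma common_denominator:
  assumes "finite A"
  shows "\<exists>q. q \<noteq> 0 \<and> (\<forall>x\<in>A. \<exists>p. x = to_fract p / to_fract q)"
  using assms
proof induction
  case (insert x A)
  then obtain q where q: "q \<noteq> 0" "\<And>y. y \<in> A \<Longrightarrow> \<exists>p. y = to_fract p / to_fract q" by blast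
  obtain a b where x: "x = Fract a b" "b \<noteq> 0" by (cases x)
  have "x = to_fract (a * q) / to_fract (b * q)"
    using x q(1) by (simp add: to_fract_def eq_fract)
  moreover have "\<exists>p. y = to_fract p / to_fract (b * q)" if y: "y \<in> A" for y
  proof -
    obtain p where "y = to_fract p / to_fract q" using q(2)[OF y] by blast
    hence "y = to_fract (b * p) / to_fract (b * q)"
      using x q(1) by (simp add: to_fract_def eq_fract)
    thus ?thesis by blast
  qed
  ultimately have "\<forall>y\<in>insert x A. \<exists>p. y = to_fract p / to_fract (b * q)" by blast
  moreover have "b * q \<noteq> 0" using x q(1) by simp
  ultimately show ?case by blast
qed (auto intro: exI[of _ 1])

lemma const_ratfun_eq_to_fract: "const_ratfun c = to_fract (Poly_Mapping.single 0 c)"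
  by (simp add: const_ratfun_def to_fract_def)

lemma field_hom_const_ratfun: "field_hom (const_ratfun :: 'a::field \<Rightarrow> ('a, 'i::linorder) ratfun)"
proof unfold_locales
  show "const_ratfun 0 = (0 :: ('a, 'i) ratfun)" "const_ratfun 1 = (1 :: ('a, 'i) ratfun)"
    by (simp_all add: const_ratfun_def Zero_fract_def One_fract_def)
  show "const_ratfun (a + b) = (const_ratfun a + const_ratfun b :: ('a, 'i) ratfun)" for a b
    by (simp add: const_ratfun_def single_add)
  show "const_ratfun (a * b) = (const_ratfun a * const_ratfun b :: ('a, 'i) ratfun)" for a b
    by (simp add: const_ratfun_def mult_single)
qed

abbreviation tensor_form :: "('i::finite list \<Rightarrow> 'f::field) \<Rightarrow> ('f^'i) list \<Rightarrow> 'f" where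
  "tensor_form T xs \<equiv> tensor_eval UNIV T (map vec_nth xs)"

definition symmetric_tensor :: "nat \<Rightarrow> ('i list \<Rightarrow> 'f) \<Rightarrow> bool" where
  "symmetric_tensor d T \<longleftrightarrow> (\<forall>is js. length is = d \<longrightarrow> mset is = mset js \<longrightarrow> T is = T js)"

text \<open>The radical of the form with coefficients \<open>T\<close> is zero, expressed as a linear system in the
entries of \<open>T\<close>.\<close>

definition nondegenerate_tensor :: "nat \<Rightarrow> ('i::finite list \<Rightarrow> 'f::field) \<Rightarrow> bool" where
  "nondegenerate_tensor d T \<longleftrightarrow>
     (\<forall>x. (\<forall>js. length js + 1 = d \<longrightarrow> (\<Sum>r\<in>UNIV. x r * T (r # js)) = 0) \<longrightarrow> (\<forall>r. x r = 0))"

text \<open>Self-adjointness as a system of linear equations with the entries of \<open>T\<close> as coefficients. In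
this form it is preserved by homomorphisms and by specialisation.\<close>

definition self_adjoint_matrix :: "nat \<Rightarrow> ('i::finite list \<Rightarrow> 'f::field) \<Rightarrow> 'f^'i^'i \<Rightarrow> bool" where
  "self_adjoint_matrix d T E \<longleftrightarrow> (\<forall>i j js. length js + 2 = d \<longrightarrow>
     (\<Sum>r\<in>UNIV. E $ r $ i * T (r # j # js)) = (\<Sum>r\<in>UNIV. E $ r $ j * T (i # r # js)))"

text \<open>The centre has no idempotents besides \<open>0\<close> and \<open>1\<close>, which for nondegenerate forms means that
there is no orthogonal decomposition.\<close>

definition primitive_tensor :: "nat \<Rightarrow> ('i::finite list \<Rightarrow> 'f::field) \<Rightarrow> bool" where
  "primitive_tensor d T \<longleftrightarrow>
     (\<forall>E. E ** E = E \<longrightarrow> self_adjoint_matrix d T E \<longrightarrow> E = 0 \<or> E = mat 1)"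

lemma vec_nth_axis: "vec_nth (axis j (1::'f::field)) = (\<lambda>i. of_bool (i = j))"
  by (auto simp: axis_def)

lemma tensor_form_axes: "tensor_form T (map (\<lambda>j. axis j 1) js) = T js"
  using tensor_eval_axes[of UNIV js T] by (simp add: comp_def vec_nth_axis)

lemma matrix_mult_axis: "vec_nth (E *v axis i (1::'f::field)) = (\<lambda>r. E $ r $ i)"
  by (auto simp: matrix_vector_mult_def axis_def if_distrib[of "\<lambda>x. _ * x"] cong: if_cong)

lemma self_adjoint_matrix_iff:
  fixes T :: "'i::finite list \<Rightarrow> 'f::field"
  shows "self_adjoint d (tensor_form T) ((*v) E) \<longleftrightarrow> self_adjoint_matrix d T E"
proof
  assume *: "self_adjoint d (tensor_form T) ((*v) E)"
  show "self_adjoint_matrix d T E"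
    unfolding self_adjoint_matrix_def
  proof (intro allI impI)
    fix i j and js :: "'i list" assume len: "length js + 2 = d"
    have ax: "tensor_eval UNIV S (map (vec_nth \<circ> (\<lambda>j. axis j 1)) js) = S js" for S :: "'i list \<Rightarrow> 'f"
      using tensor_form_axes[of S js] by simp
    have del: "(\<Sum>i\<in>UNIV. of_bool (i = k) * f i) = f k" for k :: 'i and f :: "'i \<Rightarrow> 'f"
      by (simp add: of_bool_def if_distrib[of "\<lambda>x. x * _"] cong: if_cong)
    have "tensor_form T (E *v axis i 1 # axis j 1 # map (\<lambda>j. axis j 1) js) =
        tensor_form T (axis i 1 # E *v axis j 1 # map (\<lambda>j. axis j 1) js)"
      by (rule *[unfolded self_adjoint_def, rule_format]) (use len in simp)
    thus "(\<Sum>r\<in>UNIV. E $ r $ i * T (r # j # js)) = (\<Sum>r\<in>UNIV. E $ r $ j * T (i # r # js))"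
      by (simp add: matrix_mult_axis vec_nth_axis del ax)
  qed
next
  assume *: "self_adjoint_matrix d T E"
  show "self_adjoint d (tensor_form T) ((*v) E)"
    unfolding self_adjoint_def
  proof (intro allI impI)
    fix x y and zs :: "('f^'i) list" assume len: "length zs + 2 = d"
    let ?t = "\<lambda>S. tensor_eval UNIV S (map vec_nth zs)"
    have "tensor_form T (E *v x # y # zs) =
        (\<Sum>r\<in>UNIV. \<Sum>j\<in>UNIV. \<Sum>i\<in>UNIV. x $ i * (y $ j * (E $ r $ i * ?t (\<lambda>js. T (r # j # js)))))"
      by (simp add: matrix_vector_mult_def sum_distrib_left sum_distrib_right mult_ac)
    also have "\<dots> = (\<Sum>r\<in>UNIV. \<Sum>i\<in>UNIV. \<Sum>j\<in>UNIV. x $ i * (y $ j * (E $ r $ i * ?t (\<lambda>js. T (r # j # js)))))"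
      by (rule sum.cong[OF refl], rule sum.swap)
    also have "\<dots> = (\<Sum>i\<in>UNIV. \<Sum>r\<in>UNIV. \<Sum>j\<in>UNIV. x $ i * (y $ j * (E $ r $ i * ?t (\<lambda>js. T (r # j # js)))))"
      by (rule sum.swap)
    also have "\<dots> = (\<Sum>i\<in>UNIV. \<Sum>j\<in>UNIV. \<Sum>r\<in>UNIV. x $ i * (y $ j * (E $ r $ i * ?t (\<lambda>js. T (r # j # js)))))"
      by (rule sum.cong[OF refl], rule sum.swap)
    also have "\<dots> = (\<Sum>i\<in>UNIV. \<Sum>j\<in>UNIV. x $ i * (y $ j * ?t (\<lambda>js. \<Sum>r\<in>UNIV. E $ r $ i * T (r # j # js))))"
      by (simp add: tensor_eval_sum tensor_eval_cmult sum_distrib_left)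
    also have "\<dots> = (\<Sum>i\<in>UNIV. \<Sum>j\<in>UNIV. x $ i * (y $ j * ?t (\<lambda>js. \<Sum>r\<in>UNIV. E $ r $ j * T (i # r # js))))"
    proof -
      have "?t (\<lambda>js. \<Sum>r\<in>UNIV. E $ r $ i * T (r # j # js)) =
          ?t (\<lambda>js. \<Sum>r\<in>UNIV. E $ r $ j * T (i # r # js))" for i j
        by (rule tensor_eval_cong, rule *[unfolded self_adjoint_matrix_def, rule_format]) (use len in simp)
      thus ?thesis by simp
    qed
    also have "\<dots> = (\<Sum>i\<in>UNIV. \<Sum>j\<in>UNIV. \<Sum>r\<in>UNIV. x $ i * (y $ j * (E $ r $ j * ?t (\<lambda>js. T (i # r # js)))))"
      by (simp add: tensor_eval_sum tensor_eval_cmult sum_distrib_left)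
    also have "\<dots> = (\<Sum>i\<in>UNIV. \<Sum>r\<in>UNIV. \<Sum>j\<in>UNIV. x $ i * (y $ j * (E $ r $ j * ?t (\<lambda>js. T (i # r # js)))))"
      by (rule sum.cong[OF refl], rule sum.swap)
    also have "\<dots> = tensor_form T (x # E *v y # zs)"
      by (simp add: matrix_vector_mult_def sum_distrib_left sum_distrib_right mult_ac)
    finally show "tensor_form T (E *v x # y # zs) = tensor_form T (x # E *v y # zs)" .
  qed
qed

text \<open>An injective linear map has a left inverse, so nondegeneracy is witnessed by elements \<open>C\<close> of the
small field that express each coordinate of a vector by its pairings with basis vectors. These
identities persist over a larger field.\<close>

lemma nondegenerate_tensor_extend:
  fixes T :: "'i::finite list \<Rightarrow> 'f::field" and h :: "'f \<Rightarrow> 'g::field"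
  assumes h: "field_hom h" and T: "nondegenerate_tensor d T"
  shows "nondegenerate_tensor d (h \<circ> T)"
proof -
  interpret h: field_hom h by fact
  define J where "J = {js :: 'i list. length js + 1 = d}"
  have finJ: "finite J"
  proof -
    have "J \<subseteq> {js. set js \<subseteq> UNIV \<and> length js = d - 1}" by (auto simp: J_def)
    thus ?thesis by (rule finite_subset) (rule finite_lists_length_eq, simp)
  qed
  define t where "t = (\<lambda>(a :: 'f) (f :: 'i list \<Rightarrow> 'f) js. a * f js)"
  interpret t: vector_space t
    by unfold_locales (auto simp: t_def fun_eq_iff algebra_simps)
  interpret vector_space_pair "(*s) :: 'f \<Rightarrow> 'f^'i \<Rightarrow> 'f^'i" t by unfold_locales
  define \<Phi> where "\<Phi> = (\<lambda>(x :: 'f^'i) js. if js \<in> J then \<Sum>r\<in>UNIV. x $ r * T (r # js) else 0)"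
  have lin: "Vector_Spaces.linear (*s) t \<Phi>"
    using vec.vector_space_axioms t.vector_space_axioms
    by (auto simp: Vector_Spaces.linear_iff \<Phi>_def t_def fun_eq_iff distrib_right sum.distrib
        sum_distrib_left mult.assoc)
  have "x = 0" if "\<Phi> x = 0" for x
  proof -
    have "(\<Sum>r\<in>UNIV. x $ r * T (r # js)) = 0" if "length js + 1 = d" for js
      using fun_cong[OF \<open>\<Phi> x = 0\<close>, of js] that by (simp add: \<Phi>_def J_def)
    hence "x $ r = 0" for r using T unfolding nondegenerate_tensor_def by blast
    thus ?thesis by (simp add: Finite_Cartesian_Product.vec_eq_iff)
  qed
  moreover have "\<Phi> (x - y) = \<Phi> x - \<Phi> y" for x y
    by (auto simp: \<Phi>_def fun_eq_iff left_diff_distrib sum_subtractf)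
  ultimately have "inj \<Phi>" by (metis injI right_minus_eq)
  then obtain g where g: "Vector_Spaces.linear t (*s) g" "g \<circ> \<Phi> = id"
    using linear_injective_left_inverse[OF lin] by blast
  have gadd: "g (u + v) = g u + g v" and gscale: "g (t a u) = a *s g u" for u v a
    using g(1) by (auto simp: Vector_Spaces.linear_iff)
  have "g 0 = 0" using gscale[of 0 0] by (simp add: t_def zero_fun_def)
  hence gsum: "g (\<Sum>i\<in>I. f i) = (\<Sum>i\<in>I. g (f i))" for I :: "'i list set" and f
    by (induction I rule: infinite_finite_induct) (simp_all add: gadd)
  define C where "C i js = g (\<lambda>ks. of_bool (ks = js)) $ i" for i js
  have C: "(\<Sum>js\<in>J. C i js * T (r # js)) = of_bool (i = r)" for i r
  proof -
    have "\<Phi> (axis r 1) = (\<Sum>js\<in>J. t (T (r # js)) (\<lambda>ks. of_bool (ks = js)))"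
    proof
      fix ks
      have sum_app: "(\<Sum>js\<in>J. F js) ks = (\<Sum>js\<in>J. F js ks)" for F :: "'i list \<Rightarrow> 'i list \<Rightarrow> 'f"
        by (induction J rule: infinite_finite_induct) auto
      have "(\<Sum>js\<in>J. t (T (r # js)) (\<lambda>ks. of_bool (ks = js)) ks) = (\<Sum>js\<in>J. if js = ks then T (r # js) else 0)"
        by (rule sum.cong) (auto simp: t_def)
      moreover have "(\<Sum>q\<in>UNIV. axis r 1 $ q * T (q # ks)) = T (r # ks)"
        by (simp add: axis_def if_distrib[of "\<lambda>x. x * _"] cong: if_cong)
      ultimately show "\<Phi> (axis r 1) ks = (\<Sum>js\<in>J. t (T (r # js)) (\<lambda>ks. of_bool (ks = js))) ks"
        using finJ by (simp add: sum_app \<Phi>_def)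
    qed
    hence "g (\<Phi> (axis r 1)) = (\<Sum>js\<in>J. T (r # js) *s g (\<lambda>ks. of_bool (ks = js)))"
      by (simp add: gsum gscale)
    moreover have "g (\<Phi> (axis r 1)) = axis r 1" using g(2) by (simp add: fun_eq_iff)
    ultimately have "axis r 1 $ i = (\<Sum>js\<in>J. T (r # js) *s g (\<lambda>ks. of_bool (ks = js))) $ i" by simp
    thus ?thesis by (cases "i = r") (simp_all add: C_def axis_def mult.commute)
  qed
  show ?thesis unfolding nondegenerate_tensor_def
  proof (intro allI impI)
    fix x i assume zero: "\<forall>js. length js + 1 = d \<longrightarrow> (\<Sum>r\<in>UNIV. x r * (h \<circ> T) (r # js)) = 0"
    have "x i = (\<Sum>r\<in>UNIV. x r * h (of_bool (i = r)))"
      by (simp add: of_bool_def if_distrib[of h] if_distrib[of "\<lambda>z. _ * z"] cong: if_cong)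
    also have "\<dots> = (\<Sum>r\<in>UNIV. x r * (\<Sum>js\<in>J. h (C i js) * h (T (r # js))))"
      by (simp add: h.hom_sum h.hom_mult flip: C)
    also have "\<dots> = (\<Sum>r\<in>UNIV. \<Sum>js\<in>J. h (C i js) * (x r * h (T (r # js))))"
      by (simp add: sum_distrib_left mult_ac)
    also have "\<dots> = (\<Sum>js\<in>J. h (C i js) * (\<Sum>r\<in>UNIV. x r * h (T (r # js))))"
      by (subst sum.swap) (simp add: sum_distrib_left)
    also have "\<dots> = 0" using zero by (intro sum.neutral) (auto simp: J_def)
    finally show "x i = 0" .
  qed
qed

lemma nondegenerate_multilinear_tensor_form:
  fixes T :: "'i::finite list \<Rightarrow> 'f::field"
  assumes "d \<ge> 3" "symmetric_tensor d T" "nondegenerate_tensor d T"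
  shows "nondegenerate_multilinear_form (*s) d (tensor_form T)"
proof -
  interpret symmetric_multilinear_form "(*s)" UNIV d "tensor_form T"
    by (rule symmetric_multilinear_tensor_eval) (use assms(2) in \<open>auto simp: symmetric_tensor_def\<close>)
  show ?thesis
  proof unfold_locales
    fix v assume zero: "\<And>vs. length vs + 1 = d \<Longrightarrow> tensor_form T (v # vs) = 0"
    have "(\<Sum>r\<in>UNIV. v $ r * T (r # js)) = 0" if "length js + 1 = d" for js
    proof -
      have ax: "tensor_eval UNIV S (map (vec_nth \<circ> (\<lambda>j. axis j 1)) js) = S js" for S :: "'i list \<Rightarrow> 'f"
        using tensor_form_axes[of S js] by simp
      show ?thesis using zero[of "map (\<lambda>j. axis j 1) js"] that by (simp add: ax)
    qed
    hence "v $ r = 0" for r using assms(3) unfolding nondegenerate_tensor_def by blast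
    thus "v = 0" by (simp add: Finite_Cartesian_Product.vec_eq_iff)
  qed (use assms in auto)
qed

text \<open>A homomorphism takes an idempotent of the centre to one over the larger field, and being \<open>0\<close> or
\<open>1\<close> is reflected by injectivity.\<close>

lemma primitive_tensor_reflect:
  fixes T :: "'i::finite list \<Rightarrow> 'f::field"
  assumes h: "field_hom h" and prim: "primitive_tensor d (h \<circ> T)"
  shows "primitive_tensor d T"
  unfolding primitive_tensor_def
proof (intro allI impI)
  interpret h: field_hom h by fact
  fix E :: "'f^'i^'i" assume E: "E ** E = E" "self_adjoint_matrix d T E"
  define M where "M = (\<chi> i j. h (E $ i $ j))"
  have "(M ** M) $ i $ j = h ((E ** E) $ i $ j)" for i j
    by (simp add: M_def matrix_matrix_mult_def h.hom_sum h.hom_mult)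
  hence "M ** M = M" by (simp add: E(1) M_def Finite_Cartesian_Product.vec_eq_iff)
  moreover have "self_adjoint_matrix d (h \<circ> T) M"
    using E(2) unfolding self_adjoint_matrix_def M_def
    by (simp flip: h.hom_mult h.hom_sum)
  ultimately have "M = 0 \<or> M = mat 1" using prim unfolding primitive_tensor_def by blast
  moreover have hE: "h (E $ i $ j) = M $ i $ j" for i j by (simp add: M_def)
  have "E = 0" if "M = 0"
    using hE by (simp add: that Finite_Cartesian_Product.vec_eq_iff)
  moreover have "E = mat 1" if "M = mat 1"
  proof -
    have "h (E $ i $ j) = h (mat 1 $ i $ j)" for i j
      using hE[of i j] by (simp add: that Finite_Cartesian_Product.mat_def)
    hence "E $ i $ j = mat 1 $ i $ j" for i j
      using h.hom_0_iff[of "E $ i $ j - mat 1 $ i $ j"] by (simp add: h.hom_minus)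
    thus ?thesis by (simp add: Finite_Cartesian_Product.vec_eq_iff)
  qed
  ultimately show "E = 0 \<or> E = mat 1" by blast
qed

text \<open>Let \<open>E = p / q\<close> with a common denominator. At a point where \<open>q\<close> does not vanish, the values of
\<open>E\<close> form an idempotent of the centre over the ground field, hence \<open>0\<close> or \<open>1\<close>. So each product
\<open>p i j * (p k m - q \<delta> k m) * q\<close> vanishes at all points, hence as a polynomial, and in an integral
domain one of the two alternatives must hold identically.\<close>

lemma primitive_tensor_ratfun:
  fixes T :: "'i::finite list \<Rightarrow> 'c::alg_closed_field"
  assumes prim: "primitive_tensor d T"
  shows "primitive_tensor d ((const_ratfun :: 'c \<Rightarrow> ('c, 'n::{finite,linorder}) ratfun) \<circ> T)"
  unfolding primitive_tensor_def
proof (intro allI impI)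
  let ?c = "const_ratfun :: 'c \<Rightarrow> ('c, 'n) ratfun"
  fix E :: "('c, 'n) ratfun^'i^'i"
  assume E: "E ** E = E" "self_adjoint_matrix d (?c \<circ> T) E"
  obtain q where q: "q \<noteq> 0" "\<forall>x\<in>range (\<lambda>(i, j). E $ i $ j). \<exists>p. x = to_fract p / to_fract q"
    using common_denominator[of "range (\<lambda>(i, j). E $ i $ j)"] by auto
  hence "\<forall>i j. \<exists>p. E $ i $ j = to_fract p / to_fract q" by auto
  then obtain p where p: "\<And>i j. E $ i $ j = to_fract (p i j) / to_fract q" by metis
  have inj: "a = b" if "to_fract a = to_fract b" for a b :: "('n \<Rightarrow>\<^sub>0 nat) \<Rightarrow>\<^sub>0 'c"
    using that by (simp add: to_fract_def eq_fract)
  have q0: "to_fract q \<noteq> 0" using q(1) inj[of q 0] by auto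
  have idem: "(\<Sum>k\<in>UNIV. p i k * p k j) = q * p i j" for i j
  proof (rule inj)
    have "(\<Sum>k\<in>UNIV. E $ i $ k * E $ k $ j) = E $ i $ j"
      using E(1) by (metis (no_types, lifting) matrix_matrix_mult_def vec_lambda_beta sum.cong)
    hence "(\<Sum>k\<in>UNIV. to_fract (p i k) * to_fract (p k j)) / (to_fract q * to_fract q) = to_fract (p i j) / to_fract q"
      by (simp add: p sum_divide_distrib)
    thus "to_fract (\<Sum>k\<in>UNIV. p i k * p k j) = to_fract (q * p i j)"
      using q0 by (simp add: to_fract_hom.hom_sum to_fract_hom.hom_mult field_simps)
  qed
  have adj: "(\<Sum>r\<in>UNIV. p r i * Poly_Mapping.single 0 (T (r # j # js))) =
      (\<Sum>r\<in>UNIV. p r j * Poly_Mapping.single 0 (T (i # r # js)))" if "length js + 2 = d" for i j js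
  proof (rule inj)
    have "(\<Sum>r\<in>UNIV. to_fract (p r i) * ?c (T (r # j # js))) / to_fract q =
        (\<Sum>r\<in>UNIV. to_fract (p r j) * ?c (T (i # r # js))) / to_fract q"
      using E(2) that unfolding self_adjoint_matrix_def by (simp add: p sum_divide_distrib)
    thus "to_fract (\<Sum>r\<in>UNIV. p r i * Poly_Mapping.single 0 (T (r # j # js))) =
        to_fract (\<Sum>r\<in>UNIV. p r j * Poly_Mapping.single 0 (T (i # r # js)))"
      using q0 by (simp add: const_ratfun_eq_to_fract to_fract_hom.hom_sum to_fract_hom.hom_mult)
  qed
  define \<delta> where "\<delta> k m = (if k = m then q else 0)" for k m :: 'i
  have prod: "p i j * (p k m - \<delta> k m) * q = 0" for i j k m
  proof (rule vanishing_poly_zero_alg_closed)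
    fix x :: "'n \<Rightarrow> 'c"
    let ?ev = "\<lambda>p. eval_poly_at id p x"
    interpret ev: comm_ring_hom ?ev by (rule comm_ring_hom_eval_poly_at)
    show "?ev (p i j * (p k m - \<delta> k m) * q) = 0"
    proof (cases "?ev q = 0")
      case False
      define M where "M = (\<chi> i j. ?ev (p i j) / ?ev q)"
      have "(M ** M) $ i $ j = M $ i $ j" for i j
      proof -
        have "(M ** M) $ i $ j = ?ev (\<Sum>k\<in>UNIV. p i k * p k j) / (?ev q * ?ev q)"
          by (simp add: M_def matrix_matrix_mult_def ev.hom_sum ev.hom_mult sum_divide_distrib)
        thus ?thesis using False by (simp add: idem ev.hom_mult M_def)
      qed
      hence "M ** M = M" by (simp add: Finite_Cartesian_Product.vec_eq_iff)
      moreover have "self_adjoint_matrix d T M"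
        unfolding self_adjoint_matrix_def
      proof (intro allI impI)
        fix i j and js :: "'i list" assume "length js + 2 = d"
        from arg_cong[OF adj[OF this, of i j], of ?ev]
        show "(\<Sum>r\<in>UNIV. M $ r $ i * T (r # j # js)) = (\<Sum>r\<in>UNIV. M $ r $ j * T (i # r # js))"
          by (simp add: ev.hom_sum ev.hom_mult M_def flip: sum_divide_distrib)
      qed
      ultimately have "M = 0 \<or> M = mat 1" using prim unfolding primitive_tensor_def by blast
      moreover have "?ev (p i j) = M $ i $ j * ?ev q" for i j using False by (simp add: M_def)
      ultimately have "?ev (p i j) = 0 \<or> ?ev (p k m) = ?ev (\<delta> k m)"
        by (auto simp: Finite_Cartesian_Product.mat_def \<delta>_def)
      thus ?thesis by (auto simp: ev.hom_mult ev.hom_minus)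
    qed (simp add: ev.hom_mult)
  qed
  show "E = 0 \<or> E = mat 1"
  proof (cases "\<forall>i j. p i j = 0")
    case True
    thus ?thesis by (simp add: Finite_Cartesian_Product.vec_eq_iff p)
  next
    case False
    then obtain i j where "p i j \<noteq> 0" by blast
    hence "p k m = \<delta> k m" for k m using prod[of i j k m] q(1) by simp
    thus ?thesis using q0 by (simp add: Finite_Cartesian_Product.vec_eq_iff p \<delta>_def Finite_Cartesian_Product.mat_def)
  qed
qed

section \<open>Base change of similarities and splitting of trace forms\<close>

lemma basis_family_coordinates:
  fixes s :: "'f::field \<Rightarrow> 'v::ab_group_add \<Rightarrow> 'v" and b :: "'i::finite \<Rightarrow> 'v"
  assumes "vector_space s" and b: "basis_family s UNIV b UNIV"
  obtains c where "\<And>v. (\<Sum>i\<in>UNIV. s (c i v) (b i)) = v"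
    "\<And>i u v. c i (u + v) = c i u + c i v" "\<And>i a v. c i (s a v) = a * c i v"
    "\<And>i j. c i (b j) = of_bool (i = j)"
proof -
  interpret vector_space s by fact
  have inj: "inj b" and ind: "independent (range b)" and span: "span (range b) = UNIV"
    using b by (auto simp: basis_family_def)
  define c where "c i v = representation (range b) v (b i)" for i v
  have "(\<Sum>i\<in>UNIV. s (c i v) (b i)) = v" for v
  proof -
    have "(\<Sum>i\<in>UNIV. s (c i v) (b i)) = (\<Sum>x\<in>range b. s (representation (range b) v x) x)"
      by (simp add: sum.reindex[OF inj] c_def)
    thus ?thesis using sum_representation_eq[OF ind, of v "range b"] span by simp
  qed
  moreover have "c i (u + v) = c i u + c i v" for i u v
    using span by (simp add: c_def representation_add[OF ind])
  moreover have "c i (s a v) = a * c i v" for i a v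
    using span by (simp add: c_def representation_scale[OF ind])
  moreover have "c i (b j) = of_bool (i = j)" for i j
    using inj by (simp add: c_def representation_basis[OF ind] inj_eq)
  ultimately show thesis using that by blast
qed

lemma multilinear_eq_tensor_form:
  fixes \<Theta> :: "('f::field^'i) list \<Rightarrow> 'f"
  assumes "symmetric_multilinear_form (*s) UNIV d \<Theta>" "length xs = d"
  shows "\<Theta> xs = tensor_form (\<lambda>is. \<Theta> (map (\<lambda>j. axis j 1) is)) xs"
proof -
  interpret symmetric_multilinear_form "(*s)" UNIV d \<Theta> by fact
  have "map (\<lambda>x. \<Sum>i\<in>UNIV. x i *s axis i 1) (map vec_nth xs) = xs"
    by (rule nth_equalityI) (simp_all add: basis_expansion)
  thus ?thesis
    using tensor_eval_expand[of UNIV "\<lambda>j. axis j 1" "[]" "map vec_nth xs"] assms(2) by simp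
qed

lemma symmetric_multilinear_form_pullback:
  fixes \<Theta> :: "('f::field^'m) list \<Rightarrow> 'f" and P :: "'f^'n^'m"
  assumes "symmetric_multilinear_form (*s) UNIV d \<Theta>"
  shows "symmetric_multilinear_form (*s) UNIV d (\<lambda>vs. \<Theta> (map ((*v) P) vs))"
proof -
  interpret symmetric_multilinear_form "(*s)" UNIV d \<Theta> by fact
  have "\<Theta> (map ((*v) P) xs) = \<Theta> (map ((*v) P) ys)" if "length xs = d" "mset xs = mset ys" for xs ys
    by (rule perm) (use that in auto)
  thus ?thesis
    by unfold_locales
      (auto simp: symmetric_multilinear_on_def matrix_vector_right_distrib vector_scalar_commute
        add_slot scale_slot)
qed

lemma symmetric_multilinear_form_diff:
  assumes "symmetric_multilinear_form s V d \<Theta>" "symmetric_multilinear_form s V d \<Theta>'"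
  shows "symmetric_multilinear_form s V d (\<lambda>vs. \<Theta> vs - g * \<Theta>' vs)"
proof -
  interpret T: symmetric_multilinear_form s V d \<Theta> by fact
  interpret T': symmetric_multilinear_form s V d \<Theta>' by fact
  have "\<Theta> xs - g * \<Theta>' xs = \<Theta> ys - g * \<Theta>' ys" if "set xs \<subseteq> V" "length xs = d" "mset xs = mset ys" for xs ys
    using T.perm[OF that] T'.perm[OF that] by simp
  thus ?thesis
    using T.subspace_V by unfold_locales
      (auto simp: symmetric_multilinear_on_def T.add_slot T.scale_slot T'.add_slot T'.scale_slot
        algebra_simps)
qed

text \<open>Among the first \<open>card S + 1\<close> iterates two coincide, and injectivity cancels the common part.\<close>

lemma injective_orbit_returns:
  assumes "finite S" "\<rho> ` S \<subseteq> S" "inj_on \<rho> S" "x \<in> S"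
  shows "\<exists>i. 1 \<le> i \<and> i \<le> card S \<and> (\<rho> ^^ i) x = x"
proof -
  have S: "(\<rho> ^^ i) x \<in> S" for i by (induction i) (use assms in auto)
  have "\<not> inj_on (\<lambda>i. (\<rho> ^^ i) x) {..card S}"
  proof
    assume "inj_on (\<lambda>i. (\<rho> ^^ i) x) {..card S}"
    hence "card {..card S} \<le> card S" using S assms(1) by (intro card_inj_on_le) auto
    thus False by simp
  qed
  then obtain i j where ij: "i < j" "j \<le> card S" "(\<rho> ^^ i) x = (\<rho> ^^ j) x"
    unfolding inj_on_def by (metis atMost_iff linorder_neqE_nat)
  have "(\<rho> ^^ k) x = x" if "(\<rho> ^^ i) x = (\<rho> ^^ (i + k)) x" for i k
    using that
  proof (induction i)
    case (Suc i)
    hence "(\<rho> ^^ i) x = (\<rho> ^^ (i + k)) x" using inj_onD[OF assms(3)] S by simp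
    thus ?case by (rule Suc.IH)
  qed simp
  from this[of i "j - i"] ij show ?thesis by (intro exI[of _ "j - i"]) auto
qed

lemma matrix_map_mult:
  fixes A :: "'a::field^'n^'m" and B :: "'a^'p^'n"
  assumes "field_hom h"
  shows "(\<chi> i j. h (A $ i $ j)) ** (\<chi> i j. h (B $ i $ j)) = (\<chi> i j. h ((A ** B) $ i $ j))"
proof -
  interpret h: field_hom h by fact
  show ?thesis by (simp add: Finite_Cartesian_Product.vec_eq_iff matrix_matrix_mult_def h.hom_sum h.hom_mult)
qed

lemma matrix_map_one:
  assumes "field_hom h"
  shows "(\<chi> i j. h ((mat 1 :: 'a::field^'n^'n) $ i $ j)) = mat 1"
proof -
  interpret h: field_hom h by fact
  show ?thesis by (simp add: Finite_Cartesian_Product.vec_eq_iff Finite_Cartesian_Product.mat_def)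
qed

text \<open>The similarity is given over the rational functions of the base field \<open>k\<close> and only through the
values of the form. Polarising gives an identity of multilinear forms, which is a finite set of
equations between matrix entries on basis vectors; these can be mapped to the rational function
field over \<open>c\<close>.\<close>

lemma isometry_base_change:
  fixes s :: "'k::field \<Rightarrow> 'v::ab_group_add \<Rightarrow> 'v" and b :: "'n::{finite,linorder} \<Rightarrow> 'v"
    and h :: "'k \<Rightarrow> 'c::field"
  assumes char: "\<And>m. 1 \<le> m \<Longrightarrow> m \<le> d \<Longrightarrow> of_nat m \<noteq> (0 :: 'k)"
    and form: "symmetric_multilinear_form s UNIV d \<theta>" "\<And>v. \<phi> v = \<theta> (replicate d v)"
    and b: "basis_family s UNIV b UNIV" and h: "field_hom h"
    and sm: "strongly_multiplicative s b d \<phi>"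
  obtains M M' :: "('c, 'n) ratfun^('n::{finite,linorder})^('n::{finite,linorder})" where "M ** M' = mat 1" "M' ** M = mat 1"
    "\<And>vs. length vs = d \<Longrightarrow>
       tensor_form (\<lambda>is. const_ratfun (h (\<theta> (map b is)))) (map ((*v) M) vs) =
       generic_value h s b d \<phi> * tensor_form (\<lambda>is. const_ratfun (h (\<theta> (map b is)))) vs"
proof -
  interpret symmetric_multilinear_form s UNIV d \<theta> by fact
  interpret h: field_hom h by fact
  let ?ck = "const_ratfun :: 'k \<Rightarrow> ('k, 'n) ratfun"
  let ?cc = "const_ratfun :: 'c \<Rightarrow> ('c, 'n) ratfun"
  interpret ck: field_hom ?ck by (rule field_hom_const_ratfun)
  define Tk where "Tk = (\<lambda>is. ?ck (\<theta> (map b is)))"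
  define Tc where "Tc = (\<lambda>is. ?cc (h (\<theta> (map b is))))"
  define gk where "gk = (generic_value id s b d \<phi> :: ('k, 'n) ratfun)"
  define gc where "gc = (generic_value h s b d \<phi> :: ('c, 'n) ratfun)"
  have "scalar_extension ?ck s b d \<phi> x = tensor_form Tk (replicate d x)" for x
    unfolding Tk_def
    by (rule scalar_extension_eq_tensor_eval[OF char])
      (use form b sml vector_space_axioms ck.comm_ring_hom_axioms in auto)
  then obtain f where f: "Vector_Spaces.linear (*s) (*s) f" "bij f"
    "\<And>v. tensor_form Tk (replicate d (f v)) = gk * tensor_form Tk (replicate d v)"
    using sm by (auto simp: strongly_multiplicative_def Let_def isomorphic_forms_def gk_def)
  define A where "A = matrix f"
  have Af: "A *v v = f v" for v unfolding A_def by (rule matrix_works[OF f(1)])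
  have "inj ((*v) A)" using bij_is_inj[OF f(2)] by (simp add: Af inj_on_def)
  then obtain A' where A': "A' ** A = mat 1"
    using matrix_left_invertible_injective by blast
  have A'': "A ** A' = mat 1" using matrix_left_right_inverse1[OF A'] .
  have sym: "symmetric_tensor d (\<lambda>is. \<theta> (map b is))"
    unfolding symmetric_tensor_def by (auto intro!: perm)
  have formk: "symmetric_multilinear_form (*s) UNIV d (tensor_form Tk)"
    by (rule symmetric_multilinear_tensor_eval) (use sym in \<open>auto simp: Tk_def symmetric_tensor_def\<close>)
  have formc: "symmetric_multilinear_form (*s) UNIV d (tensor_form Tc)"
    by (rule symmetric_multilinear_tensor_eval) (use sym in \<open>auto simp: Tc_def symmetric_tensor_def\<close>)
  have polar: "tensor_form Tk (map ((*v) A) vs) - gk * tensor_form Tk vs = 0" if "length vs = d" for vs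
  proof (rule symmetric_multilinear_form.zero_if_diagonal_zero[OF
        symmetric_multilinear_form_diff[OF symmetric_multilinear_form_pullback[OF formk] formk] refl _ _ that])
    show "of_nat m \<noteq> (0 :: ('k, 'n) ratfun)" if "1 \<le> m" "m \<le> d" for m
      using char[OF that] field_hom_of_nat_eq_0[OF ck.field_hom_axioms] by simp
    show "tensor_form Tk (map ((*v) A) (replicate d v)) - gk * tensor_form Tk (replicate d v) = 0" for v
      using f(3)[of v] by (simp add: Af)
  qed
  interpret map: comm_ring_hom "Poly_Mapping.map h :: (('n \<Rightarrow>\<^sub>0 nat) \<Rightarrow>\<^sub>0 'k) \<Rightarrow> _"
    by (rule comm_ring_hom_map_poly_mapping) (rule h.comm_ring_hom_axioms)
  have "x = 0" if "Poly_Mapping.map h x = 0" for x :: "('n \<Rightarrow>\<^sub>0 nat) \<Rightarrow>\<^sub>0 'k"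
  proof (rule poly_mapping_eqI)
    fix m
    have "h (Poly_Mapping.lookup x m) = 0"
      using that lookup_map_poly_mapping[of h x m] by simp
    thus "Poly_Mapping.lookup x m = Poly_Mapping.lookup 0 m" by simp
  qed
  from field_hom_to_fract_extension[OF map.comm_ring_hom_axioms this]
  obtain \<iota> :: "('k, 'n) ratfun \<Rightarrow> ('c, 'n) ratfun" where \<iota>: "field_hom \<iota>"
    "\<And>p q. q \<noteq> 0 \<Longrightarrow> \<iota> (Fract p q) = Fract (Poly_Mapping.map h p) (Poly_Mapping.map h q)" by blast
  interpret \<iota>: field_hom \<iota> by (rule \<iota>(1))
  have \<iota>c: "\<iota> (?ck a) = ?cc (h a)" for a
  proof -
    have "Poly_Mapping.map h (Poly_Mapping.single 0 a) = Poly_Mapping.single (0 :: 'n \<Rightarrow>\<^sub>0 nat) (h a)"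
      by (rule poly_mapping_eqI) (simp add: lookup_map_poly_mapping lookup_single when_def)
    thus ?thesis by (simp add: const_ratfun_def \<iota>(2))
  qed
  have \<iota>g: "\<iota> gk = gc"
  proof -
    have "Poly_Mapping.map id p = p" for p :: "('n \<Rightarrow>\<^sub>0 nat) \<Rightarrow>\<^sub>0 'k"
      by (rule poly_mapping_eqI) (simp add: lookup_map_poly_mapping)
    thus ?thesis by (simp add: gk_def gc_def generic_value_def \<iota>(2))
  qed
  define M where "M = (\<chi> i j. \<iota> (A $ i $ j))"
  define M' where "M' = (\<chi> i j. \<iota> (A' $ i $ j))"
  have \<iota>t: "\<iota> (tensor_form Tk vs) = tensor_form Tc (map (\<lambda>v. \<chi> i. \<iota> (v $ i)) vs)" for vs
  proof -
    have "map ((\<circ>) \<iota>) (map vec_nth vs) = map vec_nth (map (\<lambda>v. \<chi> i. \<iota> (v $ i)) vs)" by auto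
    moreover have "\<iota> \<circ> Tk = Tc" by (auto simp: Tk_def Tc_def \<iota>c)
    ultimately show ?thesis using tensor_eval_hom[OF \<iota>.comm_ring_hom_axioms, of UNIV Tk "map vec_nth vs"]
      by (simp only:)
  qed
  have axes: "tensor_form Tc (map ((*v) M) (map (\<lambda>j. axis j 1) js)) = gc * Tc js" if "length js = d" for js
  proof -
    have "(\<chi> i. \<iota> ((A *v axis j 1) $ i)) = M *v axis j 1" for j
      by (simp add: Finite_Cartesian_Product.vec_eq_iff matrix_mult_axis M_def)
    hence "map ((*v) M) (map (\<lambda>j. axis j 1) js) =
        map (\<lambda>v. \<chi> i. \<iota> (v $ i)) (map ((*v) A) (map (\<lambda>j. axis j 1) js))" by auto
    hence "tensor_form Tc (map ((*v) M) (map (\<lambda>j. axis j 1) js)) =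
        \<iota> (tensor_form Tk (map ((*v) A) (map (\<lambda>j. axis j 1) js)))" by (simp only: \<iota>t)
    also have "tensor_form Tk (map ((*v) A) (map (\<lambda>j. axis j 1) js)) =
        gk * tensor_form Tk (map (\<lambda>j. axis j 1) js)"
      using polar[of "map (\<lambda>j. axis j 1) js"] that by simp
    also have "\<iota> \<dots> = gc * Tc js"
      by (simp only: \<iota>.hom_mult \<iota>g tensor_form_axes) (simp add: Tk_def Tc_def \<iota>c)
    finally show ?thesis .
  qed
  have "tensor_form Tc (map ((*v) M) vs) = gc * tensor_form Tc vs" if "length vs = d" for vs
  proof -
    have "tensor_form Tc (map ((*v) M) vs) =
        tensor_form (\<lambda>js. tensor_form Tc (map ((*v) M) (map (\<lambda>j. axis j 1) js))) vs"
      by (rule multilinear_eq_tensor_form[OF symmetric_multilinear_form_pullback[OF formc] that])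
    also have "\<dots> = tensor_form (\<lambda>js. gc * Tc js) vs"
      by (rule tensor_eval_cong) (subst axes, use that in auto)
    also have "\<dots> = gc * tensor_form Tc vs"
      by (rule tensor_eval_cmult)
    finally show ?thesis .
  qed
  moreover have "M ** M' = mat 1" "M' ** M = mat 1"
    unfolding M_def M'_def matrix_map_mult[OF \<iota>(1)] A' A'' by (rule matrix_map_one[OF \<iota>(1)])+
  ultimately show thesis using that unfolding Tc_def gc_def by blast
qed

context separable_extension
begin

text \<open>The isomorphism of \<open>V \<otimes>\<^sub>k c\<close> with the product of the spaces \<open>V \<otimes>\<^sub>l c\<close> taken along all embeddings,
in coordinates. The map \<open>P \<sigma>\<close> applies \<open>\<sigma>\<close> to the \<open>l\<close>-coordinates of a vector; \<open>Q \<sigma>\<close> is built from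
the coefficients \<open>C\<close> of the coordinate functionals. The products \<open>P \<tau> Q \<sigma>\<close> come out right by the duality of
\<open>C\<close> and the values \<open>\<tau> b\<close>, and the sum of the \<open>Q \<sigma> P \<sigma>\<close> by the expansion of the functionals in embeddings.\<close>

lemma embedding_coordinate_matrices:
  fixes s :: "'l \<Rightarrow> 'v::ab_group_add \<Rightarrow> 'v" and bl :: "'m::finite \<Rightarrow> 'v" and bk :: "'n::finite \<Rightarrow> 'v"
  assumes vs: "vector_space s" "vector_space (restrict_scalars incl s)"
    and bl: "basis_family s UNIV bl UNIV" and bk: "basis_family (restrict_scalars incl s) UNIV bk UNIV"
  obtains P :: "('l \<Rightarrow> 'c) \<Rightarrow> 'c^'n^'m" and Q :: "('l \<Rightarrow> 'c) \<Rightarrow> 'c^'m^'n" and x :: "'n \<Rightarrow> 'm \<Rightarrow> 'l"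
  where "\<And>j. bk j = (\<Sum>m\<in>UNIV. s (x j m) (bl m))" "\<And>\<sigma> j m. P \<sigma> $ m $ j = \<sigma> (x j m)"
    "\<And>\<sigma> \<tau>. \<sigma> \<in> embeddings \<Longrightarrow> \<tau> \<in> embeddings \<Longrightarrow> P \<tau> ** Q \<sigma> = (if \<tau> = \<sigma> then mat 1 else 0)"
    "(\<Sum>\<sigma>\<in>embeddings. Q \<sigma> ** P \<sigma>) = mat 1"
proof -
  interpret V: vector_space s by fact
  obtain cl where cl: "\<And>v. (\<Sum>i\<in>UNIV. s (cl i v) (bl i)) = v"
    "\<And>i u v. cl i (u + v) = cl i u + cl i v" "\<And>i a v. cl i (s a v) = a * cl i v"
    "\<And>i j. cl i (bl j) = of_bool (i = j)"
    by (rule basis_family_coordinates[OF vs(1) bl]) blast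
  obtain ck where ck: "\<And>v. (\<Sum>i\<in>UNIV. s (incl (ck i v)) (bk i)) = v"
    "\<And>i u v. ck i (u + v) = ck i u + ck i v" "\<And>i a v. ck i (s (incl a) v) = a * ck i v"
    "\<And>i j. ck i (bk j) = of_bool (i = j)"
    by (rule basis_family_coordinates[OF vs(2) bk]) (auto simp: restrict_scalars_def)
  have cl0: "cl i 0 = 0" and ck0: "ck j 0 = 0" for i j
    using cl(3)[of i 0 0] ck(3)[of j 0 0] by simp_all
  have clsum: "cl i (\<Sum>a\<in>A. f a) = (\<Sum>a\<in>A. cl i (f a))" for i f and A :: "'n set"
    by (induction A rule: infinite_finite_induct) (simp_all add: cl0 cl(2))
  have cksum: "ck i (\<Sum>a\<in>A. f a) = (\<Sum>a\<in>A. ck i (f a))" for i and f :: "'z \<Rightarrow> 'v" and A :: "'z set"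
    by (induction A rule: infinite_finite_induct) (simp_all add: ck0 ck(2))
  obtain B :: "'l set" and \<beta> C where B: "finite B" "\<And>x. (\<Sum>b\<in>B. incl (\<beta> b x) * b) = x"
    "\<And>b x. b \<in> B \<Longrightarrow> h (\<beta> b x) = (\<Sum>\<sigma>\<in>embeddings. C b \<sigma> * \<sigma> x)"
    "\<And>\<sigma> \<tau>. \<sigma> \<in> embeddings \<Longrightarrow> \<tau> \<in> embeddings \<Longrightarrow>
       (\<Sum>b\<in>B. C b \<sigma> * \<tau> b) = (if \<sigma> = \<tau> then 1 else 0)"
    by (rule dual_basis_and_trace) blast
  define x where "x j m = cl m (bk j)" for j m
  define P :: "('l \<Rightarrow> 'c) \<Rightarrow> 'c^'n^'m" where "P \<sigma> = (\<chi> m j. \<sigma> (x j m))" for \<sigma>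
  define Q :: "('l \<Rightarrow> 'c) \<Rightarrow> 'c^'m^'n" where
    "Q \<sigma> = (\<chi> j m. \<Sum>b\<in>B. C b \<sigma> * h (ck j (s b (bl m))))" for \<sigma>
  have PQ: "P \<tau> ** Q \<sigma> = (if \<tau> = \<sigma> then mat 1 else 0)" if \<sigma>: "\<sigma> \<in> embeddings" and \<tau>: "\<tau> \<in> embeddings" for \<sigma> \<tau>
  proof -
    interpret \<tau>: field_hom \<tau> using \<tau> by (rule embeddingD)
    have "(P \<tau> ** Q \<sigma>) $ m $ m' = (if \<tau> = \<sigma> then mat 1 else 0) $ m $ m'" for m m'
    proof -
      have "(P \<tau> ** Q \<sigma>) $ m $ m' =
          (\<Sum>j\<in>UNIV. \<Sum>b\<in>B. \<tau> (x j m) * (C b \<sigma> * \<tau> (incl (ck j (s b (bl m'))))))"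
        by (simp add: matrix_matrix_mult_def P_def Q_def sum_distrib_left embeddingD(2)[OF \<tau>])
      also have "\<dots> = (\<Sum>b\<in>B. \<Sum>j\<in>UNIV. \<tau> (x j m) * (C b \<sigma> * \<tau> (incl (ck j (s b (bl m'))))))"
        by (rule sum.swap)
      also have "\<dots> = (\<Sum>b\<in>B. C b \<sigma> * \<tau> (\<Sum>j\<in>UNIV. incl (ck j (s b (bl m'))) * x j m))"
        by (simp add: \<tau>.hom_sum \<tau>.hom_mult sum_distrib_left mult_ac)
      also have "\<dots> = (\<Sum>b\<in>B. C b \<sigma> * \<tau> (cl m (\<Sum>j\<in>UNIV. s (incl (ck j (s b (bl m')))) (bk j))))"
        by (simp add: clsum cl(3) x_def)
      also have "\<dots> = (\<Sum>b\<in>B. C b \<sigma> * \<tau> b) * of_bool (m = m')"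
        by (simp add: ck(1) cl(3,4) sum_distrib_right)
      also have "\<dots> = (if \<tau> = \<sigma> then mat 1 else 0) $ m $ m'"
        using B(4)[OF \<sigma> \<tau>] by (simp add: Finite_Cartesian_Product.mat_def)
      finally show ?thesis .
    qed
    thus ?thesis by (simp add: Finite_Cartesian_Product.vec_eq_iff)
  qed
  have QP: "(\<Sum>\<sigma>\<in>embeddings. Q \<sigma> ** P \<sigma>) = mat 1"
  proof -
    have "(\<Sum>\<sigma>\<in>embeddings. Q \<sigma> ** P \<sigma>) $ j $ j' = mat 1 $ j $ j'" for j j'
    proof -
      have "(\<Sum>\<sigma>\<in>embeddings. Q \<sigma> ** P \<sigma>) $ j $ j' =
          (\<Sum>\<sigma>\<in>embeddings. \<Sum>m\<in>UNIV. \<Sum>b\<in>B. h (ck j (s b (bl m))) * (C b \<sigma> * \<sigma> (x j' m)))"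
        by (simp add: matrix_matrix_mult_def P_def Q_def sum_distrib_right) (simp add: mult_ac)
      also have "\<dots> = (\<Sum>m\<in>UNIV. \<Sum>b\<in>B. \<Sum>\<sigma>\<in>embeddings. h (ck j (s b (bl m))) * (C b \<sigma> * \<sigma> (x j' m)))"
        by (subst sum.swap, rule sum.cong[OF refl], rule sum.swap)
      also have "\<dots> = (\<Sum>m\<in>UNIV. \<Sum>b\<in>B. h (ck j (s b (bl m))) * h (\<beta> b (x j' m)))"
        by (simp add: B(3) sum_distrib_left)
      also have "\<dots> = h (ck j (\<Sum>m\<in>UNIV. \<Sum>b\<in>B. s (incl (\<beta> b (x j' m))) (s b (bl m))))"
        by (simp add: cksum ck(3) h.hom_sum h.hom_mult mult.commute del: V.scale_scale)
      also have "(\<Sum>m\<in>UNIV. \<Sum>b\<in>B. s (incl (\<beta> b (x j' m))) (s b (bl m))) = (\<Sum>m\<in>UNIV. s (x j' m) (bl m))"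
        by (simp add: V.scale_sum_left[symmetric] B(2))
      also have "\<dots> = bk j'" by (simp add: x_def cl(1))
      finally show ?thesis by (simp add: ck(4) Finite_Cartesian_Product.mat_def)
    qed
    thus ?thesis by (simp add: Finite_Cartesian_Product.vec_eq_iff)
  qed
  show thesis
  proof (rule that)
    show "bk j = (\<Sum>m\<in>UNIV. s (x j m) (bl m))" for j by (simp add: x_def cl(1))
    show "P \<sigma> $ m $ j = \<sigma> (x j m)" for \<sigma> j m by (simp add: P_def)
  qed (use PQ QP in auto)
qed

lemma trace_hom: "h (field_trace incl a) = (\<Sum>\<sigma>\<in>embeddings. \<sigma> a)"
  by (rule dual_basis_and_trace) blast

end

section \<open>Trace forms that are not strongly multiplicative\<close>

lemma indecomposable_imp_primitive_tensor:
  fixes T :: "'i::finite list \<Rightarrow> 'f::field"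
  assumes "d \<ge> 3" "symmetric_tensor d T" "nondegenerate_tensor d T"
    and indec: "indecomposable (*s) UNIV d (\<lambda>x. tensor_form T (replicate d x))"
  shows "primitive_tensor d T"
  unfolding primitive_tensor_def
proof (intro allI impI)
  fix E assume E: "E ** E = E" "self_adjoint_matrix d T E"
  interpret nondegenerate_multilinear_form "(*s)" d "tensor_form T"
    by (rule nondegenerate_multilinear_tensor_form) fact+
  have "(\<forall>v. E *v v = 0) \<or> (\<forall>v. E *v v = v)"
  proof (rule ccontr)
    assume "\<not> ?thesis"
    hence "decomposable (*s) UNIV d (\<lambda>x. tensor_form T (replicate d x))"
      using E
      by (intro decomposable_if_idempotent[of "(*v) E" cart_basis])
        (auto simp: self_adjoint_matrix_iff matrix_vector_mul_assoc finite_cart_basis)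
    thus False using indec by (simp add: indecomposable_def)
  qed
  thus "E = 0 \<or> E = mat 1" by (auto simp: matrix_eq)
qed

text \<open>Arguments can be expanded in the basis, so a vector that pairs to zero with all lists of basis
vectors is in the radical.\<close>

lemma nondegenerate_tensor_of_form:
  fixes s :: "'f::field \<Rightarrow> 'v::ab_group_add \<Rightarrow> 'v" and b :: "'i::finite \<Rightarrow> 'v"
  assumes form: "symmetric_multilinear_form s UNIV d \<theta>"
    and nondeg: "\<And>v. (\<And>vs. length vs + 1 = d \<Longrightarrow> \<theta> (v # vs) = 0) \<Longrightarrow> v = 0"
    and b: "basis_family s UNIV b UNIV" 
  shows "nondegenerate_tensor d (\<lambda>is. \<theta> (map b is))"
  unfolding nondegenerate_tensor_def
proof (intro allI impI)
  interpret symmetric_multilinear_form s UNIV d \<theta> by fact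
  obtain c where c: "\<And>v. (\<Sum>i\<in>UNIV. s (c i v) (b i)) = v"
    "\<And>i u v. c i (u + v) = c i u + c i v" "\<And>i a v. c i (s a v) = a * c i v"
    "\<And>i j. c i (b j) = of_bool (i = j)"
    by (rule basis_family_coordinates[OF vector_space_axioms b]) blast
  fix x r assume zero: "\<forall>js. length js + 1 = d \<longrightarrow> (\<Sum>r\<in>UNIV. x r * \<theta> (map b (r # js))) = 0"
  have "(\<Sum>i\<in>UNIV. s (x i) (b i)) = 0"
  proof (rule nondeg)
    fix vs :: "'v list" assume len: "length vs + 1 = d"
    let ?ys = "map (\<lambda>v i. c i v) vs"
    have vs: "map (\<lambda>y. \<Sum>i\<in>UNIV. s (y i) (b i)) ?ys = vs"
      by (rule nth_equalityI) (simp_all add: c(1))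
    have "\<theta> ((\<Sum>i\<in>UNIV. s (x i) (b i)) # vs) =
        \<theta> ([] @ map (\<lambda>y. \<Sum>i\<in>UNIV. s (y i) (b i)) (x # ?ys))"
      by (simp only: vs list.map append_Nil)
    also have "\<dots> = tensor_eval UNIV (\<lambda>is. \<theta> ([] @ map b is)) (x # ?ys)"
      by (rule tensor_eval_expand) (use len in auto)
    also have "\<dots> = tensor_eval UNIV (\<lambda>js. \<Sum>r\<in>UNIV. x r * \<theta> (map b (r # js))) ?ys"
      by (simp add: tensor_eval_sum tensor_eval_cmult)
    also have "\<dots> = tensor_eval UNIV (\<lambda>js. 0 * 0) ?ys"
      by (rule tensor_eval_cong) (use zero len in auto)
    also have "\<dots> = 0" by (subst tensor_eval_cmult) simp
    finally show "\<theta> ((\<Sum>i\<in>UNIV. s (x i) (b i)) # vs) = 0" .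
  qed
  note zero_sum = this
  have c0: "c r 0 = 0" using c(3)[of r 0 0] by simp
  have "c r (\<Sum>i\<in>I. f i) = (\<Sum>i\<in>I. c r (f i))" for I :: "'i set" and f
    by (induction I rule: infinite_finite_induct) (simp_all add: c(2) c0)
  hence "(\<Sum>i\<in>UNIV. x i * of_bool (r = i)) = c r (\<Sum>i\<in>UNIV. s (x i) (b i))"
    by (simp add: c(3,4))
  thus "x r = 0"
    by (simp add: zero_sum c0 of_bool_def if_distrib[of "\<lambda>z. _ * z"] cong: if_cong)
qed

theorem theorem3:
  fixes incl :: "'k::field \<Rightarrow> 'l::field"
    and emb :: "'l \<Rightarrow> 'c::alg_closed_field"
    and s :: "'l \<Rightarrow> 'v::ab_group_add \<Rightarrow> 'v"
    and \<Gamma> :: "'v \<Rightarrow> 'l" and \<phi> :: "'v \<Rightarrow> 'k"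
    and b\<^sub>l :: "'m::finite \<Rightarrow> 'v" and b\<^sub>k :: "'n::{finite,linorder} \<Rightarrow> 'v"
    and d n :: nat
  assumes "d \<ge> 3"
    and "CHAR('k) = 0 \<or> CHAR('k) > d"
    and "finite_separable_extension incl"
    and "field_hom emb" and "is_algebraic_closure (emb \<circ> incl)"
    and "nondegenerate_form_on s UNIV d \<Gamma>"
    and "basis_family s UNIV b\<^sub>l UNIV"
    and "absolutely_indecomposable emb s b\<^sub>l d \<Gamma>"
    and "\<phi> = trace_form incl \<Gamma>"
    and "nondegenerate_form_on (restrict_scalars incl s) UNIV d \<phi>"
    and "basis_family (restrict_scalars incl s) UNIV b\<^sub>k UNIV"
    and "n = card (embeddings_over incl emb)"
    and "n < d"
    and "\<And>i. 1 \<le> i \<Longrightarrow> i \<le> n \<Longrightarrow>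
      (generic_value (emb \<circ> incl) (restrict_scalars incl s) b\<^sub>k d \<phi>
         :: ('c, 'n) ratfun) ^ i
      \<notin> similarity_factors (*s) UNIV (scalar_extension (const_ratfun \<circ> emb) s b\<^sub>l d \<Gamma>)"
  shows "\<not> strongly_multiplicative (restrict_scalars incl s) b\<^sub>k d \<phi>"
proof
  assume sm: "strongly_multiplicative (restrict_scalars incl s) b\<^sub>k d \<phi>"
  let ?s = "restrict_scalars incl s"
  define h where "h = emb \<circ> incl"
  have hom_h: "field_hom h" using assms(5) by (simp add: is_algebraic_closure_def h_def)
  interpret E: separable_extension incl h by (rule separable_extension.intro) fact+
  interpret emb: field_hom emb by fact
  let ?e = "const_ratfun :: 'c \<Rightarrow> ('c, 'n) ratfun"
  interpret e: field_hom ?e by (rule field_hom_const_ratfun)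
  define S where "S = E.embeddings"
  have finS: "finite S" unfolding S_def by (rule E.finite_embeddings)
  have "S = embeddings_over incl emb"
    unfolding S_def E.embeddings_def embeddings_over_def by (simp add: h_def)
  hence n: "n = card S" and embS: "emb \<in> S"
    using assms(4,12) by (simp_all add: embeddings_over_def)
  have homS: "field_hom \<sigma>" if "\<sigma> \<in> S" for \<sigma> using that E.embeddingD(1) by (simp add: S_def)
  have char_k: "of_nat m \<noteq> (0 :: 'k)" if "1 \<le> m" "m \<le> d" for m
    using assms(2) that by (auto simp: of_nat_eq_0_iff_char_dvd dest: dvd_imp_le)
  have char_l: "of_nat m \<noteq> (0 :: 'l)" if "1 \<le> m" "m \<le> d" for m
    using char_k[OF that] field_hom_of_nat_eq_0[OF E.incl.field_hom_axioms] by simp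

  from assms(6) have "vector_space s" by (simp add: nondegenerate_form_on_def form_on_def)
  then interpret V: vector_space s .
  interpret Vk: vector_space ?s
    by unfold_locales (simp_all add: restrict_scalars_def V.scale_right_distrib V.scale_left_distrib
        E.incl.hom_add E.incl.hom_mult)
  obtain \<theta> where \<theta>: "symmetric_multilinear_on s UNIV d \<theta>" "\<And>v. \<Gamma> v = \<theta> (replicate d v)"
    "\<And>v. (\<And>vs. length vs + 1 = d \<Longrightarrow> \<theta> (v # vs) = 0) \<Longrightarrow> v = 0"
    using assms(1,6) unfolding nondegenerate_form_on_def
    by (metis (no_types, lifting) Suc_eq_plus1 Suc_pred' UNIV_I le_zero_eq not_gr_zero not_numeral_le_zero top_greatest)
  interpret \<theta>: symmetric_multilinear_form s UNIV d \<theta> by unfold_locales (simp_all add: \<theta>(1))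
  define \<theta>k where "\<theta>k vs = field_trace incl (\<theta> vs)" for vs
  have tr: "h (field_trace incl a) = (\<Sum>\<sigma>\<in>S. \<sigma> a)" for a unfolding S_def by (rule E.trace_hom)
  have inj_h: "a = b" if "h a = h b" for a b
    using that E.h.hom_0_iff[of "a - b"] by (simp add: E.h.hom_minus)
  \<comment> \<open>Linearity of the trace is read off from its expression as the sum of the embeddings.\<close>
  have tr_add: "field_trace incl (a + b) = field_trace incl a + field_trace incl b" for a b
  proof (rule inj_h)
    have "\<sigma> (a + b) = \<sigma> a + \<sigma> b" if "\<sigma> \<in> S" for \<sigma>
    proof -
      interpret \<sigma>: field_hom \<sigma> using homS that .
      show ?thesis by (rule \<sigma>.hom_add)
    qed
    thus "h (field_trace incl (a + b)) = h (field_trace incl a + field_trace incl b)"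
      by (simp add: tr E.h.hom_add flip: sum.distrib)
  qed
  have tr_scale: "field_trace incl (incl c * a) = c * field_trace incl a" for a c
  proof (rule inj_h)
    have "\<sigma> (incl c * a) = h c * \<sigma> a" if "\<sigma> \<in> S" for \<sigma>
    proof -
      interpret \<sigma>: field_hom \<sigma> using homS that .
      show ?thesis using E.embeddingD(2) that by (simp add: \<sigma>.hom_mult S_def)
    qed
    thus "h (field_trace incl (incl c * a)) = h (c * field_trace incl a)"
      by (simp add: tr E.h.hom_mult sum_distrib_left cong: sum.cong)
  qed
  have smlk: "symmetric_multilinear_on ?s UNIV d \<theta>k"
    using \<theta>(1) by (simp add: symmetric_multilinear_on_def \<theta>k_def restrict_scalars_def tr_add tr_scale)
  interpret \<theta>k: symmetric_multilinear_form ?s UNIV d \<theta>k by unfold_locales (simp_all add: smlk)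
  have \<phi>: "\<phi> v = \<theta>k (replicate d v)" for v
    by (simp add: assms(9) trace_form_def \<theta>k_def \<theta>(2))

  define T where "T = (\<lambda>is. \<theta> (map b\<^sub>l is))"
  have symT: "symmetric_tensor d T"
    unfolding symmetric_tensor_def T_def by (auto intro!: \<theta>.perm)
  have sym_comp: "symmetric_tensor d (q \<circ> T)" for q :: "'l \<Rightarrow> 'z"
    using symT by (simp add: symmetric_tensor_def)
  have nondegT: "nondegenerate_tensor d T"
    unfolding T_def by (rule nondegenerate_tensor_of_form[OF \<theta>.symmetric_multilinear_form_axioms \<theta>(3) assms(7)])
  \<comment> \<open>Idempotents of the centre over \<open>c\<close>: first for the given embedding, where absolute
    indecomposability applies, then for its conjugates.\<close>
  have prim_emb: "primitive_tensor d (emb \<circ> T)"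
  proof (rule indecomposable_imp_primitive_tensor[OF assms(1) sym_comp])
    show "nondegenerate_tensor d (emb \<circ> T)" by (rule nondegenerate_tensor_extend[OF assms(4) nondegT])
    have "scalar_extension emb s b\<^sub>l d \<Gamma> = (\<lambda>x. tensor_form (emb \<circ> T) (replicate d x))"
      using scalar_extension_eq_tensor_eval[OF char_l V.vector_space_axioms \<theta>(1,2) assms(7) emb.comm_ring_hom_axioms]
      by (simp add: T_def comp_def fun_eq_iff)
    thus "indecomposable (*s) UNIV d (\<lambda>x. tensor_form (emb \<circ> T) (replicate d x))"
      using assms(8) by (simp add: absolutely_indecomposable_def)
  qed
  have prim: "primitive_tensor d (\<sigma> \<circ> T)" if \<sigma>: "\<sigma> \<in> S" for \<sigma>
  proof -
    interpret \<sigma>: field_hom \<sigma> using homS \<sigma> .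
    have "\<exists>p. p \<noteq> 0 \<and> poly (map_poly \<sigma> p) x = 0" for x
    proof -
      obtain p where p: "p \<noteq> 0" "poly (map_poly h p) x = 0"
        using assms(5) unfolding is_algebraic_closure_def h_def by blast
      have "map_poly \<sigma> (map_poly incl p) = map_poly h p"
        using E.embeddingD(2)[of \<sigma>] \<sigma> by (intro poly_eqI) (simp add: S_def)
      thus ?thesis using p by (intro exI[of _ "map_poly incl p"]) simp
    qed
    from algebraic_closure_embedding_extends[OF \<sigma>.field_hom_axioms assms(4) this]
    obtain \<tau> where \<tau>: "field_hom \<tau>" "\<tau> \<circ> \<sigma> = emb" by blast
    have "primitive_tensor d (\<tau> \<circ> (\<sigma> \<circ> T))" using prim_emb \<tau>(2) by (simp add: comp_assoc[symmetric])
    thus ?thesis by (rule primitive_tensor_reflect[OF \<tau>(1)])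
  qed
  define \<theta>K where "\<theta>K \<sigma> = tensor_form (?e \<circ> (\<sigma> \<circ> T))" for \<sigma>
  have formK: "nondegenerate_multilinear_form (*s) d (\<theta>K \<sigma>)" if \<sigma>: "\<sigma> \<in> S" for \<sigma>
  proof -
    have "symmetric_tensor d (?e \<circ> (\<sigma> \<circ> T))" using sym_comp[of "?e \<circ> \<sigma>"] by (simp add: comp_assoc)
    moreover have "nondegenerate_tensor d (?e \<circ> (\<sigma> \<circ> T))"
      by (intro nondegenerate_tensor_extend nondegT e.field_hom_axioms homS \<sigma>)
    ultimately show ?thesis unfolding \<theta>K_def by (rule nondegenerate_multilinear_tensor_form[OF assms(1)])
  qed
  have primK: "X = 0 \<or> X = mat 1" if "\<sigma> \<in> S" "X ** X = X" "self_adjoint d (\<theta>K \<sigma>) ((*v) X)" for \<sigma> X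
    using primitive_tensor_ratfun[OF prim[OF that(1)], where 'n = 'n] that(2,3)
    unfolding primitive_tensor_def \<theta>K_def self_adjoint_matrix_iff by blast

  obtain P :: "('l \<Rightarrow> 'c) \<Rightarrow> 'c^('n::{finite,linorder})^'m" and Q :: "('l \<Rightarrow> 'c) \<Rightarrow> 'c^'m^('n::{finite,linorder})" and x where
    x: "\<And>j. b\<^sub>k j = (\<Sum>m\<in>UNIV. s (x j m) (b\<^sub>l m))" and P: "\<And>\<sigma> j m. P \<sigma> $ m $ j = \<sigma> (x j m)"
    and PQ: "\<And>\<sigma> \<tau>. \<sigma> \<in> S \<Longrightarrow> \<tau> \<in> S \<Longrightarrow> P \<tau> ** Q \<sigma> = (if \<tau> = \<sigma> then mat 1 else 0)"
    and QP: "(\<Sum>\<sigma>\<in>S. Q \<sigma> ** P \<sigma>) = mat 1"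
    unfolding S_def
    by (rule E.embedding_coordinate_matrices[OF V.vector_space_axioms Vk.vector_space_axioms assms(7,11)]) blast
  define PK where "PK \<sigma> = (\<chi> i j. ?e (P \<sigma> $ i $ j))" for \<sigma>
  define QK where "QK \<sigma> = (\<chi> i j. ?e (Q \<sigma> $ i $ j))" for \<sigma>
  have PQK: "PK \<tau> ** QK \<sigma> = (if \<tau> = \<sigma> then mat 1 else 0)" if "\<sigma> \<in> S" "\<tau> \<in> S" for \<sigma> \<tau>
    unfolding PK_def QK_def matrix_map_mult[OF e.field_hom_axioms] PQ[OF that]
  proof (cases "\<tau> = \<sigma>")
    case True
    thus "(\<chi> i j. ?e ((if \<tau> = \<sigma> then mat 1 else (0 :: 'c^'m^'m)) $ i $ j)) = (if \<tau> = \<sigma> then mat 1 else 0)"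
      by (simp add: matrix_map_one[OF e.field_hom_axioms])
  next
    case False
    thus "(\<chi> i j. ?e ((if \<tau> = \<sigma> then mat 1 else (0 :: 'c^'m^'m)) $ i $ j)) = (if \<tau> = \<sigma> then mat 1 else 0)"
      by (simp add: Finite_Cartesian_Product.vec_eq_iff)
  qed
  have QPK: "(\<Sum>\<sigma>\<in>S. QK \<sigma> ** PK \<sigma>) = mat 1"
  proof -
    have "(\<Sum>\<sigma>\<in>S. QK \<sigma> ** PK \<sigma>) = (\<chi> i j. ?e ((\<Sum>\<sigma>\<in>S. Q \<sigma> ** P \<sigma>) $ i $ j))"
      unfolding PK_def QK_def matrix_map_mult[OF e.field_hom_axioms]
      by (simp add: Finite_Cartesian_Product.vec_eq_iff e.hom_sum)
    thus ?thesis using matrix_map_one[OF e.field_hom_axioms] by (simp add: QP)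
  qed

  define g where "g = (generic_value h ?s b\<^sub>k d \<phi> :: ('c, 'n) ratfun)"
  define TK where "TK = (\<lambda>is. ?e (h (\<theta>k (map b\<^sub>k is))))"
  obtain M M' :: "('c, 'n) ratfun^('n::{finite,linorder})^('n::{finite,linorder})" where
    M: "M ** M' = mat 1" "M' ** M = mat 1"
    and M_isometry: "\<And>vs. length vs = d \<Longrightarrow>
      tensor_form (\<lambda>is. ?e (h (\<theta>k (map b\<^sub>k is)))) (map ((*v) M) vs) =
      generic_value h ?s b\<^sub>k d \<phi> * tensor_form (\<lambda>is. ?e (h (\<theta>k (map b\<^sub>k is)))) vs"
    by (rule isometry_base_change[OF char_k \<theta>k.symmetric_multilinear_form_axioms \<phi> assms(11) hom_h sm])
      (assumption | rule that)+
  have M3: "tensor_form TK (map ((*v) M) vs) = g * tensor_form TK vs" if "length vs = d" for vs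
    unfolding TK_def g_def using that by (rule M_isometry)
  \<comment> \<open>The extension of \<open>\<phi>\<close> to \<open>K\<close> is the orthogonal sum of the conjugates of \<open>\<Gamma>\<close>; both sides are
    multilinear, so it is enough to compare them on basis vectors, where the trace formula applies.\<close>
  have split: "tensor_form TK vs = (\<Sum>\<sigma>\<in>S. \<theta>K \<sigma> (map ((*v) (PK \<sigma>)) vs))" if len: "length vs = d" for vs
  proof -
    have "TK js = (\<Sum>\<sigma>\<in>S. \<theta>K \<sigma> (map ((*v) (PK \<sigma>)) (map (\<lambda>j. axis j 1) js)))" if "length js = d" for js
    proof -
      have "\<theta> (map b\<^sub>k js) = \<theta> ([] @ map (\<lambda>y. \<Sum>m\<in>UNIV. s (y m) (b\<^sub>l m)) (map x js))"
        by (simp add: comp_def flip: x)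
      also have "\<dots> = tensor_eval UNIV (\<lambda>is. \<theta> ([] @ map b\<^sub>l is)) (map x js)"
        by (rule \<theta>.tensor_eval_expand) (use that in auto)
      finally have js: "\<theta> (map b\<^sub>k js) = tensor_eval UNIV T (map x js)" by (simp add: T_def)
      have "?e (\<sigma> (\<theta> (map b\<^sub>k js))) = \<theta>K \<sigma> (map ((*v) (PK \<sigma>)) (map (\<lambda>j. axis j 1) js))" if "\<sigma> \<in> S" for \<sigma>
      proof -
        interpret \<sigma>: field_hom \<sigma> using homS that .
        have "map ((\<circ>) ?e) (map ((\<circ>) \<sigma>) (map x js)) =
            map vec_nth (map ((*v) (PK \<sigma>)) (map (\<lambda>j. axis j 1) js))"
          by (rule nth_equalityI) (auto simp: matrix_mult_axis PK_def P)
        thus ?thesis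
          unfolding js \<theta>K_def tensor_eval_hom[OF \<sigma>.comm_ring_hom_axioms] tensor_eval_hom[OF e.comm_ring_hom_axioms]
          by (simp only:)
      qed
      thus ?thesis by (simp add: TK_def \<theta>k_def tr e.hom_sum)
    qed
    hence "tensor_form TK vs = tensor_form (\<lambda>js. \<Sum>\<sigma>\<in>S. \<theta>K \<sigma> (map ((*v) (PK \<sigma>)) (map (\<lambda>j. axis j 1) js))) vs"
      by (intro tensor_eval_cong) (simp add: len)
    also have "\<dots> = (\<Sum>\<sigma>\<in>S. \<theta>K \<sigma> (map ((*v) (PK \<sigma>)) vs))"
      unfolding tensor_eval_sum
    proof (rule sum.cong[OF refl])
      fix \<sigma> assume "\<sigma> \<in> S"
      have "symmetric_multilinear_form (*s) UNIV d (\<theta>K \<sigma>)"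
        using formK[OF \<open>\<sigma> \<in> S\<close>] by (simp add: nondegenerate_multilinear_form_def)
      from multilinear_eq_tensor_form[OF symmetric_multilinear_form_pullback[OF this] len]
      show "tensor_form (\<lambda>is. \<theta>K \<sigma> (map ((*v) (PK \<sigma>)) (map (\<lambda>j. axis j 1) is))) vs =
          \<theta>K \<sigma> (map ((*v) (PK \<sigma>)) vs)" ..
    qed
    finally show ?thesis .
  qed
  have sim: "(\<Sum>\<sigma>\<in>S. \<theta>K \<sigma> (map (\<lambda>v. PK \<sigma> *v (M *v v)) vs)) = g * (\<Sum>\<sigma>\<in>S. \<theta>K \<sigma> (map ((*v) (PK \<sigma>)) vs))"
    if "length vs = d" for vs
    using M3[OF that] split[OF that] split[of "map ((*v) M) vs"] that by (simp add: comp_def)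

  \<comment> \<open>If the generic value were zero, \<open>\<phi>\<close> would vanish identically, and by polarisation every vector
    would be in its radical.\<close>
  have g0: "g \<noteq> 0"
  proof
    assume "g = 0"
    define p where "p = coordinate_poly ?s b\<^sub>k d \<phi>"
    have p: "p = tensor_poly UNIV (\<lambda>is. \<theta>k (map b\<^sub>k is)) d"
      unfolding p_def by (rule coordinate_poly_eq_tensor_poly[OF char_k Vk.vector_space_axioms smlk \<phi> assms(11)])
    have "Poly_Mapping.map h p = 0"
      using \<open>g = 0\<close> by (simp add: g_def generic_value_def p_def Zero_fract_def eq_fract)
    hence "h (Poly_Mapping.lookup p m) = 0" for m
      using lookup_map_poly_mapping[of h p m] by simp
    hence "p = 0" by (intro poly_mapping_eqI) simp
    have \<phi>0: "\<phi> v = 0" for v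
    proof -
      obtain y where y: "v = (\<Sum>i\<in>UNIV. ?s (y i) (b\<^sub>k i))"
        using basis_family_coordinates[OF Vk.vector_space_axioms assms(11)] by metis
      have "represented_by ?s UNIV b\<^sub>k d \<phi> p"
        unfolding p by (rule \<theta>k.represented_by_tensor_poly[OF assms(11)]) (rule \<phi>)
      thus ?thesis unfolding y by (simp add: represented_by_def \<open>p = 0\<close>)
    qed
    obtain \<psi> where \<psi>: "symmetric_multilinear_on ?s UNIV d \<psi>" "\<And>v. \<phi> v = \<psi> (replicate d v)"
      "\<And>v. (\<And>vs. length vs = d - 1 \<Longrightarrow> \<psi> (v # vs) = 0) \<Longrightarrow> v = 0"
      using assms(10) unfolding nondegenerate_form_on_def by auto
    interpret \<psi>: symmetric_multilinear_form ?s UNIV d \<psi> by unfold_locales (simp_all add: \<psi>(1))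
    have "b\<^sub>k undefined = 0"
    proof (rule \<psi>(3))
      fix vs :: "'v list" assume "length vs = d - 1"
      hence "length (b\<^sub>k undefined # vs) = d" using assms(1) by simp
      moreover have "\<psi> (replicate d v) = 0" for v using \<psi>(2)[of v] \<phi>0 by simp
      ultimately show "\<psi> (b\<^sub>k undefined # vs) = 0"
        using \<psi>.zero_if_diagonal_zero[OF refl char_k] by blast
    qed
    thus False using assms(11) Vk.dependent_zero[of "range b\<^sub>k"] by (auto simp: basis_family_def)
  qed

  obtain \<rho> where \<rho>: "\<rho> ` S \<subseteq> S" "inj_on \<rho> S"
    "\<And>\<sigma>. \<sigma> \<in> S \<Longrightarrow> \<exists>F F'. F ** F' = mat 1 \<and> F' ** F = mat 1 \<and>
       (\<forall>w. \<theta>K \<sigma> (replicate d (F *v w)) = g * \<theta>K (\<rho> \<sigma>) (replicate d w))"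
    by (rule similar_orthogonal_sums_permute_blocks[where S = S and d = d and \<theta> = \<theta>K and P = PK
          and Q = QK and f = M and f' = M' and g = g])
      (assumption | rule finS formK primK PQK QPK M g0 sim that)+
  \<comment> \<open>Following the permutation for \<open>i\<close> steps collects the factor \<open>g\<^sup>i\<close>.\<close>
  have iterate: "\<exists>F F'. F ** F' = mat 1 \<and> F' ** F = mat 1 \<and>
       (\<forall>w. \<theta>K emb (replicate d (F *v w)) = g ^ i * \<theta>K ((\<rho> ^^ i) emb) (replicate d w))" for i
  proof (induction i)
    case 0
    show ?case by (intro exI[of _ "mat 1"]) simp
  next
    case (Suc i)
    then obtain F F' where F: "F ** F' = mat 1" "F' ** F = mat 1"
      "\<And>w. \<theta>K emb (replicate d (F *v w)) = g ^ i * \<theta>K ((\<rho> ^^ i) emb) (replicate d w)" by blast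
    have "(\<rho> ^^ i) emb \<in> S" by (induction i) (use \<rho>(1) embS in auto)
    from \<rho>(3)[OF this] obtain G G' where G: "G ** G' = mat 1" "G' ** G = mat 1"
      "\<And>w. \<theta>K ((\<rho> ^^ i) emb) (replicate d (G *v w)) = g * \<theta>K (\<rho> ((\<rho> ^^ i) emb)) (replicate d w)" by blast
    have "(F ** G) ** (G' ** F') = F ** (G ** G') ** F'" "(G' ** F') ** (F ** G) = G' ** (F' ** F) ** G"
      by (simp_all only: matrix_mul_assoc)
    hence "(F ** G) ** (G' ** F') = mat 1" "(G' ** F') ** (F ** G) = mat 1"
      by (simp_all add: F G)
    moreover have "\<theta>K emb (replicate d ((F ** G) *v w)) = g ^ Suc i * \<theta>K ((\<rho> ^^ Suc i) emb) (replicate d w)" for w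
      using F(3)[of "G *v w"] G(3)[of w] by (simp add: matrix_vector_mul_assoc mult_ac)
    ultimately show ?case by blast
  qed
  obtain i where i: "1 \<le> i" "i \<le> n" "(\<rho> ^^ i) emb = emb"
    using injective_orbit_returns[OF finS \<rho>(1,2) embS] n by blast
  obtain F F' where F: "F ** F' = mat 1" "F' ** F = mat 1"
    "\<And>w. \<theta>K emb (replicate d (F *v w)) = g ^ i * \<theta>K emb (replicate d w)"
    using iterate[of i] i(3) by auto
  have ext: "scalar_extension (?e \<circ> emb) s b\<^sub>l d \<Gamma> w = \<theta>K emb (replicate d w)" for w
  proof -
    have "comm_ring_hom (?e \<circ> emb)"
      by unfold_locales (simp_all add: emb.hom_add emb.hom_mult e.hom_add e.hom_mult)
    from scalar_extension_eq_tensor_eval[OF char_l V.vector_space_axioms \<theta>(1,2) assms(7) this]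
    show ?thesis by (simp add: \<theta>K_def T_def comp_def)
  qed
  have "bij ((*v) F)"
    by (rule o_bij[of "(*v) F'"]) (simp_all add: fun_eq_iff matrix_vector_mul_assoc F)
  hence "isomorphic_forms (*s) UNIV (\<lambda>v. g ^ i * scalar_extension (?e \<circ> emb) s b\<^sub>l d \<Gamma> v)
      (*s) UNIV (scalar_extension (?e \<circ> emb) s b\<^sub>l d \<Gamma>)"
    unfolding isomorphic_forms_def ext using F(3)
    by (intro exI[of _ "(*v) F"]) auto
  hence "g ^ i \<in> similarity_factors (*s) UNIV (scalar_extension (?e \<circ> emb) s b\<^sub>l d \<Gamma>)"
    using g0 by (simp add: similarity_factors_def)
  thus False using assms(14)[OF i(1,2)] by (simp add: g_def h_def)
qed

end
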